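(* Let $T>0$, let $[a,b]$ be a non-trivial segment of $\mathbb{T}$ and $\omega=(-1,1)\times(\mathbb{T}\setminus[a,b])$. For $\alpha>0$, let $$\mathcal{A}_\alpha=\Big\{\sum_{n\ge0}a_n(x)e^{iny}:\ \sum_{n\ge0}|a_n|^2_{L^2(-1,1)}e^{2\alpha n}<+\infty\Big\}.$$ Then, for every $\alpha>0$, there exists an initial condition $f_\alpha\in\mathcal{A}_\alpha$ that cannot be steered to $0$ in time $T$ by means of $L^2$ controls localized in $\omega$ for the Grushin equation on $\Omega=(-1,1)\times\mathbb{T}$.
   Context: $\mathbb{T}=\mathbb{R}/2\pi\mathbb{Z}$, $\Omega=(-1,1)\times\mathbb{T}$. An initial condition $f_0\in L^2(\Omega)$ can be steered to $0$ in time $T$ by an $L^2$ control localized in $\omega$ for the Grushin equation if there exists $u\in L^2([0,T]\times\omega)$ such that the solution $f$ of $(\partial_t-\partial_x^2-x^2\partial_y^2)f=\mathbf 1_\omega u$ on $[0,T]\times\Omega$, $f=0$ on $[0,T]\times\partial\Omega$, $f(0,\cdot,\cdot)=f_0$, satisfies $f(T,\cdot,\cdot)=0$ on $\Omega$. *)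

theory Defs
  imports "HOL-Analysis.Analysis"
begin

text \<open>The circle \<open>\<real>/2\<pi>\<int>\<close> is represented by the fundamental domain \<open>[0, 2\<pi>)\<close>. An \<open>L\<^sup>2\<close> function
  is represented by any of its Borel measurable representatives, with arbitrary values outside its
  domain.\<close>

definition Omega :: "(real \<times> real) set" where
  "Omega = {-1<..<1} \<times> {0..<2 * pi}"

text \<open>\<open>(-1, 1) \<times> (\<real>/2\<pi>\<int> \<setminus> [a, b])\<close>, where \<open>[a, b]\<close> is the image in the circle of the real interval.\<close>

definition omega :: "real \<Rightarrow> real \<Rightarrow> (real \<times> real) set" where
  "omega a b = {(x, y) \<in> Omega. \<not> (\<exists>k::int. y + 2 * pi * of_int k \<in> {a..b})}"

definition L2 :: "'a::euclidean_space set \<Rightarrow> ('a \<Rightarrow> complex) set" where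
  "L2 S = {f. f \<in> borel_measurable (restrict_space lborel S) \<and>
              set_integrable lborel S (\<lambda>p. (norm (f p))\<^sup>2)}"

definition L2_normsq :: "'a::euclidean_space set \<Rightarrow> ('a \<Rightarrow> complex) \<Rightarrow> real" where
  "L2_normsq S f = (LINT p:S|lborel. (norm (f p))\<^sup>2)"

definition L2_inner :: "'a::euclidean_space set \<Rightarrow> ('a \<Rightarrow> complex) \<Rightarrow> ('a \<Rightarrow> complex) \<Rightarrow> complex" where
  "L2_inner S f g = (LINT p:S|lborel. f p * cnj (g p))"

definition L2_tendsto ::
  "'a::euclidean_space set \<Rightarrow> ('i \<Rightarrow> 'a \<Rightarrow> complex) \<Rightarrow> ('a \<Rightarrow> complex) \<Rightarrow> 'i filter \<Rightarrow> bool" where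
  "L2_tendsto S F f \<F> \<longleftrightarrow> ((\<lambda>i. L2_normsq S (\<lambda>p. F i p - f p)) \<longlongrightarrow> 0) \<F>"

text \<open>\<open>\<phi>\<close> is a \<open>C\<^sup>1\<close> function with compact support in \<open>(-1, 1) \<times> \<real>/2\<pi>\<int>\<close>, lifted to the plane and
  extended by \<open>0\<close>; \<open>\<phi>x\<close> and \<open>\<phi>y\<close> are its partial derivatives.\<close>

definition C1_compact_support ::
  "(real \<times> real \<Rightarrow> complex) \<Rightarrow> (real \<times> real \<Rightarrow> complex) \<Rightarrow> (real \<times> real \<Rightarrow> complex) \<Rightarrow> bool" where
  "C1_compact_support \<phi> \<phi>x \<phi>y \<longleftrightarrow>
     (\<forall>p. (\<phi> has_derivative (\<lambda>(v, w). v *\<^sub>R \<phi>x p + w *\<^sub>R \<phi>y p)) (at p)) \<and>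
     continuous_on UNIV \<phi>x \<and> continuous_on UNIV \<phi>y \<and>
     (\<forall>x y. \<phi> (x, y + 2 * pi) = \<phi> (x, y)) \<and>
     (\<exists>r<1. \<forall>x y. \<bar>x\<bar> > r \<longrightarrow> \<phi> (x, y) = 0)"

text \<open>\<open>h\<close> belongs to the form domain \<open>V\<close> of the Grushin operator with Dirichlet condition, i.e. the
  closure of the compactly supported test functions in the norm
  \<open>(\<parallel>h\<parallel>\<^sup>2 + \<parallel>\<partial>\<^sub>x h\<parallel>\<^sup>2 + \<parallel>x \<partial>\<^sub>y h\<parallel>\<^sup>2)\<^sup>1\<^sup>/\<^sup>2\<close>, and \<open>gx = \<partial>\<^sub>x h\<close>, \<open>gy = x \<partial>\<^sub>y h\<close> in the weak sense.
  By mollification, \<open>C\<^sup>1\<close> and \<open>C\<^sup>\<infinity>\<close> test functions have the same closure.\<close>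

definition in_form_domain ::
  "(real \<times> real \<Rightarrow> complex) \<Rightarrow> (real \<times> real \<Rightarrow> complex) \<Rightarrow> (real \<times> real \<Rightarrow> complex) \<Rightarrow> bool" where
  "in_form_domain h gx gy \<longleftrightarrow>
     h \<in> L2 Omega \<and> gx \<in> L2 Omega \<and> gy \<in> L2 Omega \<and>
     (\<exists>\<phi> \<phi>x \<phi>y. (\<forall>n::nat. C1_compact_support (\<phi> n) (\<phi>x n) (\<phi>y n)) \<and>
        L2_tendsto Omega \<phi> h sequentially \<and>
        L2_tendsto Omega \<phi>x gx sequentially \<and>
        L2_tendsto Omega (\<lambda>n (x, y). x *\<^sub>R \<phi>y n (x, y)) gy sequentially)"

text \<open>\<open>f\<close> is the weak solution, in \<open>C([0,T]; L\<^sup>2(\<Omega>)) \<inter> L\<^sup>2(0,T; V)\<close>, of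
  \<open>(\<partial>\<^sub>t - \<partial>\<^sub>x\<^sup>2 - x\<^sup>2 \<partial>\<^sub>y\<^sup>2) f = 1\<^sub>W u\<close> with \<open>f = 0\<close> on the boundary and \<open>f(0) = f0\<close>: for every \<open>h\<close> in \<open>V\<close>,
  \<open>d/dt \<langle>f(t), h\<rangle> + \<langle>\<partial>\<^sub>x f(t), \<partial>\<^sub>x h\<rangle> + \<langle>x \<partial>\<^sub>y f(t), x \<partial>\<^sub>y h\<rangle> = \<langle>1\<^sub>W u(t), h\<rangle>\<close>, integrated in time.
  The Dirichlet condition is the membership of \<open>f(t)\<close> in \<open>V\<close>. Such an \<open>f\<close> exists and is unique for
  all \<open>f0\<close> in \<open>L\<^sup>2(\<Omega>)\<close> and \<open>u\<close> in \<open>L\<^sup>2([0,T] \<times> W)\<close>.\<close>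

definition grushin_solution ::
  "real \<Rightarrow> (real \<times> real) set \<Rightarrow> (real \<times> real \<times> real \<Rightarrow> complex) \<Rightarrow> (real \<times> real \<Rightarrow> complex) \<Rightarrow>
   (real \<Rightarrow> real \<times> real \<Rightarrow> complex) \<Rightarrow> bool" where
  "grushin_solution T W u f0 f \<longleftrightarrow>
     (\<forall>t\<in>{0..T}. f t \<in> L2 Omega \<and> L2_tendsto Omega f (f t) (at t within {0..T})) \<and>
     (AE p\<in>Omega in lborel. f 0 p = f0 p) \<and>
     (\<exists>gx gy. gx \<in> L2 ({0..T} \<times> Omega) \<and> gy \<in> L2 ({0..T} \<times> Omega) \<and>
        (AE t\<in>{0..T} in lborel. in_form_domain (f t) (\<lambda>p. gx (t, p)) (\<lambda>p. gy (t, p))) \<and>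
        (\<forall>h hx hy. in_form_domain h hx hy \<longrightarrow> (\<forall>t\<in>{0..T}.
           L2_inner Omega (f t) h - L2_inner Omega f0 h
             + L2_inner ({0..t} \<times> Omega) gx (\<lambda>(s, p). hx p)
             + L2_inner ({0..t} \<times> Omega) gy (\<lambda>(s, p). hy p)
           = L2_inner ({0..t} \<times> W) u (\<lambda>(s, p). h p))))"

definition steerable_to_zero ::
  "real \<Rightarrow> (real \<times> real) set \<Rightarrow> (real \<times> real \<Rightarrow> complex) \<Rightarrow> bool" where
  "steerable_to_zero T W f0 \<longleftrightarrow>
     (\<exists>u \<in> L2 ({0..T} \<times> W). \<exists>f. grushin_solution T W u f0 f \<and> (AE p\<in>Omega in lborel. f T p = 0))"

definition analytic_space :: "real \<Rightarrow> (real \<times> real \<Rightarrow> complex) set" where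
  "analytic_space \<alpha> = {f \<in> L2 Omega. \<exists>a :: nat \<Rightarrow> real \<Rightarrow> complex.
     (\<forall>n. a n \<in> L2 {-1<..<1}) \<and>
     summable (\<lambda>n. L2_normsq {-1<..<1} (a n) * exp (2 * \<alpha> * real n)) \<and>
     L2_tendsto Omega (\<lambda>N (x, y). \<Sum>n<N. a n x * exp (\<i> * of_nat n * of_real y)) f sequentially}"

end

theory Submission
  imports Defs "HOL-Complex_Analysis.Complex_Analysis"
begin

text \<open>
  Testing the equation with \<open>cnj (v\<^sub>n x) e\<^bsup>iny\<^esup>\<close>, where \<open>v\<^sub>n\<close> is the Dirichlet ground state of \<open>- d\<^sup>2/dx\<^sup>2 + n\<^sup>2 x\<^sup>2\<close> on
  \<open>(-1, 1)\<close> and \<open>\<lambda>\<^sub>n = n + \<mu>\<^sub>n\<close> its eigenvalue, a control \<open>u\<close> steering \<open>f\<^sub>0\<close> to \<open>0\<close> satisfies, for every \<open>n\<close>,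
  \<open>\<langle>f\<^sub>0, cnj (v\<^sub>n) e\<^bsup>iny\<^esup>\<rangle> + \<integral>\<integral> u(s, x, y) e\<^bsup>\<lambda>\<^sub>n s\<^esup> v\<^sub>n(x) e\<^bsup>-iny\<^esup> = 0\<close>.
  Take \<open>f\<^sub>0 = \<Sum> e\<^bsup>-\<beta>n\<^esup> e\<^bsup>-inc\<^esup> cnj (v\<^sub>n) e\<^bsup>iny\<^esup>\<close> with \<open>c\<close> the midpoint of \<open>[a, b]\<close> and \<open>\<beta>\<close> large, multiply by
  \<open>e\<^bsup>inc\<^esup> e\<^bsup>(\<beta>+1)n\<^esup> n\<^bsup>-\<epsilon>n\<^esup>\<close> and sum over \<open>n\<close>. The first term becomes a sum of positive numbers that grow like \<open>e\<^sup>n\<close> as \<open>\<epsilon>\<close> tends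
  to \<open>0\<close>. In the second, \<open>y - c = \<theta> + \<pi>\<close> modulo \<open>2\<pi>\<close> with \<open>|\<theta>| \<le> \<pi> - (b - a)/2\<close> on \<open>\<omega>\<close>, so the sums have the form
  \<open>\<Sum> (-1)\<^sup>n \<Psi>(n) n\<^bsup>-\<epsilon>n\<^esup>\<close>. As \<open>v\<^sub>n\<close> and \<open>\<mu>\<^sub>n\<close> extend holomorphically to \<open>{Re N > R, |Im N| < k Re N}\<close> for every \<open>k\<close> (with \<open>R\<close> depending
  on \<open>k\<close>), \<open>\<Psi>\<close> is holomorphic there with growth at most \<open>e\<^bsup>L Re N + (\<pi> - (b - a)/2) |Im N|\<^esup>\<close>. Lindelof's method, the residue theorem for
  \<open>\<Psi>(N) N\<^bsup>-\<epsilon>N\<^esup> \<pi> / sin (\<pi>N)\<close>, then bounds these sums uniformly in \<open>\<epsilon>\<close>: a contradiction.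
\<close>

subsection \<open>The ground state of the complex harmonic oscillator\<close>

text \<open>Why every aperture \<open>k\<close>: \<open>1 / sin (\<pi> N)\<close> decays like
  e^(-\<pi> |Im N|), so against the angular factor only (b - a)/2 per unit of |Im N| is left. On the
  sides of the contour this must outweigh e^(L Re N), where L contains \<alpha> and T; the slope k
  has to be of the order of L divided by b - a. A larger T only opens the contour further, hence the
  result for arbitrary T. The obstacle is the eigenvalue for complex N, where - d^2/dx^2 + N^2 x^2
  is no longer self-adjoint and variational arguments fail. Existence and holomorphy of \<mu> come
  instead from quantitative estimates for the equation of w. The decisive comparison: the derivative
  of w(1) in \<mu> has size at least of order e^r / r^(3/2) with r = Re N, while the linearisation
  error on the unit disc is of order e^r / r^2. The gain is only a power of r, whence the large
  explicit lower limit R. On the other side of the identity all terms are nonnegative, so a single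
  term gives the contradiction, and a lower bound for the norm of \<open>v\<^sub>n\<close> by a
  power of n is enough.\<close>

text \<open>The function \<open>exp (- N x\<^sup>2 / 2) w(x)\<close> solves \<open>- v'' + N\<^sup>2 x\<^sup>2 v = (N + \<mu>) v\<close> iff \<open>w'' = 2 N x w' - \<mu> w\<close>. These are the
  Taylor coefficients of the even solution \<open>w\<close>.\<close>

fun wc :: "complex \<Rightarrow> complex \<Rightarrow> nat \<Rightarrow> complex" where
  "wc N \<mu> 0 = 1"
| "wc N \<mu> (Suc 0) = 0"
| "wc N \<mu> (Suc (Suc n)) = wc N \<mu> n * (2 * N * of_nat n - \<mu>) / (of_nat (Suc (Suc n)) * of_nat (Suc n))"

definition wfun :: "complex \<Rightarrow> complex \<Rightarrow> complex \<Rightarrow> complex" where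
  "wfun N \<mu> z = (\<Sum>n. wc N \<mu> n * z ^ n)"

definition wfun' :: "complex \<Rightarrow> complex \<Rightarrow> complex \<Rightarrow> complex" where
  "wfun' N \<mu> z = (\<Sum>n. diffs (wc N \<mu>) n * z ^ n)"

text \<open>The Taylor coefficients of exp (A z^2), the majorant of the power series of w.\<close>

definition wbound :: "real \<Rightarrow> nat \<Rightarrow> real" where
  "wbound A n = (if even n then A ^ (n div 2) / fact (n div 2) else 0)"

lemma wbound_nonneg: "A \<ge> 0 \<Longrightarrow> wbound A n \<ge> 0"
  by (auto simp: wbound_def)

text \<open>The recurrence multiplies by at most 2 A (n + 1) / ((n + 1)(n + 2)) = 2 A / (n + 2),
  which is exactly the ratio of consecutive even coefficients of exp (A z^2).\<close>

lemma wc_bound: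
  assumes A: "2 * norm N + norm \<mu> \<le> 2 * A"
  shows "norm (wc N \<mu> n) \<le> wbound A n"
  using A
proof (induction N \<mu> n rule: wc.induct)
  case (3 N \<mu> n)
  have A0: "A \<ge> 0" using 3(2) norm_ge_zero[of N] norm_ge_zero[of \<mu>] by linarith
  have "norm (2 * N * of_nat n - \<mu>) \<le> 2 * norm N * real n + norm \<mu>"
    by (rule order_trans[OF norm_triangle_ineq4]) (simp add: norm_mult)
  also have "\<dots> \<le> 2 * norm N * real (Suc n) + norm \<mu> * real (Suc n)"
    by (intro add_mono mult_left_mono) (auto simp: algebra_simps)
  also have "\<dots> = (2 * norm N + norm \<mu>) * real (Suc n)" by (simp add: algebra_simps)
  also have "\<dots> \<le> 2 * A * real (Suc n)" using 3(2) by (intro mult_right_mono) auto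
  finally have 1: "norm (2 * N * of_nat n - \<mu>) \<le> 2 * A * real (Suc n)" .
  have "norm (wc N \<mu> (Suc (Suc n))) = norm (wc N \<mu> n) * norm (2 * N * of_nat n - \<mu>) / (real (Suc (Suc n)) * real (Suc n))"
    by (simp only: wc.simps norm_mult norm_divide norm_of_nat)
  also have "\<dots> \<le> wbound A n * (2 * A * real (Suc n)) / (real (Suc (Suc n)) * real (Suc n))"
    using 3 1 wbound_nonneg[OF A0] by (intro divide_right_mono mult_mono) auto
  also have "\<dots> = wbound A n * (2 * A) / real (Suc (Suc n))" by (simp del: of_nat_Suc)
  also have "\<dots> = wbound A (Suc (Suc n))"
  proof (cases "even n")
    case True
    then obtain m where "n = 2 * m" by blast
    then show ?thesis by (simp add: wbound_def divide_simps)
  qed (simp add: wbound_def)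
  finally show ?case .
qed (auto simp: wbound_def)

lemma wbound_summable: "summable (\<lambda>n. wbound A n * r ^ n)"
proof -
  have "(\<lambda>n. if even n then (A * r^2) ^ (n div 2) / fact (n div 2) else 0) sums (exp (A * r^2))"
    using sums_if[OF sums_zero exp_converges[of "A * r^2"]]
    by (simp add: divide_inverse mult.commute cong: if_cong)
  moreover have "(if even n then (A * r^2) ^ (n div 2) / fact (n div 2) else 0) = wbound A n * r ^ n" for n
    by (auto simp: wbound_def power_mult_distrib power_mult[symmetric])
  ultimately show ?thesis by (simp add: sums_iff)
qed

lemma wc_summable: "summable (\<lambda>n. wc N \<mu> n * z ^ n)"
proof (rule summable_comparison_test'[where N = 0])
  show "summable (\<lambda>n. wbound ((2 * norm N + norm \<mu>) / 2) n * norm z ^ n)" by (rule wbound_summable)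
  show "norm (wc N \<mu> n * z ^ n) \<le> wbound ((2 * norm N + norm \<mu>) / 2) n * norm z ^ n" for n
    using wc_bound[of N \<mu> "(2 * norm N + norm \<mu>) / 2" n]
    by (simp add: norm_mult norm_power mult_right_mono)
qed

lemma wfun_deriv: "(wfun N \<mu> has_field_derivative wfun' N \<mu> z) (at z)"
  unfolding wfun_def [abs_def] wfun'_def
  by (rule termdiffs_strong_converges_everywhere) (rule wc_summable)

lemma wfun'_deriv: "(wfun' N \<mu> has_field_derivative 2 * N * z * wfun' N \<mu> z - \<mu> * wfun N \<mu> z) (at z)"
proof -
  have s1: "summable (\<lambda>n. diffs (wc N \<mu>) n * z ^ n)" for z :: complex
    by (rule termdiff_converges_all) (rule wc_summable)
  have "(wfun' N \<mu> has_field_derivative (\<Sum>n. diffs (diffs (wc N \<mu>)) n * z ^ n)) (at z)"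
    unfolding wfun'_def [abs_def]
    by (rule termdiffs_strong_converges_everywhere) (rule s1)
  moreover have "(\<lambda>n. diffs (diffs (wc N \<mu>)) n * z ^ n) sums (2 * N * z * wfun' N \<mu> z - \<mu> * wfun N \<mu> z)"
  proof -
    have "(\<lambda>n. of_nat n * wc N \<mu> n * z ^ (n - Suc 0)) sums wfun' N \<mu> z"
      unfolding wfun'_def by (rule diffs_equiv[OF s1])
    then have "(\<lambda>n. z * (of_nat n * wc N \<mu> n * z ^ (n - Suc 0))) sums (z * wfun' N \<mu> z)"
      by (rule sums_mult)
    moreover have "z * (of_nat n * wc N \<mu> n * z ^ (n - Suc 0)) = of_nat n * wc N \<mu> n * z ^ n" for n
      by (cases n) auto
    ultimately have "(\<lambda>n. of_nat n * wc N \<mu> n * z ^ n) sums (z * wfun' N \<mu> z)" by simp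
    then have "(\<lambda>n. 2 * N * (of_nat n * wc N \<mu> n * z ^ n) - \<mu> * (wc N \<mu> n * z ^ n)) sums
        (2 * N * (z * wfun' N \<mu> z) - \<mu> * wfun N \<mu> z)"
      unfolding wfun_def by (intro sums_diff sums_mult summable_sums wc_summable)
    moreover have "2 * N * (of_nat n * wc N \<mu> n * z ^ n) - \<mu> * (wc N \<mu> n * z ^ n) = diffs (diffs (wc N \<mu>)) n * z ^ n" for n
    proof -
      have ne: "of_nat (Suc (Suc n)) * of_nat (Suc n) \<noteq> (0::complex)"
        by (metis mult_eq_0_iff nat.distinct(1) of_nat_eq_0_iff)
      have "diffs (diffs (wc N \<mu>)) n = (of_nat (Suc (Suc n)) * of_nat (Suc n)) * wc N \<mu> (Suc (Suc n))"
        unfolding diffs_def by (simp only: mult_ac)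
      also have "\<dots> = wc N \<mu> n * (2 * N * of_nat n - \<mu>)"
        unfolding wc.simps using ne by (simp only: times_divide_eq_right nonzero_mult_div_cancel_left not_False_eq_True)
      finally show ?thesis by (simp only:) (simp add: algebra_simps)
    qed
    ultimately show ?thesis by (simp add: mult.assoc)
  qed
  ultimately show ?thesis by (simp add: sums_iff)
qed

lemma wfun_0 [simp]: "wfun N \<mu> 0 = 1"
  unfolding wfun_def by (subst powser_zero) simp

lemma wfun'_0 [simp]: "wfun' N \<mu> 0 = 0"
  unfolding wfun'_def by (subst powser_zero) (simp add: diffs_def)

text \<open>At \<mu> = 0 the recurrence stops at the constant term. This exact value is the base
  point of the linearisation in \<mu>.\<close>

lemma wfun_mu_0: "wfun N 0 z = 1"
proof -
  have "wc N 0 n = (if n = 0 then 1 else 0)" for n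
  proof -
    have "\<mu> = 0 \<longrightarrow> wc N \<mu> n = (if n = 0 then 1 else 0)" for \<mu>
      by (induction N \<mu> n rule: wc.induct) auto
    then show ?thesis by blast
  qed
  then have "(\<lambda>n. wc N 0 n * z ^ n) = (\<lambda>n. if n = 0 then 1 else 0)" by auto
  then show ?thesis unfolding wfun_def using sums_If_finite_set[of "{0}" "\<lambda>_. 1::complex"]
    by (simp add: sums_iff)
qed

text \<open>Each coefficient is a polynomial in N and g(N), and on a closed ball all coefficients
  share one majorant, so the partial sums converge uniformly there. The parameter depends on N
  through \<open>g\<close> because the result is applied to the eigenvalue correction and to its
  iterates.\<close>

lemma wfun_holomorphic:
  assumes S: "open S" and g: "g holomorphic_on S"
  shows "(\<lambda>N. wfun N (g N) z) holomorphic_on S"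
proof (rule holomorphic_uniform_sequence[OF S])
  show "(\<lambda>N. \<Sum>i<n. wc N (g N) i * z ^ i) holomorphic_on S" for n
  proof -
    \<comment> \<open>The recurrence has step two, so the induction carries two consecutive
      coefficients.\<close>
    have "(\<lambda>N. wc N (g N) i) holomorphic_on S \<and> (\<lambda>N. wc N (g N) (Suc i)) holomorphic_on S" for i
    proof (induction i)
      case (Suc i)
      have "(\<lambda>N. wc N (g N) (Suc (Suc i))) holomorphic_on S"
        unfolding wc.simps using Suc
        by (intro holomorphic_intros g) (auto simp del: of_nat_Suc)
      then show ?case using Suc by blast
    qed auto
    then show ?thesis by (intro holomorphic_intros) blast
  qed
  show "\<exists>d>0. cball x d \<subseteq> S \<and>
       uniform_limit (cball x d) (\<lambda>n N. \<Sum>i<n. wc N (g N) i * z ^ i) (\<lambda>N. wfun N (g N) z) sequentially"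
    if xS: "x \<in> S" for x
  proof -
    obtain d where d: "d > 0" "cball x d \<subseteq> S" using S xS unfolding open_contains_cball by blast
    have "continuous_on (cball x d) g"
      by (rule continuous_on_subset[OF holomorphic_on_imp_continuous_on[OF g] d(2)])
    then have "compact (g ` cball x d)" by (intro compact_continuous_image) auto
    then have "bounded (g ` cball x d)" by (rule compact_imp_bounded)
    then obtain B where B: "\<forall>y\<in>g ` cball x d. norm y \<le> B" unfolding bounded_iff by blast
    define A where "A = norm x + d + B"
    have "uniform_limit (cball x d) (\<lambda>n N. \<Sum>i<n. wc N (g N) i * z ^ i) (\<lambda>N. \<Sum>i. wc N (g N) i * z ^ i) sequentially"
    proof (rule Weierstrass_m_test)
      show "summable (\<lambda>n. wbound A n * norm z ^ n)" by (rule wbound_summable)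
      show "norm (wc N (g N) n * z ^ n) \<le> wbound A n * norm z ^ n" if "N \<in> cball x d" for n N
      proof -
        have "norm N \<le> norm x + d" using that norm_triangle_sub[of N x] by (simp add: dist_norm norm_minus_commute)
        moreover have gB: "norm (g N) \<le> B" using B that by auto
        moreover have "0 \<le> B" by (rule order_trans[OF norm_ge_zero gB])
        ultimately have "2 * norm N + norm (g N) \<le> 2 * A" by (simp add: A_def)
        from wc_bound[OF this] show ?thesis by (simp add: norm_mult norm_power mult_right_mono)
      qed
    qed
    with d show ?thesis unfolding wfun_def by (intro exI[of _ d] conjI)
  qed
qed

section \<open>Weighted estimates of w on the unit interval\<close>

definition wr :: "complex \<Rightarrow> complex \<Rightarrow> real \<Rightarrow> complex" where
  "wr N \<mu> x = wfun N \<mu> (of_real x)"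

definition wr' :: "complex \<Rightarrow> complex \<Rightarrow> real \<Rightarrow> complex" where
  "wr' N \<mu> x = wfun' N \<mu> (of_real x)"

lemma vector_derivative_of_real:
  assumes "(f has_field_derivative f') (at (of_real x :: complex))"
  shows "((\<lambda>x. f (of_real x)) has_vector_derivative f') (at x within S)"
proof -
  have "((\<lambda>x. complex_of_real x) has_vector_derivative 1) (at x within S)"
    using has_vector_derivative_of_real[OF DERIV_ident] by simp
  from field_vector_diff_chain_within[OF this has_field_derivative_at_within[OF assms]]
  show ?thesis by (simp add: o_def)
qed

lemma continuous_on_vector_derivative_at:
  assumes "\<And>x. (f has_vector_derivative f' x) (at x)"
  shows "continuous_on S f"
  by (rule continuous_on_vector_derivative) (rule has_vector_derivative_at_within[OF assms])

lemma wr_deriv: "(wr N \<mu> has_vector_derivative wr' N \<mu> x) (at x within S)"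
  unfolding wr_def [abs_def] wr'_def by (rule vector_derivative_of_real) (rule wfun_deriv)

lemma wr'_deriv: "(wr' N \<mu> has_vector_derivative 2 * N * of_real x * wr' N \<mu> x - \<mu> * wr N \<mu> x) (at x within S)"
  unfolding wr_def wr'_def [abs_def] by (rule vector_derivative_of_real) (rule wfun'_deriv)

lemma wr_0 [simp]: "wr N \<mu> 0 = 1" "wr' N \<mu> 0 = 0"
  by (auto simp: wr_def wr'_def)

lemma wr_cont: "continuous_on S (wr N \<mu>)" "continuous_on S (wr' N \<mu>)"
  by (rule continuous_on_vector_derivative, rule wr_deriv)
     (rule continuous_on_vector_derivative, rule wr'_deriv)

lemma norm_exp_minus: "norm (exp (- N * of_real (s::real))) = exp (- Re N * s)"
  by (simp add: norm_exp_eq_Re)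

text \<open>The equation reads \<open>(exp (- N x\<^sup>2) F')' = exp (- N x\<^sup>2) q\<close>, and is integrated twice.\<close>

lemma weighted_ode_bound:
  fixes F F' q :: "real \<Rightarrow> complex"
  assumes F: "\<And>x. (F has_vector_derivative F' x) (at x)"
    and F': "\<And>x. (F' has_vector_derivative 2 * N * of_real x * F' x + q x) (at x)"
    and 0: "F 0 = 0" "F' 0 = 0"
    and q: "\<And>x. 0 \<le> x \<Longrightarrow> x \<le> 1 \<Longrightarrow> norm (q x) \<le> M * exp (r * x\<^sup>2)"
    and r: "r = Re N" "r > 0" and x: "0 \<le> x" "x \<le> 1"
  shows "norm (F x) \<le> M * (exp (r * x\<^sup>2) - 1) / (2 * r)"
proof -
  have M: "M \<ge> 0" using order_trans[OF norm_ge_zero q[of 0]] by simp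
  have 1: "norm (F' x) \<le> M * x * exp (r * x\<^sup>2)" if x: "0 \<le> x" "x \<le> 1" for x
  proof (cases "x = 0")
    case False
    define g where "g s = exp (- N * of_real (s\<^sup>2)) * F' s" for s :: real
    have gd: "(g has_vector_derivative exp (- N * of_real (s\<^sup>2)) * q s) (at s)" for s
    proof -
      have "((\<lambda>z. exp (- N * z\<^sup>2)) has_field_derivative exp (- N * (of_real s)\<^sup>2) * (- N * (2 * of_real s))) (at (of_real s))"
        by (auto intro!: derivative_eq_intros)
      from vector_derivative_of_real[OF this]
      have "((\<lambda>s. exp (- N * of_real (s\<^sup>2))) has_vector_derivative exp (- N * of_real (s\<^sup>2)) * (- N * (2 * of_real s))) (at s)"
        by simp
      from has_vector_derivative_mult[OF this F'[of s]]
      have "((\<lambda>s. exp (- N * of_real (s\<^sup>2)) * F' s) has_vector_derivative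
         exp (- N * of_real (s\<^sup>2)) * (2 * N * of_real s * F' s + q s) + exp (- N * of_real (s\<^sup>2)) * (- N * (2 * of_real s)) * F' s) (at s)" .
      then show ?thesis unfolding g_def [abs_def] by (simp add: algebra_simps)
    qed
    have "norm (g x - g 0) \<le> M * x - M * 0"
    proof (rule differentiable_bound_general)
      show "0 < x" using x False by simp
      show "continuous_on {0..x} g"
        by (rule continuous_on_vector_derivative_at) (rule gd)
      show "(g has_vector_derivative exp (- N * of_real (s\<^sup>2)) * q s) (at s)" for s by (rule gd)
      show "((*) M has_vector_derivative M) (at s)" for s by (auto intro!: derivative_eq_intros)
      show "norm (exp (- N * of_real (s\<^sup>2)) * q s) \<le> M" if "0 < s" "s < x" for s
      proof -
        have "norm (exp (- N * of_real (s\<^sup>2)) * q s) \<le> exp (- r * s\<^sup>2) * (M * exp (r * s\<^sup>2))"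
          unfolding norm_mult norm_exp_minus r(1) using q[of s] that x r by (intro mult_left_mono) auto
        also have "\<dots> = M" by (simp add: exp_minus)
        finally show ?thesis .
      qed
    qed (auto intro!: continuous_intros)
    then have "exp (- r * x\<^sup>2) * norm (F' x) \<le> M * x"
      using 0 by (simp add: g_def norm_mult norm_exp_minus[of N "x\<^sup>2", simplified] r(1))
    then show ?thesis by (simp add: exp_minus field_simps)
  qed (use 0 in simp)
  show ?thesis
  proof (cases "x = 0")
    case False
    \<comment> \<open>The second integration gains a factor 1/(2r), because s exp (r s^2) is an
      exact derivative up to 2r. All smallness for large Re N comes from this gain.\<close>
    have "norm (F x - F 0) \<le> M * (exp (r * x\<^sup>2) - 1) / (2 * r) - M * (exp (r * 0\<^sup>2) - 1) / (2 * r)"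
    proof (rule differentiable_bound_general)
      show "0 < x" using x False by simp
      show "continuous_on {0..x} F"
        by (rule continuous_on_vector_derivative_at) (rule F)
      show "(F has_vector_derivative F' s) (at s)" for s by (rule F)
      show "((\<lambda>x. M * (exp (r * x\<^sup>2) - 1) / (2 * r)) has_vector_derivative M * s * exp (r * s\<^sup>2)) (at s)" for s
        unfolding has_real_derivative_iff_has_vector_derivative[symmetric] using r
        by (auto intro!: derivative_eq_intros simp: field_simps)
      show "norm (F' s) \<le> M * s * exp (r * s\<^sup>2)" if "0 < s" "s < x" for s
        using 1[of s] that x by simp
    qed (use r in \<open>auto intro!: continuous_intros\<close>)
    then show ?thesis using 0 by simp
  qed (use 0 in simp)
qed

text \<open>A self-improving bound: the maximum \<open>M\<close> of \<open>|F| exp (- r x\<^sup>2)\<close> satisfies \<open>M \<le> c + M/2\<close>.\<close>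

lemma weighted_sup_bound:
  fixes F :: "real \<Rightarrow> complex"
  assumes cont: "continuous_on {0..1} F"
    and step: "\<And>M x. \<lbrakk>\<And>x. 0 \<le> x \<Longrightarrow> x \<le> 1 \<Longrightarrow> norm (F x) \<le> M * exp (r * x\<^sup>2); 0 \<le> x; x \<le> 1\<rbrakk>
       \<Longrightarrow> norm (F x) \<le> (c + M / 2) * exp (r * x\<^sup>2)"
    and x: "0 \<le> x" "x \<le> 1"
  shows "norm (F x) \<le> 2 * c * exp (r * x\<^sup>2)"
proof -
  have "\<exists>m\<in>{0..1::real}. \<forall>y\<in>{0..1}. norm (F y) * exp (- r * y\<^sup>2) \<le> norm (F m) * exp (- r * m\<^sup>2)"
    by (rule continuous_attains_sup) (auto intro!: continuous_intros cont)
  then obtain m where m: "m \<in> {0..1}" and le: "\<And>y. y \<in> {0..1} \<Longrightarrow> norm (F y) * exp (- r * y\<^sup>2) \<le> norm (F m) * exp (- r * m\<^sup>2)"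
    by blast
  define M where "M = norm (F m) * exp (- r * m\<^sup>2)"
  have b: "norm (F y) \<le> M * exp (r * y\<^sup>2)" if "0 \<le> y" "y \<le> 1" for y
    using le[of y] that unfolding M_def[symmetric] by (simp add: exp_minus field_simps)
  have "norm (F m) \<le> (c + M / 2) * exp (r * m\<^sup>2)" using step[OF b, of m] m by auto
  then have "M \<le> c + M / 2" unfolding M_def[of] by (simp add: exp_minus field_simps)
  then have "M \<le> 2 * c" by simp
  then have "M * exp (r * x\<^sup>2) \<le> 2 * c * exp (r * x\<^sup>2)" by (intro mult_right_mono) auto
  then show ?thesis using b[OF x] by linarith
qed

lemma wr_minus_1_deriv:
  "((\<lambda>x. wr N \<mu> x - 1) has_vector_derivative wr' N \<mu> x) (at x)"
  using has_vector_derivative_diff[OF wr_deriv has_vector_derivative_const[of 1]] by simp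

text \<open>The function w - 1 solves the equation with source - \<mu> w and zero data, so a
  weighted bound M for w gives one for w - 1 with the factor 1/(2 Re N) \<le> 1/2. This closes at M
  = 2, and inserting M = 2 once more yields the second estimate.\<close>

lemma wr_bounds:
  assumes r: "Re N \<ge> 1" and \<mu>: "norm \<mu> \<le> 1" and x: "0 \<le> x" "x \<le> 1"
  shows "norm (wr N \<mu> x) \<le> 2 * exp (Re N * x\<^sup>2)"
    and "norm (wr N \<mu> x - 1) \<le> (exp (Re N * x\<^sup>2) - 1) / Re N"
proof -
  have *: "norm (wr N \<mu> x - 1) \<le> M * (exp (Re N * x\<^sup>2) - 1) / (2 * Re N)"
    if b: "\<And>x. 0 \<le> x \<Longrightarrow> x \<le> 1 \<Longrightarrow> norm (wr N \<mu> x) \<le> M * exp (Re N * x\<^sup>2)" and x: "0 \<le> x" "x \<le> 1" for M x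
  proof (rule weighted_ode_bound[OF wr_minus_1_deriv])
    show "(wr' N \<mu> has_vector_derivative 2 * N * of_real x * wr' N \<mu> x + (- \<mu> * wr N \<mu> x)) (at x)" for x
      using wr'_deriv[of N \<mu> x UNIV] by simp
    show "norm (- \<mu> * wr N \<mu> x) \<le> M * exp (Re N * x\<^sup>2)" if "0 \<le> x" "x \<le> 1" for x
      using b[OF that] \<mu> mult_mono[OF \<mu> b[OF that]] by (simp add: norm_mult)
  qed (use r x in auto)
  have 1: "norm (wr N \<mu> x) \<le> 2 * exp (Re N * x\<^sup>2)" if x: "0 \<le> x" "x \<le> 1" for x
  proof -
    have "norm (wr N \<mu> x) \<le> 2 * 1 * exp (Re N * x\<^sup>2)"
    proof (rule weighted_sup_bound[OF wr_cont(1) _ x])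
      fix M x :: real assume b: "\<And>x. 0 \<le> x \<Longrightarrow> x \<le> 1 \<Longrightarrow> norm (wr N \<mu> x) \<le> M * exp (Re N * x\<^sup>2)" and x: "0 \<le> x" "x \<le> 1"
      have M: "M \<ge> 0" using order_trans[OF norm_ge_zero b[of 0]] by simp
      have e: "exp (Re N * x\<^sup>2) \<ge> 1" using r by simp
      have "norm (wr N \<mu> x) \<le> 1 + norm (wr N \<mu> x - 1)" using norm_triangle_sub[of "wr N \<mu> x" 1] by simp
      also have "\<dots> \<le> 1 + M * (exp (Re N * x\<^sup>2) - 1) / (2 * Re N)" using *[OF b x] by simp
      also have "\<dots> \<le> 1 + M * (exp (Re N * x\<^sup>2) - 1) / (2 * 1)"
        using M e r by (intro add_left_mono divide_left_mono mult_nonneg_nonneg) auto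
      also have "\<dots> \<le> exp (Re N * x\<^sup>2) + M * exp (Re N * x\<^sup>2) / 2"
        using M e by (intro add_mono divide_right_mono) (auto simp: right_diff_distrib)
      also have "\<dots> = (1 + M / 2) * exp (Re N * x\<^sup>2)" by (simp add: algebra_simps)
      finally show "norm (wr N \<mu> x) \<le> (1 + M / 2) * exp (Re N * x\<^sup>2)" .
    qed
    then show ?thesis by simp
  qed
  show "norm (wr N \<mu> x - 1) \<le> (exp (Re N * x\<^sup>2) - 1) / Re N"
    using *[OF 1 x] by (simp only: mult_divide_mult_cancel_left_if) simp
  show "norm (wr N \<mu> x) \<le> 2 * exp (Re N * x\<^sup>2)" by (rule 1[OF x])
qed

text \<open>The difference d of the two solutions has the source - ((\<mu> - \<nu>) w + \<nu> d);
  the part containing d is absorbed by the self-improving bound. The factor 1/Re N is kept because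
  the linearisation below combines it with a second one.\<close>

lemma wr_diff_bound:
  assumes r: "Re N \<ge> 1" and \<mu>: "norm \<mu> \<le> 1" "norm \<nu> \<le> 1" and x: "0 \<le> x" "x \<le> 1"
  shows "norm (wr N \<mu> x - wr N \<nu> x) \<le> 2 * norm (\<mu> - \<nu>) * exp (Re N * x\<^sup>2) / Re N"
proof -
  define d where "d x = wr N \<mu> x - wr N \<nu> x" for x
  define \<Delta> where "\<Delta> = norm (\<mu> - \<nu>)"
  have "norm (d x) \<le> 2 * (\<Delta> / Re N) * exp (Re N * x\<^sup>2)"
  proof (rule weighted_sup_bound[OF _ _ x])
    show "continuous_on {0..1} d" unfolding d_def by (intro continuous_intros wr_cont)
    fix M x :: real assume b: "\<And>x. 0 \<le> x \<Longrightarrow> x \<le> 1 \<Longrightarrow> norm (d x) \<le> M * exp (Re N * x\<^sup>2)" and x: "0 \<le> x" "x \<le> 1"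
    have M: "M \<ge> 0" using order_trans[OF norm_ge_zero b[of 0]] by simp
    have "norm (d x) \<le> (2 * \<Delta> + M) * (exp (Re N * x\<^sup>2) - 1) / (2 * Re N)"
    proof (rule weighted_ode_bound)
      show "(d has_vector_derivative wr' N \<mu> x - wr' N \<nu> x) (at x)" for x
        unfolding d_def by (intro has_vector_derivative_diff wr_deriv)
      show "((\<lambda>x. wr' N \<mu> x - wr' N \<nu> x) has_vector_derivative 2 * N * of_real x * (wr' N \<mu> x - wr' N \<nu> x) +
          (- ((\<mu> - \<nu>) * wr N \<mu> x + \<nu> * d x))) (at x)" for x
        using has_vector_derivative_diff[OF wr'_deriv[of N \<mu> x UNIV] wr'_deriv[of N \<nu> x UNIV]]
        by (simp add: d_def algebra_simps)
      show "norm (- ((\<mu> - \<nu>) * wr N \<mu> x + \<nu> * d x)) \<le> (2 * \<Delta> + M) * exp (Re N * x\<^sup>2)" if "0 \<le> x" "x \<le> 1" for x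
      proof -
        have "norm (- ((\<mu> - \<nu>) * wr N \<mu> x + \<nu> * d x)) \<le> norm (\<mu> - \<nu>) * norm (wr N \<mu> x) + norm \<nu> * norm (d x)"
          unfolding norm_minus_cancel by (rule order_trans[OF norm_triangle_ineq]) (simp add: norm_mult)
        also have "\<dots> \<le> \<Delta> * (2 * exp (Re N * x\<^sup>2)) + 1 * (M * exp (Re N * x\<^sup>2))"
          unfolding \<Delta>_def using wr_bounds(1)[OF r \<mu>(1) that] b[OF that] \<mu> by (intro add_mono mult_mono) auto
        finally show ?thesis by (simp add: algebra_simps)
      qed
    qed (use r x in \<open>auto simp: d_def\<close>)
    also have "\<dots> \<le> (2 * \<Delta> + M) * exp (Re N * x\<^sup>2) / (2 * Re N)"
      using M r by (intro divide_right_mono mult_left_mono) (auto simp: \<Delta>_def)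
    also have "\<dots> = (\<Delta> / Re N + M / (2 * Re N)) * exp (Re N * x\<^sup>2)" using r by (simp add: field_simps)
    also have "\<dots> \<le> (\<Delta> / Re N + M / (2 * 1)) * exp (Re N * x\<^sup>2)"
      using M r by (intro mult_right_mono add_left_mono divide_left_mono) auto
    finally show "norm (d x) \<le> (\<Delta> / Re N + M / 2) * exp (Re N * x\<^sup>2)" by simp
  qed
  then show ?thesis by (simp add: d_def \<Delta>_def)
qed

text \<open>To first order in \<open>\<mu>\<close>, \<open>w = 1 - \<mu> y\<close>, where \<open>y\<close> solves \<open>y'' = 2 N x y' + 1\<close>.\<close>

lemma wr_first_order:
  fixes y y' :: "real \<Rightarrow> complex"
  assumes y: "\<And>x. (y has_vector_derivative y' x) (at x)"
    and y': "\<And>x. (y' has_vector_derivative 2 * N * of_real x * y' x + 1) (at x)"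
    and y0: "y 0 = 0" "y' 0 = 0"
    and r: "Re N \<ge> 1" and \<mu>: "norm \<mu> \<le> 1" "norm \<nu> \<le> 1"
  shows "norm (wr N \<mu> 1 - wr N \<nu> 1 + (\<mu> - \<nu>) * y 1) \<le> 3 * norm (\<mu> - \<nu>) * exp (Re N) / (2 * (Re N)\<^sup>2)"
proof -
  define \<Delta> where "\<Delta> = norm (\<mu> - \<nu>)"
  define F where "F x = wr N \<mu> x - wr N \<nu> x + (\<mu> - \<nu>) * y x" for x
  have "norm (F 1) \<le> (3 * \<Delta> / Re N) * (exp (Re N * 1\<^sup>2) - 1) / (2 * Re N)"
  proof (rule weighted_ode_bound)
    show "(F has_vector_derivative wr' N \<mu> x - wr' N \<nu> x + (\<mu> - \<nu>) * y' x) (at x)" for x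
      unfolding F_def
      by (intro has_vector_derivative_add has_vector_derivative_diff wr_deriv has_vector_derivative_mult_right y)
    show "((\<lambda>x. wr' N \<mu> x - wr' N \<nu> x + (\<mu> - \<nu>) * y' x) has_vector_derivative
      2 * N * of_real x * (wr' N \<mu> x - wr' N \<nu> x + (\<mu> - \<nu>) * y' x) +
        (- ((\<mu> - \<nu>) * (wr N \<mu> x - 1) + \<nu> * (wr N \<mu> x - wr N \<nu> x)))) (at x)" for x
      using has_vector_derivative_add[OF has_vector_derivative_diff[OF wr'_deriv[of N \<mu> x UNIV] wr'_deriv[of N \<nu> x UNIV]]
        has_vector_derivative_mult_right[OF y'[of x], of "\<mu> - \<nu>"]]
      by (simp add: algebra_simps)
    \<comment> \<open>The neglected terms are products of two small quantities. To the constant 3,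
      the deviation of w from 1 contributes 1 and the difference of the two solutions contributes 2,
      each with a factor 1/Re N.\<close>
    show "norm (- ((\<mu> - \<nu>) * (wr N \<mu> x - 1) + \<nu> * (wr N \<mu> x - wr N \<nu> x))) \<le> 3 * \<Delta> / Re N * exp (Re N * x\<^sup>2)"
      if "0 \<le> x" "x \<le> 1" for x
    proof -
      have "norm (- ((\<mu> - \<nu>) * (wr N \<mu> x - 1) + \<nu> * (wr N \<mu> x - wr N \<nu> x)))
          \<le> norm (\<mu> - \<nu>) * norm (wr N \<mu> x - 1) + norm \<nu> * norm (wr N \<mu> x - wr N \<nu> x)"
        unfolding norm_minus_cancel by (rule order_trans[OF norm_triangle_ineq]) (simp add: norm_mult)
      also have "\<dots> \<le> \<Delta> * (exp (Re N * x\<^sup>2) / Re N) + 1 * (2 * \<Delta> * exp (Re N * x\<^sup>2) / Re N)"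
        unfolding \<Delta>_def using wr_diff_bound[OF r \<mu> that] \<mu> r
        by (intro add_mono mult_mono order_trans[OF wr_bounds(2)[OF r \<mu>(1) that]] divide_right_mono) auto
      finally show ?thesis by (simp add: algebra_simps add_divide_distrib[symmetric])
    qed
  qed (use r y0 in \<open>auto simp: F_def\<close>)
  also have "\<dots> \<le> (3 * \<Delta> / Re N) * exp (Re N) / (2 * Re N)"
    using r by (intro divide_right_mono mult_left_mono) (auto simp: \<Delta>_def)
  finally show ?thesis by (simp add: F_def \<Delta>_def power2_eq_square field_simps)
qed

section \<open>The linear response and the eigenvalue correction in a sector\<close>

definition sector :: "real \<Rightarrow> real \<Rightarrow> complex set" where
  "sector R k = {N. R < Re N \<and> \<bar>Im N\<bar> < k * Re N}"

lemma open_sector: "open (sector R k)"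
proof -
  have "sector R k = {N. R < Re N} \<inter> {N. Im N < k * Re N} \<inter> {N. - Im N < k * Re N}"
    by (auto simp: sector_def abs_less_iff)
  also have "open \<dots>" by (intro open_Int open_Collect_less continuous_intros)
  finally show ?thesis .
qed

lemma sector_norm_le:
  assumes "N \<in> sector R k" "R \<ge> 0"
  shows "norm N \<le> (1 + k) * Re N"
  using cmod_le[of N] assms by (auto simp: sector_def algebra_simps)

lemma exp_ge_half_square: "x \<ge> 0 \<Longrightarrow> x\<^sup>2 / 2 \<le> exp (x::real)"
  using exp_lower_Taylor_quadratic[of x] by (simp add: field_simps)

lemma entire_primitive:
  fixes f :: "complex \<Rightarrow> complex"
  assumes "f holomorphic_on UNIV"
  shows "\<exists>G. (\<forall>z. (G has_field_derivative f z) (at z)) \<and> G 0 = 0"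
proof -
  obtain g where g: "\<And>z. (g has_field_derivative f z) (at z)"
    using holomorphic_convex_primitive'[OF convex_UNIV open_UNIV assms] by auto
  have "((\<lambda>z. g z - g 0) has_field_derivative f z) (at z)" for z
    using DERIV_diff[OF g DERIV_const] by simp
  then show ?thesis by (intro exI[of _ "\<lambda>z. g z - g 0"]) simp
qed

text \<open>On the real axis, F(sqrt r) \<ge> F(1) \<ge> 1/3, since exp (- x^2) \<ge> 1/3 on [0, 1].
  The derivative of F(csqrt z) is e^(-z) / (2 csqrt z), so moving from r = Re N to N inside the
  half-plane Re z \<ge> r costs at most |Im N| e^(-r) / 2 \<le> k / r \<le> 1/12, which leaves
  1/4.\<close>

lemma erf_lower_bound:
  fixes F :: "complex \<Rightarrow> complex"
  assumes F: "\<And>z. (F has_field_derivative exp (- z\<^sup>2)) (at z)" and F0: "F 0 = 0"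
    and N: "N \<in> sector R k" and R: "R \<ge> 1" "R \<ge> 12 * k"
  shows "1 / 4 \<le> norm (F (csqrt N))"
proof -
  define r where "r = Re N"
  have r: "r > 1" "r > 12 * k" "\<bar>Im N\<bar> < k * r" using N R by (auto simp: sector_def r_def)
  have k: "k > 0" using r by (smt (verit) mult_nonpos_nonneg)
  have "norm (F (csqrt N) - F (csqrt r)) \<le> exp (- r) / 2 * norm (N - r)"
  proof (rule field_differentiable_bound[of "{z. Re z \<ge> r}" "\<lambda>z. F (csqrt z)" "\<lambda>z. exp (- z) * inverse (2 * csqrt z)"])
    fix z assume z: "z \<in> {z. Re z \<ge> r}"
    then have nz: "z \<notin> \<real>\<^sub>\<le>\<^sub>0" using r by (auto simp: complex_nonpos_Reals_iff)
    have "((\<lambda>z. F (csqrt z)) has_field_derivative exp (- (csqrt z)\<^sup>2) * inverse (2 * csqrt z)) (at z within {z. Re z \<ge> r})"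
      by (rule DERIV_chain2[OF F has_field_derivative_at_within[OF has_field_derivative_csqrt[OF nz]]])
    then show "((\<lambda>z. F (csqrt z)) has_field_derivative exp (- z) * inverse (2 * csqrt z)) (at z within {z. Re z \<ge> r})"
      by simp
    have "1 \<le> norm z" using z r complex_Re_le_cmod[of z] by auto
    then have "norm (csqrt z) \<ge> 1" by (simp add: norm_csqrt)
    then have "inverse (norm (csqrt z)) \<le> 1" by (simp add: inverse_le_1_iff)
    then have "norm (exp (- z)) * inverse (norm (2 * csqrt z)) \<le> exp (- r) * (1 / 2)"
      using z by (intro mult_mono) (auto simp: norm_mult)
    then show "norm (exp (- z) * inverse (2 * csqrt z)) \<le> exp (- r) / 2"
      by (simp add: norm_mult norm_inverse)
  qed (use r_def in \<open>auto simp: convex_halfspace_Re_ge\<close>)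
  also have "norm (N - r) = \<bar>Im N\<bar>" by (simp add: cmod_def r_def)
  also have "exp (- r) / 2 * \<bar>Im N\<bar> \<le> exp (- r) / 2 * (k * r)" using r by (intro mult_left_mono) auto
  also have "\<dots> \<le> k / r"
  proof -
    have "r\<^sup>2 / 2 \<le> exp r" using exp_ge_half_square[of r] r by simp
    then have "k * (r\<^sup>2 / 2) \<le> k * exp r" using k by simp
    then show ?thesis using r by (simp add: exp_minus field_simps power2_eq_square)
  qed
  also have "\<dots> \<le> 1 / 12" using r by (simp add: field_simps)
  finally have 1: "norm (F (csqrt N) - F (csqrt r)) \<le> 1 / 12" .
  define f where "f x = Re (F (of_real x))" for x :: real
  have f: "(f has_real_derivative exp (- x\<^sup>2)) (at x)" for x
  proof -
    have "((\<lambda>x. F (of_real x)) has_vector_derivative exp (- (of_real x)\<^sup>2)) (at x)"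
      by (rule vector_derivative_of_real) (rule F)
    from bounded_linear.has_vector_derivative[OF bounded_linear_Re this]
    show ?thesis unfolding f_def has_real_derivative_iff_has_vector_derivative
      by (metis Re_complex_of_real exp_of_real of_real_minus of_real_power)
  qed
  have "f 0 - 0 * (1/3) \<le> f 1 - 1 * (1/3)"
  proof (rule DERIV_nonneg_imp_nondecreasing[of 0 1 "\<lambda>x. f x - x * (1/3)"])
    fix x :: real assume x: "0 \<le> x" "x \<le> 1"
    have "exp 1 \<le> (3 :: real)" by (rule exp_le)
    then have "1/3 \<le> exp (- 1 :: real)" by (simp add: exp_minus field_simps)
    also have "\<dots> \<le> exp (- x\<^sup>2)" using x by (simp add: power_le_one)
    finally have "0 \<le> exp (- x\<^sup>2) - 1/3" by simp
    moreover have "((\<lambda>x. f x - x * (1/3)) has_real_derivative exp (- x\<^sup>2) - 1/3) (at x)"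
      by (auto intro!: derivative_eq_intros f)
    ultimately show "\<exists>y. ((\<lambda>x. f x - x * (1/3)) has_real_derivative y) (at x) \<and> y \<ge> 0" by blast
  qed simp
  moreover have "f 1 \<le> f (sqrt r)"
    by (rule DERIV_nonneg_imp_nondecreasing[of 1 "sqrt r" f]) (use f r exp_ge_zero in \<open>auto, blast\<close>)
  moreover have "f 0 = 0" by (simp add: f_def F0)
  moreover have "f (sqrt r) \<le> norm (F (csqrt r))"
    using r by (simp add: f_def of_real_sqrt[symmetric] complex_Re_le_cmod)
  ultimately have "1/3 \<le> norm (F (csqrt r))" by simp
  then show ?thesis using 1 norm_triangle_ineq2[of "F (csqrt r)" "F (csqrt N)"]
    by (simp add: norm_minus_commute)
qed

text \<open>The solution of \<open>y'' = 2 N x y' + 1\<close> is compared with \<open>x y' / (1 + 2 N x\<^sup>2)\<close>, its asymptotic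
  primitive of \<open>y' = exp (N x\<^sup>2) F(q x) / q\<close>, where \<open>q\<^sup>2 = N\<close> and \<open>F\<close> is the primitive of \<open>exp (- z\<^sup>2)\<close>.\<close>

lemma linear_response_lower_bound:
  fixes k :: real
  assumes k: "k > 0" and N: "N \<in> sector R k" and R: "R \<ge> (444 * (1 + k) ^ 3)\<^sup>2"
  obtains y y' :: "real \<Rightarrow> complex" where
    "\<And>x. (y has_vector_derivative y' x) (at x)"
    "\<And>x. (y' has_vector_derivative 2 * N * of_real x * y' x + 1) (at x)"
    "y 0 = 0" "y' 0 = 0"
    "12 * exp (Re N) / (Re N)\<^sup>2 \<le> norm (y 1)"
proof -
  define r where "r = Re N"
  define s where "s = sqrt r"
  have k3: "(1 + k) ^ 3 \<ge> 1" "(1 + k) ^ 3 \<ge> 1 + k" using k self_le_power[of "1 + k" 3] by auto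
  have "R \<ge> 444 * (1 + k) ^ 3" using R k3 self_le_power[of "444 * (1 + k) ^ 3" 2] by simp
  then have R': "R \<ge> 1" "R \<ge> 12 * k" using k3 k by auto
  have r: "r > 1" "r > 12 * k" "r > (444 * (1 + k) ^ 3)\<^sup>2" using N R R' by (auto simp: sector_def r_def)
  have s: "s \<ge> 444 * (1 + k) ^ 3" "s > 1" "s\<^sup>2 = r"
    using r k real_le_rsqrt[of "444 * (1 + k) ^ 3" r] by (auto simp: s_def)
  have nN: "norm N \<le> (1 + k) * r" using sector_norm_le[OF N] R' by (simp add: r_def)
  have nN1: "norm N \<ge> 1" "N \<noteq> 0" using r complex_Re_le_cmod[of N] by (auto simp: r_def)
  have "(\<lambda>z. exp (- z\<^sup>2) :: complex) holomorphic_on UNIV" by (intro holomorphic_intros)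
  from entire_primitive[OF this] obtain F :: "complex \<Rightarrow> complex" where F: "\<And>z. (F has_field_derivative exp (- z\<^sup>2)) (at z)" and F0: "F 0 = 0"
    by blast
  have Fh: "F holomorphic_on UNIV" using F by (auto simp: holomorphic_on_open)
  define q where "q = csqrt N"
  have q: "q\<^sup>2 = N" "q \<noteq> 0" using nN1 by (auto simp: q_def)
  define g where "g z = exp (N * z\<^sup>2) * F (q * z) / q" for z
  have "g holomorphic_on UNIV" unfolding g_def using q
    by (intro holomorphic_intros holomorphic_on_compose_gen[OF _ Fh, unfolded o_def]) auto
  from entire_primitive[OF this] obtain Y where Y: "\<And>z. (Y has_field_derivative g z) (at z)" and Y0: "Y 0 = 0"
    by blast
  have gd: "(g has_field_derivative 2 * N * z * g z + 1) (at z)" for z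
  proof -
    have "((\<lambda>z. F (q * z)) has_field_derivative exp (- (q * z)\<^sup>2) * q) (at z)"
      by (rule DERIV_chain2[OF F]) (auto intro!: derivative_eq_intros)
    then have "(g has_field_derivative (exp (N * z\<^sup>2) * (N * (2 * z)) * F (q * z) + exp (- (q * z)\<^sup>2) * q * exp (N * z\<^sup>2)) / q) (at z)"
      unfolding g_def [abs_def]
      by (intro DERIV_cdivide DERIV_mult) (auto intro!: derivative_eq_intros)
    moreover have "exp (- (q * z)\<^sup>2) * q * exp (N * z\<^sup>2) = q"
      by (simp add: power_mult_distrib q exp_minus)
    ultimately show ?thesis using q(2) by (simp add: g_def add_divide_distrib mult_ac)
  qed
  define y where "y x = Y (of_real x)" for x :: real
  define y' where "y' x = g (of_real x)" for x :: real
  have y: "(y has_vector_derivative y' x) (at x)" for x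
    unfolding y_def y'_def by (rule vector_derivative_of_real) (rule Y)
  have y': "(y' has_vector_derivative 2 * N * of_real x * y' x + 1) (at x)" for x
    unfolding y'_def by (rule vector_derivative_of_real) (rule gd)
  have y0: "y 0 = 0" "y' 0 = 0" by (auto simp: y_def y'_def Y0 g_def F0)
  \<comment> \<open>Majorising exp (- r x^2) by 1 / (1 + r x^2) gives a primitive in closed form,
    the arctangent; the constant 2 stands for \<pi>/2.\<close>
  have E: "norm (F (q * of_real x) / q) \<le> 2 / s" if x: "0 < x" for x
  proof -
    have "norm (F (q * of_real x) / q - F (q * of_real 0) / q) \<le> arctan (s * x) / s - arctan (s * 0) / s"
    proof (rule differentiable_bound_general)
      have d: "((\<lambda>x. F (q * of_real x) / q) has_vector_derivative exp (- N * of_real (x\<^sup>2))) (at x)" for x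
      proof -
        have "((\<lambda>z. F (q * z) / q) has_field_derivative exp (- (q * of_real x)\<^sup>2) * q / q) (at (of_real x))"
          by (intro DERIV_cdivide DERIV_chain2[OF F]) (auto intro!: derivative_eq_intros)
        from vector_derivative_of_real[OF this] show ?thesis using q by (simp add: power_mult_distrib)
      qed
      show "((\<lambda>x. F (q * of_real x) / q) has_vector_derivative exp (- N * of_real (x\<^sup>2))) (at x)" for x by (rule d)
      show "continuous_on {0..x} (\<lambda>x. F (q * of_real x) / q)"
        by (rule continuous_on_vector_derivative_at) (rule d)
      show "((\<lambda>x. arctan (s * x) / s) has_vector_derivative inverse (1 + r * x\<^sup>2)) (at x)" for x
        unfolding has_real_derivative_iff_has_vector_derivative[symmetric] using s
        by (auto intro!: derivative_eq_intros simp: power_mult_distrib)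
      show "norm (exp (- N * of_real (x\<^sup>2))) \<le> inverse (1 + r * x\<^sup>2)" for x
        unfolding norm_exp_minus using exp_ge_add_one_self[of "r * x\<^sup>2"] r
        by (simp add: exp_minus r_def[symmetric] le_imp_inverse_le add_pos_nonneg)
    qed (use x s in \<open>auto intro!: continuous_intros\<close>)
    moreover have "arctan (s * x) / s \<le> 2 / s"
      using arctan_ubound[of "s * x"] pi_less_4 s by (intro divide_right_mono) auto
    ultimately show ?thesis using F0 by simp
  qed
  have y'_bound: "norm (y' x) \<le> exp (r * x\<^sup>2) * (2 / s)" if x: "0 < x" for x
  proof -
    have ne: "norm (exp (N * (of_real x)\<^sup>2)) = exp (r * x\<^sup>2)"
      using norm_exp_minus[of "- N" "x\<^sup>2"] by (simp add: r_def)
    show ?thesis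
      unfolding y'_def g_def times_divide_eq_right[symmetric] norm_mult ne
      by (rule mult_left_mono[OF E[OF x]]) simp
  qed
  define D where "D x = 1 + 2 * N * of_real (x\<^sup>2)" for x :: real
  have D: "norm (D x) \<ge> 1 + r * x\<^sup>2" for x
  proof -
    have "1 + r * x\<^sup>2 \<le> Re (D x)" using r by (simp add: D_def r_def)
    then show ?thesis using complex_Re_le_cmod[of "D x"] by linarith
  qed
  have D1: "norm (D x) \<ge> 1" "D x \<noteq> 0" for x
  proof -
    have "r * x\<^sup>2 \<ge> 0" using r by simp
    then show "norm (D x) \<ge> 1" using D[of x] by linarith
    then show "D x \<noteq> 0" by auto
  qed
  \<comment> \<open>Because y'' = 2 N x y' + 1, the leading parts cancel in the derivative of h:
    there y' only carries the weight 4 N x^2 / D^2, which is small once |N| x^2 is large. Hence h(1)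
    is of lower order than the subtracted term.\<close>
  define h where "h x = y x - of_real x * y' x / D x" for x
  define h' where "h' x = 4 * N * of_real (x\<^sup>2) * y' x / (D x)\<^sup>2 - of_real x / D x" for x
  have hd: "(h has_vector_derivative h' x) (at x)" for x
  proof -
    have "((\<lambda>z. Y z - z * g z / (1 + 2 * N * z\<^sup>2)) has_field_derivative
       g (of_real x) - ((g (of_real x) + (2 * N * of_real x * g (of_real x) + 1) * of_real x) * D x -
         of_real x * g (of_real x) * (2 * N * (2 * of_real x))) / (D x * D x)) (at (of_real x))"
      (is "(_ has_field_derivative ?d) _")
      unfolding D_def using D1(2)[of x, unfolded D_def]
      by (auto intro!: derivative_eq_intros Y gd simp: algebra_simps)
    then have "(h has_vector_derivative  ?d) (at x)"
      unfolding h_def [abs_def] y_def y'_def D_def of_real_power by (rule vector_derivative_of_real)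
    moreover have "?d = h' x"
    proof -
      have "g (of_real x) + (2 * N * of_real x * g (of_real x) + 1) * of_real x = g (of_real x) * D x + of_real x"
        by (simp add: D_def algebra_simps power2_eq_square)
      then show ?thesis using D1(2)[of x]
        by (simp add: h'_def y'_def field_simps power2_eq_square)
    qed
    ultimately show ?thesis by simp
  qed
  \<comment> \<open>Three times the constant 8 (1 + k) / s that bounds the first part of h'. With
    this scaling the comparison of derivatives becomes the polynomial inequality \<tau> (1 + \<tau>)
    / 3 \<le> 1 - \<tau> + 2 \<tau>^2. The summand x^2 / 2 in the comparison function absorbs the
    second part x / D.\<close>
  define A where "A = 24 * (1 + k) / s"
  have A: "A > 0" using k s by (simp add: A_def)
  have h1: "norm (h 1 - h 0) \<le> (A * 1 * exp (r * 1\<^sup>2) / (1 + r * 1\<^sup>2)\<^sup>2 + 1\<^sup>2 / 2) - (A * 0 * exp (r * 0\<^sup>2) / (1 + r * 0\<^sup>2)\<^sup>2 + 0\<^sup>2 / 2)"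
  proof (rule differentiable_bound_general)
    show "(h has_vector_derivative h' x) (at x)" for x by (rule hd)
    show "continuous_on {0..1} h"
      by (rule continuous_on_vector_derivative_at) (rule hd)
    have pos: "1 + r * x\<^sup>2 > 0" for x using r by (simp add: add_pos_nonneg)
    show "((\<lambda>x. A * x * exp (r * x\<^sup>2) / (1 + r * x\<^sup>2)\<^sup>2 + x\<^sup>2 / 2) has_vector_derivative
        A * exp (r * x\<^sup>2) * (1 - r * x\<^sup>2 + 2 * (r * x\<^sup>2)\<^sup>2) / (1 + r * x\<^sup>2) ^ 3 + x) (at x)" for x
    proof -
      have "((\<lambda>x. A * x * exp (r * x\<^sup>2) / (1 + r * x\<^sup>2)\<^sup>2 + x\<^sup>2 / 2) has_real_derivative
          ((A * exp (r * x\<^sup>2) + A * x * (exp (r * x\<^sup>2) * (r * (2 * x)))) * (1 + r * x\<^sup>2)\<^sup>2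
           - A * x * exp (r * x\<^sup>2) * (2 * (1 + r * x\<^sup>2) * (r * (2 * x)))) / ((1 + r * x\<^sup>2)\<^sup>2 * (1 + r * x\<^sup>2)\<^sup>2) + x) (at x)"
        (is "(_ has_real_derivative ?num / ?den + x) _")
        using pos[of x] by (auto intro!: derivative_eq_intros simp: algebra_simps)
      moreover have "?num / ?den
         = A * exp (r * x\<^sup>2) * (1 - r * x\<^sup>2 + 2 * (r * x\<^sup>2)\<^sup>2) / (1 + r * x\<^sup>2) ^ 3" (is "_ = ?B / _")
      proof -
        have "?num = (1 + r * x\<^sup>2) * ?B" by (simp add: power2_eq_square algebra_simps)
        moreover have "(1 + r * x\<^sup>2)\<^sup>2 * (1 + r * x\<^sup>2)\<^sup>2 = (1 + r * x\<^sup>2) * (1 + r * x\<^sup>2) ^ 3"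
          by (simp add: power2_eq_square power3_eq_cube mult_ac)
        ultimately show ?thesis using pos[of x] by (simp only: mult_divide_mult_cancel_left_if) simp
      qed
      ultimately show ?thesis unfolding has_real_derivative_iff_has_vector_derivative by simp
    qed
    show "continuous_on {0..1} (\<lambda>x. A * x * exp (r * x\<^sup>2) / (1 + r * x\<^sup>2)\<^sup>2 + x\<^sup>2 / 2)"
      using pos by (intro continuous_intros) (auto simp: less_imp_neq[symmetric])
    show "norm (h' x) \<le> A * exp (r * x\<^sup>2) * (1 - r * x\<^sup>2 + 2 * (r * x\<^sup>2)\<^sup>2) / (1 + r * x\<^sup>2) ^ 3 + x"
      if x: "0 < x" "x < 1" for x
    proof -
      define \<tau> where "\<tau> = r * x\<^sup>2"
      have \<tau>: "\<tau> > 0" using r x by (simp add: \<tau>_def)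
      have "norm (4 * N * of_real (x\<^sup>2) * y' x / (D x)\<^sup>2) = 4 * norm N * x\<^sup>2 * norm (y' x) / (norm (D x))\<^sup>2"
        by (simp add: norm_mult norm_divide norm_power)
      also have "\<dots> \<le> 4 * ((1 + k) * r) * x\<^sup>2 * (exp \<tau> * (2 / s)) / (1 + \<tau>)\<^sup>2"
        using nN y'_bound[OF x(1)] D[of x] \<tau> r k s(2) x pos[of x]
        by (intro frac_le mult_mono power_mono) (auto simp: \<tau>_def zero_le_divide_iff zero_le_mult_iff)
      also have "\<dots> = A * exp \<tau> * (\<tau> / 3) / (1 + \<tau>)\<^sup>2"
      proof -
        have "4 * ((1 + k) * r) * X * (e * (2 / s)) / d = 24 * (1 + k) / s * e * (r * X / 3) / d" for X e d :: real
          using s(2) by (cases "d = 0") (auto simp: field_simps)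
        then show ?thesis unfolding A_def \<tau>_def .
      qed
      also have "\<dots> = A * exp \<tau> * (\<tau> / 3 * (1 + \<tau>)) / (1 + \<tau>) ^ 3"
        using \<tau> by (simp add: power2_eq_square power3_eq_cube)
      also have "\<dots> \<le> A * exp \<tau> * (1 - \<tau> + 2 * \<tau>\<^sup>2) / (1 + \<tau>) ^ 3"
      proof -
        \<comment> \<open>This is 5 (5 \<tau>^2 - 4 \<tau> + 3), that is, the required inequality
          cleared of denominators and completed to a square.\<close>
        have "0 \<le> (5 * \<tau> - 2)\<^sup>2 + 11" by simp
        then have "\<tau> / 3 * (1 + \<tau>) \<le> 1 - \<tau> + 2 * \<tau>\<^sup>2" by (simp add: power2_eq_square field_simps)
        then show ?thesis using A \<tau> by (intro divide_right_mono mult_left_mono) auto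
      qed
      finally have 1: "norm (4 * N * of_real (x\<^sup>2) * y' x / (D x)\<^sup>2) \<le> A * exp \<tau> * (1 - \<tau> + 2 * \<tau>\<^sup>2) / (1 + \<tau>) ^ 3" .
      have "norm (complex_of_real x / D x) \<le> x / 1"
        unfolding norm_divide using D1(1)[of x] x by (intro frac_le) auto
      then show ?thesis unfolding h'_def \<tau>_def[symmetric]
        using norm_triangle_ineq4[of "4 * N * of_real (x\<^sup>2) * y' x / (D x)\<^sup>2" "complex_of_real x / D x"] 1 by linarith
    qed
  qed simp
  have h0: "h 0 = 0" by (simp add: h_def y0)
  have h1': "norm (h 1) \<le> A * exp r / s ^ 4 + 1 / 2"
  proof -
    have "norm (h 1) \<le> A * exp r / (1 + r)\<^sup>2 + 1 / 2" using h1 h0 by simp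
    also have "A * exp r / (1 + r)\<^sup>2 \<le> A * exp r / r\<^sup>2"
      using A r by (intro divide_left_mono power_mono mult_pos_pos) auto
    also have "r\<^sup>2 = s ^ 4" using s(3) by (metis num_double numeral_times_numeral power_mult)
    finally show ?thesis by simp
  qed
  \<comment> \<open>The subtracted term has at least the order e^r / s^3, whereas its error and the
    bound to be reached are controlled by multiples of e^r / s^4. A large s therefore
    decides.\<close>
  have low: "exp r / (12 * (1 + k)\<^sup>2 * s ^ 3) \<le> norm (y' 1 / D 1)"
  proof -
    have "norm (exp N) = exp r" by (simp add: norm_exp_eq_Re r_def)
    then have eq: "norm (y' 1 / D 1) = exp r * norm (F q) / (norm q * norm (D 1))"
      by (simp add: y'_def g_def norm_mult norm_divide)
    have "norm q = sqrt (norm N)" by (simp add: q_def norm_csqrt)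
    also have "\<dots> \<le> sqrt ((1 + k)\<^sup>2 * r)"
    proof -
      have "(1 + k) * r \<le> (1 + k)\<^sup>2 * r"
        using k r self_le_power[of "1 + k" 2] by (intro mult_right_mono) auto
      then show ?thesis unfolding real_sqrt_le_iff using nN by linarith
    qed
    also have "\<dots> = (1 + k) * s" using k by (simp add: real_sqrt_mult s_def)
    finally have nq: "norm q \<le> (1 + k) * s" .
    have "norm (D 1) \<le> 1 + 2 * norm N" unfolding D_def by (rule norm_triangle_le) (simp add: norm_mult)
    also have "\<dots> \<le> 3 * norm N" using nN1 by simp
    also have "\<dots> \<le> 3 * ((1 + k) * s\<^sup>2)" using nN s by simp
    finally have nD: "norm (D 1) \<le> 3 * ((1 + k) * s\<^sup>2)" .
    have "1 / 4 \<le> norm (F q)" unfolding q_def by (rule erf_lower_bound[OF F F0 N R'])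
    then have "exp r * (1 / 4) / ((1 + k) * s * (3 * ((1 + k) * s\<^sup>2))) \<le> exp r * norm (F q) / (norm q * norm (D 1))"
      using q nq nD D1(2)[of 1] k s by (intro frac_le mult_mono mult_left_mono) auto
    then show ?thesis unfolding eq by (simp add: power2_eq_square power3_eq_cube field_simps)
  qed
  have "exp r / (12 * (1 + k)\<^sup>2 * s ^ 3) \<le> norm (y 1) + norm (h 1)"
  proof -
    have "y' 1 / D 1 = y 1 - h 1" by (simp add: h_def)
    then show ?thesis using low norm_triangle_ineq4[of "y 1" "h 1"] by simp
  qed
  then have 2: "exp r / (12 * (1 + k)\<^sup>2 * s ^ 3) - (A * exp r / s ^ 4 + 1 / 2) \<le> norm (y 1)"
    using h1' by linarith
  have "12 * exp r / s ^ 4 + A * exp r / s ^ 4 + 1 / 2 \<le> exp r / (12 * (1 + k)\<^sup>2 * s ^ 3)"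
  proof -
    have e: "s ^ 4 / 2 \<le> exp r"
      using exp_ge_half_square[of r] r s(3) by (metis less_eq_real_def less_trans num_double numeral_times_numeral power_mult zero_less_one)
    have "A \<le> 24 * (1 + k)" unfolding A_def using s k by (simp add: divide_le_eq)
    then have "12 * exp r / s ^ 4 + A * exp r / s ^ 4 \<le> (36 * (1 + k)) * exp r / s ^ 4"
      unfolding add_divide_distrib[symmetric] distrib_right[symmetric] using s k
      by (intro divide_right_mono mult_right_mono) auto
    moreover have "1 / 2 \<le> (1 + k) * exp r / s ^ 4"
    proof -
      have "s ^ 4 / 2 \<le> (1 + k) * exp r" using e k by (smt (verit) exp_gt_zero mult_le_cancel_right1)
      then show ?thesis using s by (simp add: field_simps)
    qed
    \<comment> \<open>Origin of 444 = 12 * 37: the target 12 and the error 24 (1 + k) make at most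
      36 (1 + k), the constant 1/2 costs another 1 + k, and 12 (1 + k)^2 is the denominator of the
      lower bound.\<close>
    moreover have "(37 * (1 + k)) * exp r / s ^ 4 \<le> exp r / (12 * (1 + k)\<^sup>2 * s ^ 3)"
    proof -
      have "(37 * (1 + k)) * exp r / s ^ 4 = (444 * (1 + k) ^ 3) * (exp r / (12 * (1 + k)\<^sup>2 * s ^ 4))"
        using k by (simp add: power2_eq_square power3_eq_cube)
      also have "\<dots> \<le> s * (exp r / (12 * (1 + k)\<^sup>2 * s ^ 4))"
        using s by (intro mult_right_mono) auto
      also have "\<dots> = exp r / (12 * (1 + k)\<^sup>2 * s ^ 3)"
        using s by (simp add: power3_eq_cube power4_eq_xxxx)
      finally show ?thesis .
    qed
    moreover have "36 * (1 + k) * exp r / s ^ 4 + (1 + k) * exp r / s ^ 4 = (37 * (1 + k)) * exp r / s ^ 4"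
      by (simp add: add_divide_distrib[symmetric] distrib_right[symmetric])
    moreover have "u + v \<le> c \<Longrightarrow> 1 / 2 \<le> d \<Longrightarrow> e \<le> f \<Longrightarrow> c + d = e \<Longrightarrow> u + v + 1 / 2 \<le> f" for u v c d e f :: real
      by linarith
    ultimately show ?thesis by blast
  qed
  moreover have "s ^ 4 = r\<^sup>2" using s(3) by (metis num_double numeral_times_numeral power_mult)
  ultimately have "12 * exp r / r\<^sup>2 \<le> norm (y 1)" using 2 by simp
  then show ?thesis using that[OF y y' y0] by (simp add: r_def)
qed

text \<open>\<open>\<mu>\<close> is the fixed point of \<open>\<mu> \<mapsto> \<mu> + w(1; N, \<mu>) / (1 - w(1; N, 1))\<close>, a contraction of the closed unit disc
  by the first order expansion of \<open>w\<close>; being a uniform limit of iterates, it is holomorphic in \<open>N\<close>.\<close>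

lemma eigenvalue_correction:
  fixes k :: real
  assumes k: "k > 0"
  obtains R \<mu> where "R \<ge> 1" "\<mu> holomorphic_on sector R k"
    "\<And>N. N \<in> sector R k \<Longrightarrow> norm (\<mu> N) \<le> 1" "\<And>N. N \<in> sector R k \<Longrightarrow> wr N (\<mu> N) 1 = 0"
proof -
  define R where "R = (444 * (1 + k) ^ 3)\<^sup>2"
  define S where "S = sector R k"
  have "(1 + k) ^ 3 \<ge> 1" using k one_le_power[of "1 + k" 3] by simp
  then have R1: "R \<ge> 1" using one_le_power[of "444 * (1 + k) ^ 3" 2] by (simp add: R_def)
  \<comment> \<open>The secant slope of - w(1; N, \<mu>) between \<mu> = 0 and \<mu> = 1, which
    makes \<open>Tm\<close> a chord version of Newton's method. It replaces the response y(1), which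
    is obtained for each N separately, by a quantity that is visibly holomorphic in N.\<close>
  define St where "St N = 1 - wr N 1 1" for N
  define Tm where "Tm N m = m + wr N m 1 / St N" for N m
  have key: "St N \<noteq> 0 \<and> norm (Tm N 0) \<le> 1 / 2 \<and>
      (\<forall>m n. norm m \<le> 1 \<longrightarrow> norm n \<le> 1 \<longrightarrow> norm (Tm N m - Tm N n) \<le> norm (m - n) / 2)"
    if N: "N \<in> S" for N
  proof -
    define \<rho> where "\<rho> = Re N"
    have \<rho>: "\<rho> > 1" using N R1 by (auto simp: S_def sector_def \<rho>_def)
    obtain y y' :: "real \<Rightarrow> complex" where y: "\<And>x. (y has_vector_derivative y' x) (at x)"
      "\<And>x. (y' has_vector_derivative 2 * N * of_real x * y' x + 1) (at x)"
      "y 0 = 0" "y' 0 = 0" and low: "12 * exp \<rho> / \<rho>\<^sup>2 \<le> norm (y 1)"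
      using linear_response_lower_bound[OF k, of N R] N unfolding S_def R_def \<rho>_def by blast
    \<comment> \<open>The linearisation error per unit of |m - n|. The response is at least 8
      \<delta>, hence the slope \<open>St\<close> at least 7 \<delta>, and the contraction factor
      2/7 is below 1/2. As \<delta> \<ge> 3/4, also |St| \<ge> 2, so 0 is sent into the disc of
      radius 1/2 and the unit disc is preserved.\<close>
    define \<delta> where "\<delta> = 3 * exp \<rho> / (2 * \<rho>\<^sup>2)"
    have \<delta>: "\<delta> \<ge> 3 / 4"
      using exp_ge_half_square[of \<rho>] \<rho> by (simp add: \<delta>_def field_simps)
    have low: "8 * \<delta> \<le> norm (y 1)" using low by (simp add: \<delta>_def)
    have fo: "norm (wr N m 1 - wr N n 1 + (m - n) * y 1) \<le> norm (m - n) * \<delta>"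
      if "norm m \<le> 1" "norm n \<le> 1" for m n
      using wr_first_order[OF y _ that] \<rho> by (simp add: \<rho>_def \<delta>_def mult_ac)
    have w0: "wr N 0 1 = 1" by (simp add: wr_def wfun_mu_0)
    have St: "norm (y 1 - St N) \<le> \<delta>" using fo[of 1 0] by (simp add: St_def w0 algebra_simps)
    then have St7: "norm (St N) \<ge> 7 * \<delta>" using low norm_triangle_ineq2[of "y 1" "St N"] by linarith
    then have St2: "norm (St N) \<ge> 2" "St N \<noteq> 0" using \<delta> by auto
    have "norm (Tm N 0) \<le> 1 / 2" using St2 by (simp add: Tm_def w0 norm_divide field_simps)
    moreover have "norm (Tm N m - Tm N n) \<le> norm (m - n) / 2" if mn: "norm m \<le> 1" "norm n \<le> 1" for m n
    proof -
      \<comment> \<open>Two linearisation errors appear: the one between m and n, and the one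
        between 1 and 0 contained in y(1) - St.\<close>
      have "Tm N m - Tm N n = ((wr N m 1 - wr N n 1 + (m - n) * y 1) - (m - n) * (y 1 - St N)) / St N"
        using St2 by (simp add: Tm_def field_simps)
      also have "norm \<dots> \<le> (norm (m - n) * \<delta> + norm (m - n) * \<delta>) / norm (St N)"
        unfolding norm_divide
        by (intro divide_right_mono norm_ge_zero order_trans[OF norm_triangle_ineq4] add_mono fo mn)
           (simp add: norm_mult mult_left_mono St)
      also have "\<dots> \<le> (norm (m - n) * \<delta> + norm (m - n) * \<delta>) / (4 * \<delta>)"
        using St7 \<delta> by (intro divide_left_mono mult_pos_pos) auto
      also have "\<dots> = norm (m - n) / 2" using \<delta> by (simp add: field_simps)
      finally show ?thesis .
    qed
    ultimately show ?thesis using St2 by blast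
  qed
  have contr: "norm (Tm N m - Tm N n) \<le> norm (m - n) / 2" if "N \<in> S" "norm m \<le> 1" "norm n \<le> 1" for N m n
    using key that by blast
  define M where "M = rec_nat (\<lambda>N. 0) (\<lambda>_ m N. Tm N (m N))"
  have M0: "M 0 N = 0" and MS: "M (Suc j) N = Tm N (M j N)" for j N by (simp_all add: M_def)
  have M_le: "norm (M j N) \<le> 1" if N: "N \<in> S" for j N
  proof (induction j)
    case (Suc j)
    have "norm (M (Suc j) N) \<le> norm (Tm N (M j N) - Tm N 0) + norm (Tm N 0)"
      unfolding MS by (metis add.commute norm_triangle_sub)
    also have "\<dots> \<le> norm (M j N - 0) / 2 + 1 / 2" using key[OF N] contr[OF N Suc, of 0] by (intro add_mono) auto
    finally show ?case using Suc by simp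
  qed (simp add: M0)
  have M_diff: "norm (M (Suc j) N - M j N) \<le> (1/2) ^ j" if N: "N \<in> S" for j N
  proof (induction j)
    case 0 then show ?case using M_le[OF N, of 1] by (simp add: M0)
  next
    case (Suc j)
    have "norm (M (Suc (Suc j)) N - M (Suc j) N) \<le> norm (M (Suc j) N - M j N) / 2"
      unfolding MS[of "Suc j"] using contr[OF N M_le[OF N] M_le[OF N], of "Suc j" j] by (simp only: MS)
    then show ?case using Suc by simp
  qed
  \<comment> \<open>Writing the limit as a telescoping series with the majorant (1/2)^j, the same
    for all N, gives the uniform convergence that carries holomorphy over to \<mu>.\<close>
  define \<mu> where "\<mu> N = (\<Sum>j. M (Suc j) N - M j N)" for N
  have ul: "uniform_limit S M \<mu> sequentially"
  proof -
    have "uniform_limit S (\<lambda>n N. \<Sum>j<n. M (Suc j) N - M j N) \<mu> sequentially"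
      unfolding \<mu>_def using M_diff by (intro Weierstrass_m_test[where M = "\<lambda>j. (1/2) ^ j"]) (auto simp: summable_geometric)
    moreover have "(\<Sum>j<n. M (Suc j) N - M j N) = M n N" for n N
      using sum_lessThan_telescope[of "\<lambda>j. M j N" n] by (simp add: M0)
    ultimately show ?thesis by simp
  qed
  have opS: "open S" unfolding S_def by (rule open_sector)
  have holM: "M j holomorphic_on S" for j
  proof (induction j)
    case (Suc j)
    have "(\<lambda>N. M j N + wr N (M j N) 1 / St N) holomorphic_on S"
      unfolding St_def wr_def using key
      by (intro holomorphic_intros wfun_holomorphic opS Suc) (auto simp: St_def wr_def)
    then show ?case by (simp add: MS [abs_def] Tm_def)
  qed (simp add: M0 [abs_def])
  have "\<mu> holomorphic_on S"
  proof (rule holomorphic_uniform_sequence[OF opS holM])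
    fix N assume "N \<in> S"
    then obtain d where "d > 0" "cball N d \<subseteq> S" using opS unfolding open_contains_cball by blast
    then show "\<exists>d>0. cball N d \<subseteq> S \<and> uniform_limit (cball N d) M \<mu> sequentially"
      using uniform_limit_on_subset[OF ul] by blast
  qed
  moreover have lim: "(\<lambda>j. M j N) \<longlonglongrightarrow> \<mu> N" if "N \<in> S" for N
    using tendsto_uniform_limitI[OF ul that] .
  have mu1: "norm (\<mu> N) \<le> 1" if N: "N \<in> S" for N
    using Lim_norm_ubound[OF trivial_limit_sequentially lim[OF N]] M_le[OF N] by auto
  moreover have "wr N (\<mu> N) 1 = 0" if N: "N \<in> S" for N
  proof -
    have "(\<lambda>j. norm (M j N - \<mu> N) / 2) \<longlonglongrightarrow> 0"
      using tendsto_norm_zero[OF LIM_zero[OF lim[OF N]]] by (auto intro!: tendsto_eq_intros)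
    then have "(\<lambda>j. Tm N (M j N) - Tm N (\<mu> N)) \<longlonglongrightarrow> 0"
      by (rule Lim_null_comparison[rotated]) (use contr[OF N M_le[OF N] mu1[OF N]] in simp)
    then have "(\<lambda>j. M (Suc j) N) \<longlonglongrightarrow> Tm N (\<mu> N)" unfolding MS by (rule LIM_zero_cancel)
    then have "Tm N (\<mu> N) = \<mu> N"
      using LIMSEQ_Suc[OF lim[OF N]] LIMSEQ_unique by blast
    then show ?thesis using key[OF N] by (simp add: Tm_def)
  qed
  ultimately show ?thesis using that[of R \<mu>] R1 unfolding S_def by blast
qed

text \<open>The odd coefficients vanish because their majorant \<open>wbound\<close> does. Evenness
  supplies the boundary condition at -1 and transfers the bounds on [0, 1] to [-1, 1].\<close>

lemma wr_even: "wr N \<mu> (- x) = wr N \<mu> x"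
proof -
  have "wc N \<mu> n * (- of_real x) ^ n = wc N \<mu> n * of_real x ^ n" for n
  proof (cases "even n")
    case False
    then have "wc N \<mu> n = 0"
      using wc_bound[of N \<mu> "norm N + norm \<mu>" n] by (simp add: wbound_def)
    then show ?thesis by simp
  qed simp
  then show ?thesis by (simp only: wr_def wfun_def of_real_minus)
qed

section \<open>Eigenfunctions for complex frequency: bounds and holomorphy\<close>

definition efun :: "complex \<Rightarrow> complex \<Rightarrow> real \<Rightarrow> complex" where
  "efun N \<mu> x = exp (- N * (of_real x)\<^sup>2 / 2) * wr N \<mu> x"

definition efun' :: "complex \<Rightarrow> complex \<Rightarrow> real \<Rightarrow> complex" where
  "efun' N \<mu> x = exp (- N * (of_real x)\<^sup>2 / 2) * (wr' N \<mu> x - N * of_real x * wr N \<mu> x)"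

lemma gauss_deriv:
  fixes N :: complex
  shows
  "((\<lambda>x. exp (- N * (of_real x)\<^sup>2 / 2)) has_vector_derivative - N * of_real x * exp (- N * (of_real x)\<^sup>2 / 2)) (at x)"
proof -
  have "((\<lambda>z. exp (- N * z\<^sup>2 / 2)) has_field_derivative - N * of_real x * exp (- N * (of_real x)\<^sup>2 / 2)) (at (of_real x))"
    by (auto intro!: derivative_eq_intros)
  from vector_derivative_of_real[OF this] show ?thesis .
qed

lemma efun_deriv: "(efun N \<mu> has_vector_derivative efun' N \<mu> x) (at x)"
  using has_vector_derivative_mult[OF gauss_deriv[of N x] wr_deriv[of N \<mu> x UNIV]]
  unfolding efun_def [abs_def] efun'_def by (simp add: algebra_simps)

lemma efun'_deriv:
  "(efun' N \<mu> has_vector_derivative ((N * of_real x)\<^sup>2 - (N + \<mu>)) * efun N \<mu> x) (at x)"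
proof -
  have i: "((\<lambda>x. N * of_real x) has_vector_derivative N) (at x)"
  proof -
    have "((\<lambda>z. N * z) has_field_derivative N) (at (of_real x))" by (auto intro!: derivative_eq_intros)
    from vector_derivative_of_real[OF this] show ?thesis .
  qed
  have "((\<lambda>x. wr' N \<mu> x - N * of_real x * wr N \<mu> x) has_vector_derivative
     (2 * N * of_real x * wr' N \<mu> x - \<mu> * wr N \<mu> x) - (N * of_real x * wr' N \<mu> x + N * wr N \<mu> x)) (at x)"
    by (intro has_vector_derivative_diff has_vector_derivative_mult i wr'_deriv wr_deriv)
  from has_vector_derivative_mult[OF gauss_deriv[of N x] this]
  show ?thesis unfolding efun_def efun'_def [abs_def] by (simp add: algebra_simps power2_eq_square)
qed

text \<open>The weighted bound of w costs exp (Re N x^2) and the Gaussian returns half of the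
  exponent. Only the exponential type in Re N matters later, together with the absence of any growth
  in Im N.\<close>

lemma efun_bound:
  assumes "Re N \<ge> 1" "norm \<mu> \<le> 1" "\<bar>x\<bar> \<le> 1"
  shows "norm (efun N \<mu> x) \<le> 2 * exp (Re N)"
proof -
  have w: "norm (wr N \<mu> x) \<le> 2 * exp (Re N * x\<^sup>2)"
    using wr_bounds(1)[OF assms(1,2), of "\<bar>x\<bar>"] assms(3) by (cases "x \<ge> 0") (auto simp: wr_even)
  have "norm (efun N \<mu> x) = exp (- (Re N * x\<^sup>2 / 2)) * norm (wr N \<mu> x)"
    by (simp add: efun_def norm_mult norm_exp_eq_Re)
  also have "\<dots> \<le> exp (- (Re N * x\<^sup>2 / 2)) * (2 * exp (Re N * x\<^sup>2))" using w by (intro mult_left_mono) auto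
  also have "\<dots> = 2 * exp (Re N * x\<^sup>2 / 2)" by (simp add: exp_add[symmetric])
  also have "\<dots> \<le> 2 * exp (Re N)"
  proof -
    have "Re N * x\<^sup>2 \<le> Re N * 1" using assms by (intro mult_left_mono) (auto simp: abs_square_le_1)
    then show ?thesis using assms(1) by simp
  qed
  finally show ?thesis .
qed

text \<open>On [0, 1/n] the Gaussian is at least 1/2, and w differs from 1 by at most (exp (n x^2) -
  1) / n \<le> 1/2. The purpose is a lower bound for the norm of the ground state by a power of
  n.\<close>

lemma efun_lower_bound:
  assumes n: "real n \<ge> 4" and \<mu>: "norm \<mu> \<le> 1" and x: "0 \<le> x" "x \<le> 1 / real n"
  shows "1 / 4 \<le> norm (efun (of_nat n) \<mu> x)"
proof -
  have nx: "real n * x\<^sup>2 \<le> 1 / 4"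
  proof -
    have "real n * x\<^sup>2 \<le> real n * (1 / real n)\<^sup>2" using x by (intro mult_left_mono power_mono) auto
    also have "\<dots> = 1 / real n" using n by (simp add: power2_eq_square)
    also have "\<dots> \<le> 1 / 4" using n by simp
    finally show ?thesis .
  qed
  have "1 / real n \<le> 1" using n by simp
  then have "x \<le> 1" using x by linarith
  have "norm (wr (of_nat n) \<mu> x - 1) \<le> (exp (real n * x\<^sup>2) - 1) / real n"
    using wr_bounds(2)[of "of_nat n" \<mu> x] n \<mu> x \<open>x \<le> 1\<close> by simp
  also have "\<dots> \<le> (3 - 1) / 4"
  proof (rule frac_le)
    have "exp (real n * x\<^sup>2) \<le> exp 1" using nx by simp
    then show "exp (real n * x\<^sup>2) - 1 \<le> 3 - 1" using exp_le by linarith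
  qed (use n in auto)
  finally have w: "1 / 2 \<le> norm (wr (of_nat n) \<mu> x)"
    using norm_triangle_ineq2[of 1 "wr (of_nat n) \<mu> x"] by (simp add: norm_minus_commute)
  have "1 / 2 \<le> exp (- (1 / 2) :: real)" using exp_ge_add_one_self[of "- (1/2) :: real"] by simp
  also have "\<dots> \<le> exp (- (real n * x\<^sup>2 / 2))" using nx by simp
  finally have e: "1 / 2 \<le> exp (- (real n * x\<^sup>2 / 2))" .
  have "norm (efun (of_nat n) \<mu> x) = exp (- (real n * x\<^sup>2 / 2)) * norm (wr (of_nat n) \<mu> x)"
    by (simp add: efun_def norm_mult norm_exp_eq_Re)
  moreover have "1 / 2 * (1 / 2) \<le> exp (- (real n * x\<^sup>2 / 2)) * norm (wr (of_nat n) \<mu> x)"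
    by (intro mult_mono e w) auto
  ultimately show ?thesis by simp
qed

lemma efun_holomorphic:
  assumes "open S" "\<mu> holomorphic_on S"
  shows "(\<lambda>N. efun N (\<mu> N) x) holomorphic_on S"
  unfolding efun_def wr_def by (intro holomorphic_intros wfun_holomorphic assms) auto

lemma efun_boundary: "wr N \<mu> 1 = 0 \<Longrightarrow> efun N \<mu> 1 = 0 \<and> efun N \<mu> (- 1) = 0"
  by (simp add: efun_def wr_even)

subsection \<open>Alternating sums over the integers\<close>

text \<open>The zero of sin (\<pi> s) at n is simple with derivative (-1)^n \<pi>; this sign is the
  source of the alternating sum.\<close>

lemma residue_cosecant:
  assumes "open S" "of_nat n \<in> S" and \<Phi>: "\<Phi> holomorphic_on S"
  shows "residue (\<lambda>s::complex. \<Phi> s * (pi / sin (pi * s))) (of_nat n) = (-1) ^ n * \<Phi> (of_nat n)"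
proof -
  obtain r where r: "r > 0" "ball (of_nat n) r \<subseteq> S" using assms open_contains_ball by blast
  \<comment> \<open>A radius of at most 1 keeps all other integers, hence all other zeros of the
    sine, outside.\<close>
  define U :: "complex set" where "U = ball (of_nat n) (min r 1)"
  have U: "open U" "of_nat n \<in> U" "U \<subseteq> S" using r by (auto simp: U_def)
  have sin0: "sin (complex_of_real pi * s) \<noteq> 0" if "s \<in> U - {of_nat n}" for s
  proof
    assume "sin (complex_of_real pi * s) = 0"
    then obtain m :: int where "complex_of_real pi * s = of_real (m * pi)" unfolding sin_eq_0 by blast
    then have s: "s = of_int m" by (simp add: mult.commute)
    have "norm (s - of_nat n) < 1" using that by (simp add: U_def dist_norm norm_minus_commute)
    moreover have "s - of_nat n = of_int (m - int n)" by (simp add: s)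
    ultimately have "real_of_int \<bar>m - int n\<bar> < 1" by (metis norm_of_int of_int_abs)
    then have "m = int n" by linarith
    then show False using that s by auto
  qed
  have cn: "cos (complex_of_real pi * of_nat n) = (-1) ^ n"
    by (metis cos_npi cos_of_real mult.commute of_real_minus of_real_1 of_real_mult of_real_of_nat_eq of_real_power)
  have sn: "sin (complex_of_real pi * of_nat n) = 0"
    unfolding sin_eq_0 by (intro exI[of _ "int n"]) simp
  show ?thesis
  proof (rule residue_simple'[OF U(1,2)])
    show "(\<lambda>s::complex. \<Phi> s * (pi / sin (pi * s))) holomorphic_on U - {of_nat n}"
      using sin0 U by (intro holomorphic_intros holomorphic_on_subset[OF \<Phi>]) auto
    have "((\<lambda>s. sin (complex_of_real pi * s)) has_field_derivative (-1) ^ n * complex_of_real pi) (at (of_nat n :: complex))"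
      using cn by (auto intro!: derivative_eq_intros)
    then have "((\<lambda>s. sin (complex_of_real pi * s) / (s - of_nat n)) \<longlongrightarrow> (-1) ^ n * complex_of_real pi) (at (of_nat n :: complex))"
      unfolding has_field_derivative_iff using sn by simp
    moreover have "(\<Phi> \<longlongrightarrow> \<Phi> (of_nat n)) (at (of_nat n :: complex))"
      using holomorphic_on_imp_continuous_on[OF \<Phi>] assms by (metis continuous_on_eq_continuous_at isCont_def)
    ultimately have "((\<lambda>s::complex. \<Phi> s * (pi / (sin (complex_of_real pi * s) / (s - of_nat n)))) \<longlongrightarrow>
        \<Phi> (of_nat n) * (pi / ((-1) ^ n * complex_of_real pi))) (at (of_nat n :: complex))"
      by (intro tendsto_intros) auto
    then show "((\<lambda>s::complex. \<Phi> s * (pi / sin (pi * s)) * (s - of_nat n)) \<longlongrightarrow> (-1) ^ n * \<Phi> (of_nat n)) (at (of_nat n :: complex))"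
      by (cases "even n") (simp_all add: mult_ac)
  qed
qed

text \<open>The contour crosses the real axis at half-integers only, where \<open>1 / sin (\<pi> z)\<close> is bounded.\<close>

locale nodal_triangle =
  fixes n0 M :: nat and k :: real
  assumes n0: "n0 \<le> M" "n0 \<ge> 1" and k: "k \<ge> 1"
begin

text \<open>The distance from the apex \<open>A\<close> to the vertical side at M + 1/2. On the real
  axis the triangle encloses exactly the integers from n0 to M; its sides through \<open>A\<close>
  have slopes k and - k, and \<open>tri\<close> runs counterclockwise.\<close>

definition h :: real where "h = real M + 1 - real n0"
definition A :: complex where "A = of_real (real n0 - 1 / 2)"
definition Bl :: complex where "Bl = Complex (real M + 1 / 2) (- k * h)"
definition Bu :: complex where "Bu = Complex (real M + 1 / 2) (k * h)"
definition tri :: "real \<Rightarrow> complex" where "tri = linepath A Bl +++ linepath Bl Bu +++ linepath Bu A"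

lemma h: "h \<ge> 1" using n0 by (simp add: h_def)

lemma vertices [simp]:
  "Re A = real n0 - 1 / 2" "Im A = 0"
  "Re Bl = real n0 - 1 / 2 + h" "Im Bl = - (k * h)"
  "Re Bu = real n0 - 1 / 2 + h" "Im Bu = k * h"
  by (auto simp: A_def Bl_def Bu_def h_def)

text \<open>The integers in question lie in an open subset \<open>U\<close> of the convex hull,
  hence in its interior; there the winding number of a triangle is determined by the sign of one
  cross product.\<close>

lemma winding_number_tri:
  assumes n: "n \<in> {n0..M}"
  shows "winding_number tri (of_nat n) = 1"
proof -
  define U where "U = {z. \<bar>Im z\<bar> < k * (Re z - (real n0 - 1 / 2)) \<and> Re z < real M + 1 / 2}"
  have "U = {z. Im z < k * (Re z - (real n0 - 1 / 2))} \<inter> {z. - Im z < k * (Re z - (real n0 - 1 / 2))} \<inter> {z. Re z < real M + 1 / 2}"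
    by (auto simp: U_def abs_less_iff)
  also have "open \<dots>" by (intro open_Int open_Collect_less continuous_intros)
  finally have "open U" .
  moreover have "U \<subseteq> convex hull {A, Bl, Bu}"
  proof
    fix z assume z: "z \<in> U"
    \<comment> \<open>Distance from the apex and height, relative to h and k h; they yield the
      barycentric weights 1 - t, (t - r)/2 and (t + r)/2.\<close>
    define t where "t = (Re z - (real n0 - 1 / 2)) / h"
    define r where "r = Im z / (k * h)"
    have "\<bar>r\<bar> < t"
      using z h k by (auto simp: r_def t_def U_def abs_divide abs_mult field_simps)
    moreover have "t < 1" using z h by (auto simp: t_def U_def h_def field_simps)
    moreover have "z = (1 - t) *\<^sub>R A + ((t - r) / 2) *\<^sub>R Bl + ((t + r) / 2) *\<^sub>R Bu"
    proof (rule complex_eqI)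
      have th: "t * h = Re z - (real n0 - 1 / 2)" using h by (simp add: t_def)
      have "Re ((1 - t) *\<^sub>R A + ((t - r) / 2) *\<^sub>R Bl + ((t + r) / 2) *\<^sub>R Bu) = (real n0 - 1 / 2) + t * h"
        by (simp add: field_simps)
      then show "Re z = Re ((1 - t) *\<^sub>R A + ((t - r) / 2) *\<^sub>R Bl + ((t + r) / 2) *\<^sub>R Bu)" using th by simp
      have "r * (k * h) = Im z" using h k by (simp add: r_def)
      then show "Im z = Im ((1 - t) *\<^sub>R A + ((t - r) / 2) *\<^sub>R Bl + ((t + r) / 2) *\<^sub>R Bu)"
        by (simp add: field_simps)
    qed
    ultimately show "z \<in> convex hull {A, Bl, Bu}"
      unfolding convex_hull_3 mem_Collect_eq
      by (intro exI[of _ "1 - t"] exI[of _ "(t - r) / 2"] exI[of _ "(t + r) / 2"]) (auto simp: field_simps)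
  qed
  ultimately have "U \<subseteq> interior (convex hull {A, Bl, Bu})" by (rule interior_maximal[rotated])
  moreover have "complex_of_nat n \<in> U" using n k by (auto simp: U_def)
  ultimately have i: "complex_of_nat n \<in> interior (convex hull {A, Bl, Bu})" by blast
  have "Im ((Bl - A) * cnj (Bl - of_nat n)) = k * h * (real n - (real n0 - 1 / 2))"
    by (simp add: algebra_simps)
  also have "\<dots> > 0" using h k n by (intro mult_pos_pos) auto
  finally show ?thesis unfolding tri_def winding_number_triangle[OF i] by simp
qed

lemma path_image_tri:
  "path_image tri = closed_segment A Bl \<union> closed_segment Bl Bu \<union> closed_segment Bu A"
  by (simp add: tri_def path_image_join Un_assoc)

text \<open>Both sides through the apex are described by the fraction t counted from the apex, so
  that the estimates below can treat them alike.\<close>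

lemma slant_cases:
  assumes "z \<in> closed_segment A Bl \<union> closed_segment Bu A"
  obtains t where "0 \<le> t" "t \<le> 1" "Re z = real n0 - 1 / 2 + t * h" "\<bar>Im z\<bar> = k * (t * h)"
proof (cases "z \<in> closed_segment A Bl")
  case True
  then obtain t where t: "0 \<le> t" "t \<le> 1" "z = (1 - t) *\<^sub>R A + t *\<^sub>R Bl" by (auto simp: in_segment)
  have "Re z = real n0 - 1 / 2 + t * h" "\<bar>Im z\<bar> = k * (t * h)"
    unfolding t(3) using t(1,2) h k by (auto simp: algebra_simps abs_mult)
  then show ?thesis using t by (intro that[of t])
next
  case False
  then obtain t where t: "0 \<le> t" "t \<le> 1" "z = (1 - t) *\<^sub>R Bu + t *\<^sub>R A" using assms by (auto simp: in_segment)
  have "\<bar>Im z\<bar> = (1 - t) * (k * h)" using t(1,2) h k unfolding t(3) by (simp add: abs_mult)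
  moreover have "Re z = real n0 - 1 / 2 + (1 - t) * h" unfolding t(3) by (simp add: algebra_simps)
  ultimately show ?thesis using t(1,2) by (intro that[of "1 - t"]) (simp_all add: mult_ac)
qed

lemma edge_cases:
  assumes "z \<in> closed_segment Bl Bu"
  shows "Re z = real M + 1 / 2" "\<bar>Im z\<bar> \<le> k * h"
proof -
  obtain t where t: "0 \<le> t" "t \<le> 1" "z = (1 - t) *\<^sub>R Bl + t *\<^sub>R Bu" using assms by (auto simp: in_segment)
  show "Re z = real M + 1 / 2" unfolding t(3) by (simp add: h_def algebra_simps)
  have "Im z = (2 * t - 1) * (k * h)" unfolding t(3) by (simp add: algebra_simps)
  then have "\<bar>Im z\<bar> = \<bar>2 * t - 1\<bar> * (k * h)" using h k by (simp add: abs_mult)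
  also have "\<dots> \<le> 1 * (k * h)" using t h k by (intro mult_right_mono) auto
  finally show "\<bar>Im z\<bar> \<le> k * h" by simp
qed

lemma tri_Re: "z \<in> path_image tri \<Longrightarrow> real n0 - 1 / 2 \<le> Re z \<and> Re z \<le> real M + 1 / 2 \<and> \<bar>Im z\<bar> \<le> k * (Re z - (real n0 - 1 / 2))"
proof -
  assume "z \<in> path_image tri"
  then consider "z \<in> closed_segment A Bl \<union> closed_segment Bu A" | "z \<in> closed_segment Bl Bu"
    unfolding path_image_tri by blast
  then show ?thesis
  proof cases
    case 1
    then obtain t where t: "0 \<le> t" "t \<le> 1" "Re z = real n0 - 1 / 2 + t * h" "\<bar>Im z\<bar> = k * (t * h)"
      by (rule slant_cases)
    have "t * h \<le> 1 * h" "t * h \<ge> 0" using t h by (intro mult_right_mono, auto)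
    then show ?thesis using t by (auto simp: h_def)
  next
    case 2
    then show ?thesis using edge_cases[OF 2] n0 by (simp add: h_def algebra_simps)
  qed
qed

text \<open>With u = 2 \<pi> |Im z|, 4 |sin (\<pi> z)|^2 = e^u + e^(-u) - 2 cos (2 \<pi> Re z). On
  the vertical side the cosine is -1. On the slanted sides it is nonpositive as long as Re z is
  within 1/4 of the apex; beyond that, |Im z| \<ge> 1/4 because the slope is at least 1, and e^u
  dominates.\<close>

lemma sin_lower_bound:
  fixes z :: complex
  assumes "z \<in> path_image tri"
  shows "exp (pi * \<bar>Im z\<bar>) / 4 \<le> norm (sin (pi * z))"
proof -
  define u where "u = 2 * pi * \<bar>Im z\<bar>"
  have sq: "(norm (sin (pi * z)))\<^sup>2 = (exp u + exp (- u) - 2 * cos (2 * pi * Re z)) / 4"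
    unfolding norm_sin_squared u_def by (cases "Im z \<ge> 0") (auto simp: exp_minus mult_ac)
  have "exp u / 4 \<le> exp u + exp (- u) - 2 * cos (2 * pi * Re z)"
  proof (cases "z \<in> closed_segment Bl Bu")
    case True
    have "cos (2 * pi * Re z) = cos (real (2 * M) * pi + pi)" using edge_cases[OF True] by (simp add: algebra_simps)
    also have "\<dots> = - 1" by (simp add: cos_add del: of_nat_mult)
    finally have "cos (2 * pi * Re z) \<le> 0" by simp
    then show ?thesis using exp_gt_zero[of u] exp_gt_zero[of "- u"] by (simp del: exp_gt_zero)
  next
    case False
    then have "z \<in> closed_segment A Bl \<union> closed_segment Bu A" using assms by (auto simp: path_image_tri)
    then obtain t where t: "0 \<le> t" "t \<le> 1" "Re z = real n0 - 1 / 2 + t * h" "\<bar>Im z\<bar> = k * (t * h)"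
      by (rule slant_cases)
    have th: "t * h \<ge> 0" using t h by simp
    obtain m where m: "n0 = Suc m" using n0 by (cases n0) auto
    have "cos (2 * pi * Re z) = cos (real (2 * m) * pi + (pi + 2 * pi * (t * h)))"
      using t m by (simp add: algebra_simps)
    also have "\<dots> = - cos (2 * pi * (t * h))" by (simp add: cos_add sin_add del: of_nat_mult)
    finally have c: "cos (2 * pi * Re z) = - cos (2 * pi * (t * h))" .
    show ?thesis
    proof (cases "t * h \<le> 1 / 4")
      case True
      have "2 * pi * (t * h) \<le> pi / 2" using True by (simp add: field_simps)
      then have "cos (2 * pi * (t * h)) \<ge> 0" using th by (intro cos_ge_zero) (auto intro: order_trans[of _ 0])
      then show ?thesis using c exp_gt_zero[of u] exp_gt_zero[of "- u"] by (simp del: exp_gt_zero)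
    next
      case F: False
      have "k * (t * h) \<ge> 1 * (1 / 4)" using k F by (intro mult_mono) auto
      then have "u \<ge> 2 * pi * (1 / 4)" unfolding u_def t(4) by (intro mult_left_mono) auto
      then have "u \<ge> 1" using pi_gt3 by simp
      have "exp 1 \<le> exp u" using \<open>u \<ge> 1\<close> by simp
      moreover have "(5/2 :: real) \<le> exp 1" using exp_lower_Taylor_quadratic[of "1::real"] by simp
      ultimately have e: "exp u \<ge> 5/2" by linarith
      \<comment> \<open>With E = e^u, this is the claim E / 4 \<le> E + 1/E - 2 multiplied by 4 E
        and factored.\<close>
      have "0 \<le> (3 * exp u - 2) * (exp u - 2)" using e by (intro mult_nonneg_nonneg) auto
      then have "8 * exp u \<le> 3 * exp u * exp u + 4" by (simp add: algebra_simps)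
      then have "exp u / 4 \<le> exp u + exp (- u) - 2" by (simp add: exp_minus field_simps)
      then show ?thesis using cos_le_one[of "2 * pi * Re z"] by linarith
    qed
  qed
  then have "exp u / 16 \<le> (norm (sin (pi * z)))\<^sup>2" unfolding sq by simp
  moreover have "exp u / 16 = (exp (pi * \<bar>Im z\<bar>) / 4)\<^sup>2"
    by (simp add: u_def power_divide exp_double[symmetric] mult.assoc)
  ultimately have "(exp (pi * \<bar>Im z\<bar>) / 4)\<^sup>2 \<le> (norm (sin (pi * z)))\<^sup>2" by simp
  then show ?thesis by (rule power2_le_imp_le) simp
qed

text \<open>The residue theorem with all winding numbers equal to 1. The strip hypothesis keeps
  every integer outside n0, ..., M, and so every further pole, away from S.\<close>

lemma alternating_sum_integral:
  assumes S: "open S" "convex S" "path_image tri \<subseteq> S" and \<Phi>: "\<Phi> holomorphic_on S"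
    and strip: "\<And>z. z \<in> S \<Longrightarrow> real n0 - 1 < Re z \<and> Re z < real M + 1"
    and nodes: "\<And>n. n \<in> {n0..M} \<Longrightarrow> of_nat n \<in> S"
  shows "contour_integral tri (\<lambda>s::complex. \<Phi> s * (pi / sin (pi * s))) = 2 * pi * \<i> * (\<Sum>n=n0..M. (-1) ^ n * \<Phi> (of_nat n))"
proof -
  define P :: "complex set" where "P = of_nat ` {n0..M}"
  have vp: "valid_path tri" "pathfinish tri = pathstart tri" by (auto simp: tri_def)
  have pP: "path_image tri \<subseteq> S - P"
  proof -
    have "sin (pi * z) \<noteq> 0" if "z \<in> path_image tri" for z :: complex
      using sin_lower_bound[OF that] exp_gt_zero[of "pi * \<bar>Im z\<bar>"] by (auto simp del: exp_gt_zero)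
    moreover have "sin (complex_of_real pi * z) = 0" if zP: "z \<in> P" for z
    proof -
      obtain n where "z = of_nat n" using zP unfolding P_def by blast
      then show ?thesis unfolding sin_eq_0 by (intro exI[of _ "int n"]) simp
    qed
    ultimately show ?thesis using S(3) by blast
  qed
  have "contour_integral tri (\<lambda>s::complex. \<Phi> s * (pi / sin (pi * s))) =
     2 * pi * \<i> * (\<Sum>p\<in>P. winding_number tri p * residue (\<lambda>s::complex. \<Phi> s * (pi / sin (pi * s))) p)"
  proof (rule Residue_theorem)
    show "(\<lambda>s::complex. \<Phi> s * (pi / sin (pi * s))) holomorphic_on S - P"
    proof (intro holomorphic_intros holomorphic_on_subset[OF \<Phi>])
      fix z assume z: "z \<in> S - P"
      show "sin (complex_of_real pi * z) \<noteq> 0"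
      proof
        assume "sin (complex_of_real pi * z) = 0"
        then obtain m :: int where "complex_of_real pi * z = of_real (m * pi)" unfolding sin_eq_0 by blast
        then have zm: "z = of_int m" by (simp add: mult.commute)
        then have "real n0 - 1 < m" "m < real M + 1" using strip[of z] z by auto
        then have m: "int n0 \<le> m" "m \<le> int M" by linarith+
        then have "z = of_nat (nat m)" "nat m \<in> {n0..M}" using zm by auto
        then show False using z unfolding P_def by blast
      qed
    qed auto
    show "\<forall>z. z \<notin> S \<longrightarrow> winding_number tri z = 0"
      using winding_number_zero_outside[OF valid_path_imp_path[OF vp(1)] S(2) vp(2) _ S(3)] by blast
  qed (use S vp pP in \<open>auto simp: P_def convex_connected\<close>)
  also have "(\<Sum>p\<in>P. winding_number tri p * residue (\<lambda>s::complex. \<Phi> s * (pi / sin (pi * s))) p)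
     = (\<Sum>n=n0..M. (-1) ^ n * \<Phi> (of_nat n))"
    unfolding P_def using nodes residue_cosecant[OF S(1) _ \<Phi>] winding_number_tri
    by (subst sum.reindex) (auto simp: inj_on_def intro!: sum.cong)
  finally show ?thesis .
qed

end

context nodal_triangle
begin

text \<open>The length, of order h, is paid for by the decay: h times the integral of exp (- t h)
  over [0, 1] is at most 1. The bound is therefore independent of h, that is, of the truncation
  M.\<close>

lemma integral_along_slant:
  assumes f: "continuous_on (closed_segment A B) f" and B: "norm (B - A) \<le> (1 + k) * h"
    and bound: "\<And>t. 0 \<le> t \<Longrightarrow> t \<le> 1 \<Longrightarrow> norm (f (linepath A B t)) \<le> K * exp (- (t * h))"
  shows "norm (contour_integral (linepath A B) f) \<le> K * (1 + k)"
proof -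
  have K: "K \<ge> 0" using order_trans[OF norm_ge_zero bound[of 0]] by simp
  have eq: "contour_integral (linepath A B) f = integral {0..1} (\<lambda>t. f (linepath A B t) * (B - A))"
    by (simp add: contour_integral_integral)
  have "norm (integral {0..1} (\<lambda>t. f (linepath A B t) * (B - A))) \<le> integral {0..1} (\<lambda>t. K * (1 + k) * (h * exp (- (t * h))))"
  proof (rule integral_norm_bound_integral)
    have "continuous_on {0..1} (\<lambda>t. f (linepath A B t))"
      by (rule continuous_on_compose2[OF f]) (auto intro!: continuous_intros simp: linepath_in_path)
    then show "(\<lambda>t. f (linepath A B t) * (B - A)) integrable_on {0..1}"
      by (intro integrable_continuous_interval continuous_intros)
    show "(\<lambda>t. K * (1 + k) * (h * exp (- (t * h)))) integrable_on {0..1}"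
      by (intro integrable_continuous_interval continuous_intros)
    show "norm (f (linepath A B t) * (B - A)) \<le> K * (1 + k) * (h * exp (- (t * h)))" if "t \<in> {0..1}" for t
    proof -
      have "norm (f (linepath A B t) * (B - A)) \<le> (K * exp (- (t * h))) * ((1 + k) * h)"
        unfolding norm_mult using that bound[of t] B K by (intro mult_mono) auto
      then show ?thesis by (simp add: mult_ac)
    qed
  qed
  moreover have "integral {0..1} (\<lambda>t. K * (1 + k) * (h * exp (- (t * h)))) = K * (1 + k) * (1 - exp (- h))"
  proof (rule integral_unique)
    have "((\<lambda>t. K * (1 + k) * (h * exp (- (t * h)))) has_integral (- (K * (1 + k) * exp (- (1 * h)))) - (- (K * (1 + k) * exp (- (0 * h))))) {0..1}"
      by (rule fundamental_theorem_of_calculus)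
         (auto intro!: derivative_eq_intros simp: has_real_derivative_iff_has_vector_derivative[symmetric])
    then show "((\<lambda>t. K * (1 + k) * (h * exp (- (t * h)))) has_integral K * (1 + k) * (1 - exp (- h))) {0..1}"
      by (simp add: algebra_simps)
  qed
  moreover have "K * (1 + k) * (1 - exp (- h)) \<le> K * (1 + k) * 1" using K k by (intro mult_left_mono) auto
  ultimately show ?thesis unfolding eq by linarith
qed

end

text \<open>The damping factor \<open>exp (- \<epsilon> s Ln s)\<close> makes the integral over the right edge of the triangle negligible, and is at most
  \<open>exp (\<epsilon> \<pi> |Im s| / 2)\<close> elsewhere.\<close>

lemma norm_damping:
  assumes "Re s \<ge> 1" "\<epsilon> > 0"
  shows "norm (exp (- (complex_of_real \<epsilon> * s * Ln s))) \<le> exp (- (\<epsilon> * Re s * ln (Re s)) + \<epsilon> * (pi / 2) * \<bar>Im s\<bar>)"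
proof -
  have s0: "s \<noteq> 0" using assms by auto
  have re: "ln (Re s) \<le> ln (norm s)" using assms complex_Re_le_cmod[of s] by (intro ln_mono) auto
  have im: "\<bar>Im (Ln s)\<bar> \<le> pi / 2" using Re_Ln_pos_le[OF s0] assms by auto
  have "Im s * Im (Ln s) \<le> \<bar>Im s\<bar> * \<bar>Im (Ln s)\<bar>" by (metis abs_ge_self abs_mult)
  also have "\<dots> \<le> \<bar>Im s\<bar> * (pi / 2)" using im by (intro mult_left_mono) auto
  finally have "Im s * Im (Ln s) \<le> \<bar>Im s\<bar> * (pi / 2)" .
  then have "Im s * Im (Ln s) - Re s * ln (norm s) \<le> \<bar>Im s\<bar> * (pi / 2) - Re s * ln (Re s)"
  proof -
    have "Re s * ln (Re s) \<le> Re s * ln (norm s)" using re assms by (intro mult_left_mono) auto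
    with \<open>Im s * Im (Ln s) \<le> \<bar>Im s\<bar> * (pi / 2)\<close> show ?thesis by linarith
  qed
  then have "\<epsilon> * (Im s * Im (Ln s) - Re s * ln (norm s)) \<le> \<epsilon> * (\<bar>Im s\<bar> * (pi / 2) - Re s * ln (Re s))"
    using assms by (intro mult_left_mono) auto
  then show ?thesis using s0 by (simp add: norm_exp_eq_Re Re_Ln algebra_simps)
qed

text \<open>The constant \<open>B\<close> is made explicit so that one estimate serves the whole
  family of functions attached to the points of the control region.\<close>

definition exp_type :: "real \<Rightarrow> real \<Rightarrow> real \<Rightarrow> real \<Rightarrow> real \<Rightarrow> (complex \<Rightarrow> complex) set" where
  "exp_type R k L \<delta> B = {\<Psi>. \<Psi> holomorphic_on sector R k \<and>
     (\<forall>s\<in>sector R k. norm (\<Psi> s) \<le> B * exp (L * Re s + (pi - \<delta>) * \<bar>Im s\<bar>))}"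

definition damping :: "real \<Rightarrow> nat \<Rightarrow> real" where
  "damping \<epsilon> n = exp (- (\<epsilon> * real n * ln (real n)))"

text \<open>On the slanted sides the decay \<delta>/2 per unit of height, at slope k, outweighs the
  growth L per unit of length and leaves exp (- t h). The vertical side is negligible once M is
  large, thanks to the damping. The order of quantifiers matters: C is chosen before \<epsilon>, and
  M0 depends on \<epsilon> but not on \<Psi>, so the bound can be used pointwise under an integral
  with a fixed M.\<close>

lemma lindelof_bound:
  fixes L \<delta> k R :: real
  assumes L: "L \<ge> 0" and \<delta>: "\<delta> > 0" and kL: "k \<ge> 1" "\<delta> / 2 * k \<ge> L + 1" and n0R: "real n0 \<ge> R + 1" and R: "R \<ge> 1"
  shows "\<exists>C>0. \<forall>\<epsilon>. 0 < \<epsilon> \<and> \<epsilon> \<le> \<delta> / pi \<longrightarrow> (\<exists>M0. \<forall>M\<ge>M0. \<forall>B. \<forall>\<Psi>\<in>exp_type R k L \<delta> B.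
     norm (\<Sum>n=n0..M. (-1) ^ n * (\<Psi> (of_nat n) * of_real (damping \<epsilon> n))) \<le> C * B)"
proof -
  \<comment> \<open>Two slanted sides with 4 \<pi> B (1 + k) e^(L n0) each and the vertical side
    with 4 \<pi> B, divided by the factor 2 \<pi> of the residue theorem.\<close>
  define C where "C = 2 * (2 * (1 + k) * exp (L * real n0) + 1)"
  have "C > 0" using kL by (simp add: C_def add_pos_pos)
  moreover have "\<exists>M0. \<forall>M\<ge>M0. \<forall>B. \<forall>\<Psi>\<in>exp_type R k L \<delta> B.
     norm (\<Sum>n=n0..M. (-1) ^ n * (\<Psi> (of_nat n) * of_real (damping \<epsilon> n))) \<le> C * B"
    if \<epsilon>: "0 < \<epsilon>" "\<epsilon> \<le> \<delta> / pi" for \<epsilon>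
  proof -
    \<comment> \<open>From here on \<epsilon> ln (M + 1/2) \<ge> L + 1 + 2 k, so on the vertical
      side the damping beats the growth e^(L Re z) with a reserve for the length of that
      side.\<close>
    define M0 where "M0 = max n0 (nat \<lceil>exp ((L + 1 + 2 * k) / \<epsilon>)\<rceil>)"
    show ?thesis
    proof (intro exI[of _ M0] allI impI ballI)
      fix M B \<Psi>
      assume M: "M0 \<le> M" and "\<Psi> \<in> exp_type R k L \<delta> B"
      then have \<Psi>: "\<Psi> holomorphic_on sector R k"
        and bd: "\<forall>s\<in>sector R k. norm (\<Psi> s) \<le> B * exp (L * Re s + (pi - \<delta>) * \<bar>Im s\<bar>)"
        by (auto simp: exp_type_def)
      interpret nodal_triangle n0 M k
        by unfold_locales (use M n0R R kL in \<open>auto simp: M0_def\<close>)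
      define X where "X = real M + 1 / 2"
      have X: "X \<ge> 1" "exp ((L + 1 + 2 * k) / \<epsilon>) \<le> X" using M n0R R n0(1)
        unfolding M0_def X_def by linarith+
      define S where "S = {z. real n0 - 1 < Re z \<and> Re z < real M + 1 \<and> \<bar>Im z\<bar> < k * Re z}"
      have S_eq: "S = {z. real n0 - 1 < Re z} \<inter> {z. Re z < real M + 1} \<inter> {z. Im z < k * Re z} \<inter> {z. - (k * Re z) < Im z}"
        by (auto simp: S_def abs_less_iff)
      have opS: "open S" unfolding S_eq by (intro open_Int open_Collect_less continuous_intros)
      have "convex {z. Im z < k * Re z}" "convex {z. - (k * Re z) < Im z}"
        using convex_halfspace_lt[of "Complex (- k) 1" 0] convex_halfspace_lt[of "Complex (- k) (-1)" 0]
        by (simp_all add: inner_complex_def)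
      then have cvS: "convex S" unfolding S_eq
        by (intro convex_Int convex_halfspace_Re_gt convex_halfspace_Re_lt)
      have Ssec: "S \<subseteq> sector R k" using n0R by (auto simp: S_def sector_def)
      have S1: "Re z \<ge> 1" if "z \<in> S" for z using that n0R R by (auto simp: S_def)
      have triS: "path_image tri \<subseteq> S"
      proof
        fix z assume "z \<in> path_image tri"
        from tri_Re[OF this] have z: "real n0 - 1 / 2 \<le> Re z" "Re z \<le> real M + 1 / 2" "\<bar>Im z\<bar> \<le> k * (Re z - (real n0 - 1 / 2))"
          by auto
        have "k * (Re z - (real n0 - 1 / 2)) < k * Re z" using k n0R R by (intro mult_strict_left_mono) auto
        then show "z \<in> S" using z by (auto simp: S_def)
      qed
      define \<Phi> where "\<Phi> s = \<Psi> s * exp (- (complex_of_real \<epsilon> * s * Ln s))" for s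
      have \<Phi>: "\<Phi> holomorphic_on S" unfolding \<Phi>_def
      proof -
        have "Re z > 0" if "z \<in> S" for z using S1[OF that] by linarith
        then have "z \<notin> \<real>\<^sub>\<le>\<^sub>0" if "z \<in> S" for z using that by (fastforce simp: complex_nonpos_Reals_iff)
        then show "(\<lambda>s. \<Psi> s * exp (- (complex_of_real \<epsilon> * s * Ln s))) holomorphic_on S"
          by (intro holomorphic_intros holomorphic_on_subset[OF \<Psi> Ssec]) auto
      qed
      define f where "f s = \<Phi> s * (pi / sin (pi * s))" for s :: complex
      have nodes: "of_nat n \<in> S" if "n \<in> {n0..M}" for n
        using that n0R R k by (auto simp: S_def)
      have int: "contour_integral tri f = 2 * pi * \<i> * (\<Sum>n=n0..M. (-1) ^ n * \<Phi> (of_nat n))"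
        unfolding f_def by (rule alternating_sum_integral[OF opS cvS triS \<Phi> _ nodes]) (auto simp: S_def)
      have "complex_of_nat n0 \<in> sector R k" using nodes[of n0] Ssec n0(1) by auto
      then have "0 \<le> B * exp (L * Re (of_nat n0) + (pi - \<delta>) * \<bar>Im (of_nat n0)\<bar>)"
        using bd order_trans[OF norm_ge_zero] by blast
      then have B: "B \<ge> 0" by (simp add: zero_le_mult_iff)
      \<comment> \<open>Balance of the coefficients of |Im z|: \<pi> - \<delta> from \<Psi>, at most
        \<delta>/2 from the damping since \<epsilon> \<le> \<delta>/\<pi>, and - \<pi> from the
        sine; - \<delta>/2 remains.\<close>
      have fb: "norm (f z) \<le> 4 * pi * B * exp (L * Re z - \<epsilon> * Re z * ln (Re z) - \<delta> / 2 * \<bar>Im z\<bar>)"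
        if z: "z \<in> path_image tri" for z :: complex
      proof -
        have zS: "z \<in> S" using z triS by blast
        have e2: "\<epsilon> * (pi / 2) * \<bar>Im z\<bar> \<le> \<delta> / 2 * \<bar>Im z\<bar>"
          using \<epsilon> by (intro mult_right_mono) (auto simp: field_simps)
        have 1: "norm (\<Psi> z) \<le> B * exp (L * Re z + (pi - \<delta>) * \<bar>Im z\<bar>)" using bd zS Ssec by blast
        have 2: "norm (exp (- (complex_of_real \<epsilon> * z * Ln z))) \<le> exp (- (\<epsilon> * Re z * ln (Re z)) + \<delta> / 2 * \<bar>Im z\<bar>)"
          using norm_damping[OF S1[OF zS] \<epsilon>(1)] e2 by (smt (verit) exp_le_cancel_iff)
        have 3: "norm (pi / sin (pi * z)) \<le> pi / (exp (pi * \<bar>Im z\<bar>) / 4)"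
          unfolding norm_divide using sin_lower_bound[OF z] by (intro frac_le) auto
        have "norm (f z) = norm (\<Psi> z) * norm (exp (- (complex_of_real \<epsilon> * z * Ln z))) * norm (pi / sin (pi * z))"
          unfolding f_def \<Phi>_def norm_mult ..
        also have "\<dots> \<le> (B * exp (L * Re z + (pi - \<delta>) * \<bar>Im z\<bar>)) * exp (- (\<epsilon> * Re z * ln (Re z)) + \<delta> / 2 * \<bar>Im z\<bar>) * (pi / (exp (pi * \<bar>Im z\<bar>) / 4))"
          using B by (intro mult_mono 1 2 3) auto
        also have "\<dots> = 4 * pi * B * (exp (L * Re z + (pi - \<delta>) * \<bar>Im z\<bar>) * exp (- (\<epsilon> * Re z * ln (Re z)) + \<delta> / 2 * \<bar>Im z\<bar>) * exp (- (pi * \<bar>Im z\<bar>)))"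
          by (simp add: exp_minus field_simps)
        also have "exp (L * Re z + (pi - \<delta>) * \<bar>Im z\<bar>) * exp (- (\<epsilon> * Re z * ln (Re z)) + \<delta> / 2 * \<bar>Im z\<bar>) * exp (- (pi * \<bar>Im z\<bar>))
           = exp (L * Re z - \<epsilon> * Re z * ln (Re z) - \<delta> / 2 * \<bar>Im z\<bar>)"
          unfolding exp_add[symmetric] by (simp add: algebra_simps)
        finally show ?thesis .
      qed
      have fcont: "continuous_on (path_image tri) f"
      proof -
        have "sin (complex_of_real pi * z) \<noteq> 0" if "z \<in> path_image tri" for z
          using sin_lower_bound[OF that] exp_gt_zero[of "pi * \<bar>Im z\<bar>"] by (auto simp del: exp_gt_zero)
        then show ?thesis unfolding f_def
          by (intro continuous_intros continuous_on_subset[OF holomorphic_on_imp_continuous_on[OF \<Phi>] triS]) auto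
      qed
      have fcont': "continuous_on (closed_segment A Bl) f" "continuous_on (closed_segment Bl Bu) f" "continuous_on (closed_segment Bu A) f"
        by (auto intro: continuous_on_subset[OF fcont] simp: path_image_tri)
      define K where "K = 4 * pi * B * exp (L * real n0)"
      have K: "K \<ge> 0" using B by (simp add: K_def)
      have slant: "norm (f z) \<le> K * exp (- (t * h))"
        if z: "z \<in> path_image tri" "Re z = real n0 - 1 / 2 + t * h" "\<bar>Im z\<bar> = k * (t * h)" "t \<ge> 0" for z t
      proof -
        have th: "t * h \<ge> 0" using that h by simp
        have "\<epsilon> * Re z * ln (Re z) \<ge> 0" using S1[of z] z triS \<epsilon> by force
        moreover have "L * Re z \<le> L * (real n0 + t * h)" using z L by (intro mult_left_mono) auto
        moreover have "\<delta> / 2 * \<bar>Im z\<bar> \<ge> (L + 1) * (t * h)"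
          unfolding z using mult_right_mono[OF kL(2) th] by (simp add: mult_ac)
        ultimately have "L * Re z - \<epsilon> * Re z * ln (Re z) - \<delta> / 2 * \<bar>Im z\<bar> \<le> L * real n0 + - (t * h)"
          by (simp add: algebra_simps)
        then have "exp (L * Re z - \<epsilon> * Re z * ln (Re z) - \<delta> / 2 * \<bar>Im z\<bar>) \<le> exp (L * real n0) * exp (- (t * h))"
          unfolding exp_add[symmetric] by simp
        then have "4 * pi * B * exp (L * Re z - \<epsilon> * Re z * ln (Re z) - \<delta> / 2 * \<bar>Im z\<bar>) \<le> 4 * pi * B * (exp (L * real n0) * exp (- (t * h)))"
          using B by (intro mult_left_mono) auto
        then show ?thesis using fb[OF z(1)] by (simp add: K_def mult_ac)
      qed
      have len: "norm (Bl - A) \<le> (1 + k) * h" "norm (Bu - A) \<le> (1 + k) * h"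
        using cmod_le[of "Bl - A"] cmod_le[of "Bu - A"] h k by (auto simp: algebra_simps abs_mult)
      have I1: "norm (contour_integral (linepath A Bl) f) \<le> K * (1 + k)"
      proof (rule integral_along_slant[OF fcont'(1) len(1)])
        fix t :: real assume t: "0 \<le> t" "t \<le> 1"
        have "linepath A Bl t \<in> path_image tri" using t by (auto simp: path_image_tri linepath_in_path)
        then show "norm (f (linepath A Bl t)) \<le> K * exp (- (t * h))"
          using t h k by (intro slant) (auto simp: linepath_def algebra_simps abs_mult)
      qed
      have I3: "norm (contour_integral (linepath Bu A) f) \<le> K * (1 + k)"
      proof -
        \<comment> \<open>The side is traversed backwards so that the parameter again starts at the
          apex.\<close>
        have "norm (contour_integral (linepath A Bu) f) \<le> K * (1 + k)"
        proof (rule integral_along_slant[OF _ len(2)])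
          show "continuous_on (closed_segment A Bu) f" using fcont'(3) by (simp add: closed_segment_commute)
          fix t :: real assume t: "0 \<le> t" "t \<le> 1"
          have "linepath A Bu t \<in> path_image tri" using t by (auto simp: path_image_tri linepath_in_path closed_segment_commute[of Bu])
          then show "norm (f (linepath A Bu t)) \<le> K * exp (- (t * h))"
            using t h k by (intro slant) (auto simp: linepath_def algebra_simps abs_mult)
        qed
        then show ?thesis using contour_integral_reverse_linepath[OF fcont'(3)] by simp
      qed
      have I2: "norm (contour_integral (linepath Bl Bu) f) \<le> 4 * pi * B"
      proof -
        have "norm (contour_integral (linepath Bl Bu) f) \<le> (4 * pi * B * exp (- ((1 + 2 * k) * X))) * norm (Bu - Bl)"
        proof (rule contour_integral_bound_linepath)
          show "f contour_integrable_on linepath Bl Bu" by (rule contour_integrable_continuous_linepath[OF fcont'(2)])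
          fix z assume z: "z \<in> closed_segment Bl Bu"
          then have zt: "z \<in> path_image tri" by (auto simp: path_image_tri)
          have Rz: "Re z = X" using edge_cases[OF z] by (simp add: X_def)
          have "(L + 1 + 2 * k) / \<epsilon> \<le> ln X" using X ln_ge_iff[of X] by auto
          then have "L + 1 + 2 * k \<le> \<epsilon> * ln X" using \<epsilon> by (simp add: field_simps)
          then have "(L + 1 + 2 * k) * X \<le> \<epsilon> * ln X * X" using X by (intro mult_right_mono) auto
          moreover have "\<delta> / 2 * \<bar>Im z\<bar> \<ge> 0" using \<delta> by simp
          ultimately have "L * Re z - \<epsilon> * Re z * ln (Re z) - \<delta> / 2 * \<bar>Im z\<bar> \<le> - ((1 + 2 * k) * X)"
            unfolding Rz by (simp add: algebra_simps)
          then have "4 * pi * B * exp (L * Re z - \<epsilon> * Re z * ln (Re z) - \<delta> / 2 * \<bar>Im z\<bar>) \<le> 4 * pi * B * exp (- ((1 + 2 * k) * X))"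
            using B by (intro mult_left_mono) auto
          then show "norm (f z) \<le> 4 * pi * B * exp (- ((1 + 2 * k) * X))" using fb[OF zt] by linarith
        qed (use B in auto)
        also have "norm (Bu - Bl) \<le> (1 + 2 * k) * X"
        proof -
          have "norm (Bu - Bl) \<le> 2 * k * h" using cmod_le[of "Bu - Bl"] h k by (simp add: abs_mult)
          also have "\<dots> \<le> 2 * k * X" using k n0R R by (intro mult_left_mono) (auto simp: h_def X_def)
          finally show ?thesis using X by (simp add: algebra_simps)
        qed
        \<comment> \<open>The length of the side is absorbed by v e^(-v) \<le> 1.\<close>
        also have "4 * pi * B * exp (- ((1 + 2 * k) * X)) * ((1 + 2 * k) * X) \<le> 4 * pi * B * 1"
        proof -
          have "(1 + 2 * k) * X \<le> exp ((1 + 2 * k) * X)" using exp_ge_add_one_self[of "(1 + 2 * k) * X"] by linarith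
          moreover have "v \<le> exp v \<Longrightarrow> exp (- v) * v \<le> 1" for v :: real by (simp add: exp_minus field_simps)
          ultimately have "exp (- ((1 + 2 * k) * X)) * ((1 + 2 * k) * X) \<le> 1" by blast
          then have "4 * pi * B * (exp (- ((1 + 2 * k) * X)) * ((1 + 2 * k) * X)) \<le> 4 * pi * B * 1"
            using B by (intro mult_left_mono) auto
          then show ?thesis by (simp only: mult.assoc)
        qed
        finally show ?thesis using B by (simp add: mult_left_mono)
      qed
      have "contour_integral tri f = contour_integral (linepath A Bl) f + (contour_integral (linepath Bl Bu) f + contour_integral (linepath Bu A) f)"
        unfolding tri_def using fcont' by (simp add: contour_integrable_continuous_linepath contour_integrable_join)
      then have "norm (contour_integral tri f) \<le> K * (1 + k) + (4 * pi * B + K * (1 + k))"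
        using I1 I2 I3 by (metis add_mono norm_triangle_le norm_triangle_mono)
      also have "\<dots> = 2 * pi * (C * B)" by (simp add: K_def C_def algebra_simps)
      finally have "2 * pi * norm (\<Sum>n=n0..M. (-1) ^ n * \<Phi> (of_nat n)) \<le> 2 * pi * (C * B)"
        unfolding int by (simp add: norm_mult)
      then have "norm (\<Sum>n=n0..M. (-1) ^ n * \<Phi> (of_nat n)) \<le> C * B" by simp
      moreover have \<Phi>n: "\<Phi> (of_nat n) = \<Psi> (of_nat n) * of_real (damping \<epsilon> n)" if "n \<in> {n0..M}" for n
      proof -
        have "n > 0" using that n0R R by auto
        then have "Ln (complex_of_nat n) = of_real (ln (real n))" by (metis Ln_of_real of_nat_0_less_iff of_real_of_nat_eq)
        then show ?thesis by (simp add: \<Phi>_def damping_def exp_of_real[symmetric])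
      qed
      ultimately show "norm (\<Sum>n=n0..M. (-1) ^ n * (\<Psi> (of_nat n) * of_real (damping \<epsilon> n))) \<le> C * B"
        by (subst sum.cong[OF refl, of _ _ "\<lambda>n. (-1) ^ n * \<Phi> (of_nat n)"]) (simp_all add: \<Phi>n)
    qed
  qed
  ultimately show ?thesis by blast
qed

subsection \<open>Square integrable functions\<close>

lemma L2_iff:
  assumes S: "S \<in> sets borel"
  shows "f \<in> L2 S \<longleftrightarrow> set_borel_measurable lborel S f \<and> set_integrable lborel S (\<lambda>p. (norm (f p))\<^sup>2)"
  unfolding L2_def set_borel_measurable_def
  by (subst borel_measurable_restrict_space_iff) (use S in auto)

lemma continuous_set_integrable:
  fixes f :: "'a::euclidean_space \<Rightarrow> 'b::{banach, second_countable_topology}"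
  assumes f: "continuous_on UNIV f" and S: "S \<in> sets borel" "bounded S"
  shows "set_integrable lborel S f"
proof -
  have "set_integrable lborel (closure S) f"
    unfolding set_integrable_def using S
    by (intro borel_integrable_compact continuous_on_subset[OF f]) (auto simp: compact_closure)
  then show ?thesis by (rule set_integrable_subset) (use S closure_subset in auto)
qed

lemma continuous_L2:
  assumes f: "continuous_on UNIV f" and S: "S \<in> sets borel" "bounded S"
  shows "f \<in> L2 S"
  unfolding L2_iff[OF S(1)]
proof
  show "set_integrable lborel S (\<lambda>p. (norm (f p))\<^sup>2)"
    by (rule continuous_set_integrable[OF _ S]) (intro continuous_intros f)
  have "f \<in> borel_measurable borel" using f by (rule borel_measurable_continuous_onI)
  then show "set_borel_measurable lborel S f" unfolding set_borel_measurable_def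
    using S(1) by measurable
qed

lemma L2_mult_measurable:
  assumes S: "S \<in> sets borel" and f: "f \<in> L2 S" and g: "g \<in> L2 S"
  shows "set_borel_measurable lborel S (\<lambda>p. f p * cnj (g p))"
proof -
  have [measurable]: "(\<lambda>p. indicator S p *\<^sub>R f p) \<in> borel_measurable lborel" "(\<lambda>p. indicator S p *\<^sub>R g p) \<in> borel_measurable lborel"
    using f g unfolding L2_iff[OF S] set_borel_measurable_def by auto
  have "(\<lambda>p. (indicator S p *\<^sub>R f p) * cnj (indicator S p *\<^sub>R g p)) \<in> borel_measurable lborel"
    by (intro borel_measurable_times measurable_compose[OF _ borel_measurable_continuous_onI[of cnj]])
       (auto intro!: continuous_intros)
  also have "(\<lambda>p. (indicator S p *\<^sub>R f p) * cnj (indicator S p *\<^sub>R g p)) = (\<lambda>p. indicator S p *\<^sub>R (f p * cnj (g p)))"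
    by (auto simp: indicator_def)
  finally show ?thesis unfolding set_borel_measurable_def .
qed

lemma young_complex: "t > 0 \<Longrightarrow> norm (x * cnj y) \<le> (t * (norm x)\<^sup>2 + (norm y)\<^sup>2 / t) / 2"
proof -
  assume t: "t > 0"
  have "0 \<le> (t * norm x - norm y)\<^sup>2 / t" using t by simp
  also have "\<dots> = t * (norm x)\<^sup>2 + (norm y)\<^sup>2 / t - 2 * (norm x * norm y)"
    using t by (simp add: power2_eq_square field_simps)
  finally show ?thesis by (simp add: norm_mult)
qed

lemma L2_mult_integrable:
  assumes S: "S \<in> sets borel" and f: "f \<in> L2 S" and g: "g \<in> L2 S"
  shows "set_integrable lborel S (\<lambda>p. f p * cnj (g p))"
proof (rule set_integrable_bound[OF _ L2_mult_measurable[OF assms]])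
  show "set_integrable lborel S (\<lambda>p. (1 * (norm (f p))\<^sup>2 + (norm (g p))\<^sup>2 / 1) / 2)"
    using f g unfolding L2_iff[OF S] by (intro set_integrable_divide set_integral_add) auto
  show "AE p in lborel. p \<in> S \<longrightarrow> norm (f p * cnj (g p)) \<le> norm ((1 * (norm (f p))\<^sup>2 + (norm (g p))\<^sup>2 / 1) / 2)"
    using young_complex[of 1] by (intro AE_I2 impI order_trans[OF _ abs_ge_self[unfolded real_norm_def[symmetric]]]) auto
qed

text \<open>Young's inequality with a free weight t takes the place of Cauchy-Schwarz: letting t
  depend on the tolerance still gives continuity of the inner product.\<close>

lemma L2_inner_young:
  assumes S: "S \<in> sets borel" and f: "f \<in> L2 S" and g: "g \<in> L2 S" and t: "t > 0"
  shows "norm (L2_inner S f g) \<le> (t * L2_normsq S f + L2_normsq S g / t) / 2"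
proof -
  have fi: "set_integrable lborel S (\<lambda>p. (norm (f p))\<^sup>2)" and gi: "set_integrable lborel S (\<lambda>p. (norm (g p))\<^sup>2)"
    using f g unfolding L2_iff[OF S] by auto
  have "norm (L2_inner S f g) \<le> (LINT p:S|lborel. norm (f p * cnj (g p)))"
    unfolding L2_inner_def by (rule set_integral_norm_bound[OF L2_mult_integrable[OF S f g]])
  also have "\<dots> \<le> (LINT p:S|lborel. (t * (norm (f p))\<^sup>2 + (norm (g p))\<^sup>2 / t) / 2)"
    using fi gi young_complex[OF t] L2_mult_integrable[OF S f g]
    by (intro set_integral_mono set_integrable_divide set_integral_add set_integrable_mult_right set_integrable_norm) auto
  also have "\<dots> = (t * L2_normsq S f + L2_normsq S g / t) / 2"
    unfolding L2_normsq_def using fi gi by (simp add: set_integral_add)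
  finally show ?thesis .
qed

lemma L2_diff:
  assumes S: "S \<in> sets borel" and f: "f \<in> L2 S" and g: "g \<in> L2 S"
  shows "(\<lambda>p. f p - g p) \<in> L2 S"
  unfolding L2_iff[OF S]
proof
  have [measurable]: "(\<lambda>p. indicator S p *\<^sub>R f p) \<in> borel_measurable lborel" "(\<lambda>p. indicator S p *\<^sub>R g p) \<in> borel_measurable lborel"
    using f g unfolding L2_iff[OF S] set_borel_measurable_def by auto
  have "(\<lambda>p. indicator S p *\<^sub>R f p - indicator S p *\<^sub>R g p) \<in> borel_measurable lborel" by measurable
  then show m: "set_borel_measurable lborel S (\<lambda>p. f p - g p)"
    unfolding set_borel_measurable_def by (simp add: scaleR_diff_right)
  show "set_integrable lborel S (\<lambda>p. (norm (f p - g p))\<^sup>2)"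
  proof (rule set_integrable_bound)
    show "set_integrable lborel S (\<lambda>p. 2 * (norm (f p))\<^sup>2 + 2 * (norm (g p))\<^sup>2)"
      using f g unfolding L2_iff[OF S] by (intro set_integral_add set_integrable_mult_right) auto
    have "(\<lambda>p. (norm (indicator S p *\<^sub>R (f p - g p)))\<^sup>2) \<in> borel_measurable lborel"
      using m unfolding set_borel_measurable_def by measurable
    also have "(\<lambda>p. (norm (indicator S p *\<^sub>R (f p - g p)))\<^sup>2) = (\<lambda>p. indicator S p *\<^sub>R (norm (f p - g p))\<^sup>2)"
      by (auto simp: indicator_def)
    finally show "set_borel_measurable lborel S (\<lambda>p. (norm (f p - g p))\<^sup>2)" unfolding set_borel_measurable_def .
    have "(norm (x - y))\<^sup>2 \<le> 2 * (norm x)\<^sup>2 + 2 * (norm y)\<^sup>2" for x y :: complex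
    proof -
      have "(norm (x - y))\<^sup>2 \<le> (norm x + norm y)\<^sup>2" by (intro power_mono norm_triangle_ineq4) auto
      also have "\<dots> \<le> 2 * (norm x)\<^sup>2 + 2 * (norm y)\<^sup>2"
        using zero_le_power2[of "norm x - norm y"] by (simp add: power2_eq_square algebra_simps)
      finally show ?thesis .
    qed
    then show "AE p in lborel. p \<in> S \<longrightarrow> norm ((norm (f p - g p))\<^sup>2) \<le> norm (2 * (norm (f p))\<^sup>2 + 2 * (norm (g p))\<^sup>2)"
      by (intro AE_I2 impI) (auto intro!: order_trans[OF _ abs_ge_self])
  qed
qed

lemma L2_inner_diff_left:
  assumes S: "S \<in> sets borel" and f: "f \<in> L2 S" "f' \<in> L2 S" and g: "g \<in> L2 S"
  shows "L2_inner S (\<lambda>p. f p - f' p) g = L2_inner S f g - L2_inner S f' g"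
  unfolding L2_inner_def left_diff_distrib
  by (rule set_integral_diff(2)[OF L2_mult_integrable[OF S f(1) g] L2_mult_integrable[OF S f(2) g]])

lemma L2_inner_tendsto:
  assumes S: "S \<in> sets borel" and F: "\<forall>\<^sub>F i in \<F>. F i \<in> L2 S" and f: "f \<in> L2 S" and g: "g \<in> L2 S"
    and lim: "L2_tendsto S F f \<F>"
  shows "((\<lambda>i. L2_inner S (F i) g) \<longlongrightarrow> L2_inner S f g) \<F>"
proof (rule tendstoI)
  fix e :: real assume e: "e > 0"
  define b where "b = L2_normsq S g"
  have b: "b \<ge> 0" unfolding b_def L2_normsq_def set_lebesgue_integral_def by (intro integral_nonneg_AE) auto
  \<comment> \<open>Large enough for b / t < e; the summand 1 covers b = 0.\<close>
  define t where "t = (b + 1) / e"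
  have t: "t > 0" using b e by (simp add: t_def)
  have bt: "b / t < e" using b e by (simp add: t_def field_simps)
  have "\<forall>\<^sub>F i in \<F>. L2_normsq S (\<lambda>p. F i p - f p) < e / t"
    using lim t e unfolding L2_tendsto_def by (intro order_tendstoD) auto
  with F show "\<forall>\<^sub>F i in \<F>. dist (L2_inner S (F i) g) (L2_inner S f g) < e"
  proof eventually_elim
    case (elim i)
    have "dist (L2_inner S (F i) g) (L2_inner S f g) = norm (L2_inner S (\<lambda>p. F i p - f p) g)"
      by (simp add: dist_norm L2_inner_diff_left[OF S elim(1) f g])
    also have "\<dots> \<le> (t * L2_normsq S (\<lambda>p. F i p - f p) + b / t) / 2"
      unfolding b_def by (rule L2_inner_young[OF S L2_diff[OF S elim(1) f] g t])
    also have "t * L2_normsq S (\<lambda>p. F i p - f p) < e" using elim(2) t by (simp add: field_simps)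
    then have "(t * L2_normsq S (\<lambda>p. F i p - f p) + b / t) / 2 < e" using bt by simp
    finally show ?case .
  qed
qed

text \<open>Dominated convergence: a bounded set has finite measure, so a constant serves as the
  dominating function.\<close>

lemma L2_tendsto_bounded:
  assumes S: "S \<in> sets borel" "bounded S" and F: "\<And>i::nat. F i \<in> L2 S" and f: "f \<in> L2 S"
    and K: "\<And>i p. p \<in> S \<Longrightarrow> norm (F i p - f p) \<le> K"
    and lim: "\<And>p. p \<in> S \<Longrightarrow> (\<lambda>i. F i p) \<longlonglongrightarrow> f p"
  shows "L2_tendsto S F f sequentially"
  unfolding L2_tendsto_def L2_normsq_def set_lebesgue_integral_def
proof -
  have "(\<lambda>i. LINT p|lborel. indicat_real S p *\<^sub>R (norm (F i p - f p))\<^sup>2) \<longlonglongrightarrow> (LINT p|lborel. indicat_real S p *\<^sub>R 0)"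
  proof (rule integral_dominated_convergence)
    show "integrable lborel (\<lambda>p. indicat_real S p *\<^sub>R K\<^sup>2)"
      using continuous_set_integrable[of "\<lambda>_. K\<^sup>2", OF _ S] by (simp add: set_integrable_def)
    have "set_integrable lborel S (\<lambda>p. (norm (F i p - f p))\<^sup>2)" for i
      using L2_diff[OF S(1) F f] unfolding L2_iff[OF S(1)] by auto
    then show "(\<lambda>p. indicat_real S p *\<^sub>R (norm (F i p - f p))\<^sup>2) \<in> borel_measurable lborel" for i
      unfolding set_integrable_def by auto
    show "AE p in lborel. (\<lambda>i. indicat_real S p *\<^sub>R (norm (F i p - f p))\<^sup>2) \<longlonglongrightarrow> indicat_real S p *\<^sub>R 0"
    proof (rule AE_I2)
      fix p show "(\<lambda>i. indicat_real S p *\<^sub>R (norm (F i p - f p))\<^sup>2) \<longlonglongrightarrow> indicat_real S p *\<^sub>R 0"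
      proof (cases "p \<in> S")
        case True
        have "(\<lambda>i. (norm (F i p - f p))\<^sup>2) \<longlonglongrightarrow> (norm (f p - f p))\<^sup>2"
          by (intro tendsto_intros lim True)
        then show ?thesis using True by simp
      qed simp
    qed
    show "AE p in lborel. norm (indicat_real S p *\<^sub>R (norm (F i p - f p))\<^sup>2) \<le> indicat_real S p *\<^sub>R K\<^sup>2" for i
      using K by (intro AE_I2) (auto simp: indicator_def intro!: power_mono)
  qed simp
  then show "(\<lambda>i. LINT p|lborel. indicat_real S p *\<^sub>R (norm (F i p - f p))\<^sup>2) \<longlonglongrightarrow> 0" by simp
qed

lemma
  fixes f :: "'a::euclidean_space \<times> 'b::euclidean_space \<Rightarrow> 'c::{banach, second_countable_topology}"
  assumes f: "set_integrable lborel (A \<times> B) f"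
  shows set_integral_Times: "(LINT p:A \<times> B|lborel. f p) = (LINT x:A|lborel. LINT y:B|lborel. f (x, y))"
    and set_integral_Times': "(LINT p:A \<times> B|lborel. f p) = (LINT y:B|lborel. LINT x:A|lborel. f (x, y))"
    and set_integrable_slice_integral: "set_integrable lborel A (\<lambda>x. LINT y:B|lborel. f (x, y))"
    and AE_set_integrable_slice: "AE x in lborel. x \<in> A \<longrightarrow> set_integrable lborel B (\<lambda>y. f (x, y))"
proof -
  define g where "g x y = indicat_real A x *\<^sub>R indicat_real B y *\<^sub>R f (x, y)" for x y
  have g: "case_prod g = (\<lambda>p. indicat_real (A \<times> B) p *\<^sub>R f p)"
    by (auto simp: g_def indicator_def fun_eq_iff)
  have int: "integrable (lborel \<Otimes>\<^sub>M lborel) (case_prod g)"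
    using f unfolding g set_integrable_def lborel_prod .
  have 1: "(LINT y|lborel. g x y) = indicat_real A x *\<^sub>R (LINT y:B|lborel. f (x, y))" for x
    unfolding g_def set_lebesgue_integral_def by (simp del: scaleR_scaleR)
  have 2: "(LINT x|lborel. g x y) = indicat_real B y *\<^sub>R (LINT x:A|lborel. f (x, y))" for y
    unfolding g_def set_lebesgue_integral_def by (subst scaleR_left_commute) (simp del: scaleR_scaleR)
  have eq: "(LINT p:A \<times> B|lborel. f p) = integral\<^sup>L (lborel \<Otimes>\<^sub>M lborel) (case_prod g)"
    unfolding g set_lebesgue_integral_def lborel_prod ..
  show "(LINT p:A \<times> B|lborel. f p) = (LINT x:A|lborel. LINT y:B|lborel. f (x, y))"
    unfolding eq lborel_pair.integral_fst'[OF int, symmetric] case_prod_conv 1 by (simp add: set_lebesgue_integral_def)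
  show "(LINT p:A \<times> B|lborel. f p) = (LINT y:B|lborel. LINT x:A|lborel. f (x, y))"
    unfolding eq lborel_pair.integral_snd[OF int, symmetric] 2 by (simp add: set_lebesgue_integral_def)
  show "set_integrable lborel A (\<lambda>x. LINT y:B|lborel. f (x, y))"
    using lborel_pair.integrable_fst'[OF int] unfolding case_prod_conv 1 set_integrable_def .
  show "AE x in lborel. x \<in> A \<longrightarrow> set_integrable lborel B (\<lambda>y. f (x, y))"
    using lborel_pair.AE_integrable_fst'[OF int] by eventually_elim (auto simp: g_def set_integrable_def)
qed

text \<open>The endpoints are left open in the statement because it is applied to (-1, 1), to [0, 2
  \<pi>) and to closed time intervals; two points do not affect the integral.\<close>

lemma set_integral_FTC:
  fixes F f :: "real \<Rightarrow> complex"
  assumes F: "\<And>x. (F has_vector_derivative f x) (at x)" and f: "continuous_on UNIV f"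
    and ab: "a \<le> b" and S: "S \<in> sets borel" "{a<..<b} \<subseteq> S" "S \<subseteq> {a..b}"
  shows "(LINT x:S|lborel. f x) = F b - F a"
proof -
  have "bounded S" by (rule bounded_subset[OF _ S(3)]) simp
  then have "set_integrable lborel S f" by (rule continuous_set_integrable[OF f S(1)])
  then have "(LINT x:S|lborel. f x) = integral S f" by (rule set_borel_integral_eq_integral)
  moreover have "(f has_integral F b - F a) {a..b}"
    by (rule fundamental_theorem_of_calculus[OF ab]) (rule has_vector_derivative_at_within[OF F])
  moreover have "(f has_integral F b - F a) S \<longleftrightarrow> (f has_integral F b - F a) {a..b}"
  proof (rule has_integral_spike_set_eq)
    have "negligible {a, b}" by simp
    then show "negligible {x \<in> {a..b} - S. f x \<noteq> 0}" "negligible {x \<in> S - {a..b}. f x \<noteq> 0}"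
      by (rule negligible_subset, use S in force)+
  qed
  ultimately show ?thesis by (simp add: integral_unique)
qed

lemma Omega_borel [measurable]: "Omega \<in> sets borel"
  unfolding Omega_def by (intro borel_Times) auto

lemma Omega_bounded: "bounded Omega"
  unfolding Omega_def by (intro bounded_Times) auto

subsection \<open>Fourier modes in the form domain\<close>

definition osc :: "nat \<Rightarrow> real \<Rightarrow> complex" where
  "osc n y = exp (\<i> * of_nat n * of_real y)"

text \<open>The inner product conjugates its second argument. Conjugating \<open>g\<close> here
  makes testing against a mode produce \<open>g\<close> itself, which for the ground states is
  holomorphic in the frequency.\<close>

definition mode :: "nat \<Rightarrow> (real \<Rightarrow> complex) \<Rightarrow> real \<times> real \<Rightarrow> complex" where
  "mode n g p = cnj (g (fst p)) * osc n (snd p)"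

lemma osc_deriv: "(osc n has_vector_derivative \<i> * of_nat n * osc n y) (at y)"
proof -
  have "((\<lambda>z. exp (\<i> * of_nat n * z)) has_field_derivative \<i> * of_nat n * exp (\<i> * of_nat n * of_real y)) (at (of_real y))"
    by (auto intro!: derivative_eq_intros)
  from vector_derivative_of_real[OF this] show ?thesis unfolding osc_def [abs_def] .
qed

lemma norm_osc [simp]: "norm (osc n y) = 1"
  by (simp add: osc_def norm_exp_eq_Re)

lemma osc_periodic: "osc n (y + 2 * pi) = osc n y"
proof -
  have "osc n (y + 2 * pi) = osc n y * exp (2 * of_int (int n) * of_real pi * \<i>)"
    unfolding osc_def exp_add[symmetric] by (simp add: algebra_simps)
  also have "exp (2 * of_int (int n) * of_real pi * \<i>) = (1 :: complex)"
    unfolding exp_eq_1 by (auto intro!: exI[of _ "int n"])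
  finally show ?thesis by simp
qed

lemma cnj_osc: "cnj (osc n y) = exp (- (\<i> * of_nat n * of_real y))"
  by (simp add: osc_def exp_cnj)

lemma norm_mode: "norm (mode n g p) = norm (g (fst p))"
  by (simp add: mode_def norm_mult)

lemma continuous_osc: "continuous_on S (osc n)"
  by (rule continuous_on_vector_derivative_at) (rule osc_deriv)

lemma continuous_mode:
  assumes "continuous_on UNIV g"
  shows "continuous_on UNIV (mode n g)"
  unfolding mode_def
  by (intro continuous_intros continuous_on_compose2[OF assms] continuous_on_compose2[OF continuous_osc[of UNIV]]) auto

lemma mode_C1_compact_support:
  assumes g: "\<And>x. (g has_vector_derivative g' x) (at x)" and g': "continuous_on UNIV g'"
    and supp: "r < 1" "\<And>x. \<bar>x\<bar> > r \<Longrightarrow> g x = 0"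
  shows "C1_compact_support (mode n g) (mode n g') (\<lambda>p. \<i> * of_nat n * mode n g p)"
  unfolding C1_compact_support_def
proof (intro conjI allI)
  fix p :: "real \<times> real"
  have "((\<lambda>x. cnj (g x)) has_derivative (\<lambda>v. v *\<^sub>R cnj (g' (fst p)))) (at (fst p))"
    using bounded_linear.has_vector_derivative[OF bounded_linear_cnj g[of "fst p"]]
    unfolding has_vector_derivative_def .
  from has_derivative_compose[OF has_derivative_fst[OF has_derivative_ident] this]
  have 1: "((\<lambda>q. cnj (g (fst q))) has_derivative (\<lambda>d. fst d *\<^sub>R cnj (g' (fst p)))) (at p)" by simp
  have "(osc n has_derivative (\<lambda>v. v *\<^sub>R (\<i> * of_nat n * osc n (snd p)))) (at (snd p))"
    using osc_deriv unfolding has_vector_derivative_def .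
  from has_derivative_compose[OF has_derivative_snd[OF has_derivative_ident] this]
  have 2: "((\<lambda>q. osc n (snd q)) has_derivative (\<lambda>d. snd d *\<^sub>R (\<i> * of_nat n * osc n (snd p)))) (at p)" by simp
  have "(\<lambda>d. cnj (g (fst p)) * (snd d *\<^sub>R (\<i> * of_nat n * osc n (snd p))) + fst d *\<^sub>R cnj (g' (fst p)) * osc n (snd p))
     = (\<lambda>(v, w). v *\<^sub>R mode n g' p + w *\<^sub>R (\<i> * of_nat n * mode n g p))"
    by (auto simp: mode_def scaleR_conv_of_real algebra_simps)
  with has_derivative_mult[OF 1 2] show "(mode n g has_derivative (\<lambda>(v, w). v *\<^sub>R mode n g' p + w *\<^sub>R (\<i> * of_nat n * mode n g p))) (at p)"
    unfolding mode_def [abs_def, symmetric] by (simp add: mode_def [abs_def])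
next
  have "continuous_on UNIV g"
    by (rule continuous_on_vector_derivative_at) (rule g)
  then show "continuous_on UNIV (mode n g')" "continuous_on UNIV (\<lambda>p. \<i> * of_nat n * mode n g p)"
    by (intro continuous_intros continuous_mode g')+
  show "mode n g (x, y + 2 * pi) = mode n g (x, y)" for x y
    by (simp add: mode_def osc_periodic)
  show "\<exists>r<1. \<forall>x y. r < \<bar>x\<bar> \<longrightarrow> mode n g (x, y) = 0"
    using supp by (intro exI[of _ r]) (auto simp: mode_def)
qed

text \<open>The cutoff \<open>\<chi>\<^sub>j(x) = m\<^sup>2 / (1 + m\<^sup>2)\<close> with \<open>m = max 0 (j (1 - x\<^sup>2) - 1)\<close>: its derivative is \<open>O(1 / (1 - x\<^sup>2))\<close>, which a function
  vanishing at \<open>\<plusminus>1\<close> compensates.\<close>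

definition cutoff :: "real \<Rightarrow> real" where
  "cutoff t = (max 0 (t - 1))\<^sup>2 / (1 + (max 0 (t - 1))\<^sup>2)"

definition cutoff' :: "real \<Rightarrow> real" where
  "cutoff' t = 2 * max 0 (t - 1) / (1 + (max 0 (t - 1))\<^sup>2)\<^sup>2"

text \<open>Squaring smooths the corner of the positive part: at 0 the difference quotient is at
  most |h|. This is what makes the cutoff continuously differentiable.\<close>

lemma max_square_deriv: "((\<lambda>s. (max 0 s)\<^sup>2) has_real_derivative 2 * max 0 s) (at (s::real))"
proof (cases "s = 0")
  case True
  have "(\<lambda>h. ((max 0 (0 + h))\<^sup>2 - (max 0 0)\<^sup>2) / h) \<midarrow>0\<rightarrow> (0::real)"
  proof (rule Lim_null_comparison)
    show "\<forall>\<^sub>F h::real in at 0. norm (((max 0 (0 + h))\<^sup>2 - (max 0 0)\<^sup>2) / h) \<le> \<bar>h\<bar>"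
      by (intro always_eventually allI) (auto simp: max_def power2_eq_square)
    show "((\<lambda>h::real. \<bar>h\<bar>) \<longlongrightarrow> 0) (at 0)" by (auto intro!: tendsto_eq_intros)
  qed
  then show ?thesis unfolding DERIV_def True by simp
next
  case False
  show ?thesis
  proof (cases "s > 0")
    case True
    have "((\<lambda>s. s\<^sup>2) has_real_derivative 2 * max 0 s) (at s)"
      using True by (auto intro!: derivative_eq_intros)
    then show ?thesis
      by (rule has_field_derivative_transform_within_open[of _ _ _ "{0<..}"]) (use True in auto)
  next
    case F: False
    have "((\<lambda>s. 0) has_real_derivative 2 * max 0 s) (at s)"
      using F by (auto intro!: derivative_eq_intros)
    then show ?thesis
      by (rule has_field_derivative_transform_within_open[of _ _ _ "{..<0}"]) (use F False in auto)
  qed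
qed

lemma cutoff_deriv: "(cutoff has_real_derivative cutoff' t) (at t)"
proof -
  have "((\<lambda>t. (max 0 (t - 1))\<^sup>2) has_real_derivative 2 * max 0 (t - 1) * 1) (at t)"
    by (rule DERIV_chain2[OF max_square_deriv]) (auto intro!: derivative_eq_intros)
  moreover have "1 + (max 0 (t - 1))\<^sup>2 \<noteq> 0" by (smt (verit) zero_le_power2)
  ultimately have "((\<lambda>t. (max 0 (t - 1))\<^sup>2 / (1 + (max 0 (t - 1))\<^sup>2)) has_real_derivative
      (2 * max 0 (t - 1) * 1 * (1 + (max 0 (t - 1))\<^sup>2) - (max 0 (t - 1))\<^sup>2 * (0 + 2 * max 0 (t - 1) * 1)) /
        ((1 + (max 0 (t - 1))\<^sup>2) * (1 + (max 0 (t - 1))\<^sup>2))) (at t)"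
    by (intro DERIV_divide DERIV_add DERIV_const)
  then show ?thesis unfolding cutoff_def [abs_def] cutoff'_def
    by (simp add: power2_eq_square algebra_simps)
qed

text \<open>Everything follows from 1 - cutoff = 1 / (1 + m^2) and t \<le> m + 1. The estimates by 2
  / t give pointwise convergence of the truncations, those by constants give domination.\<close>

lemma cutoff_bounds:
  assumes t: "t > 0"
  shows "\<bar>cutoff t - 1\<bar> \<le> 2 / t" "\<bar>cutoff t - 1\<bar> \<le> 1" "0 \<le> cutoff' t" "t * cutoff' t \<le> 2 / t" "t * cutoff' t \<le> 2"
proof -
  define m where "m = max 0 (t - 1)"
  have m: "m \<ge> 0" "t \<le> m + 1" by (auto simp: m_def)
  have d: "1 + m\<^sup>2 \<ge> 1" by simp
  have c: "\<bar>cutoff t - 1\<bar> = 1 / (1 + m\<^sup>2)"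
  proof -
    have "cutoff t - 1 = - (1 / (1 + m\<^sup>2))"
    proof -
      have "a / (1 + a) - 1 = - (1 / (1 + a))" if "1 + a \<noteq> 0" for a :: real using that by (simp add: field_simps)
      moreover have "1 + m\<^sup>2 \<noteq> 0" using d by linarith
      ultimately show ?thesis unfolding cutoff_def m_def[symmetric] by blast
    qed
    then show ?thesis using d by simp
  qed
  have m2: "2 * m \<le> 1 + m\<^sup>2" using zero_le_power2[of "m - 1"] by (simp add: power2_eq_square algebra_simps)
  have m1: "m + 1 \<le> 2 * (1 + m\<^sup>2)" using m2 zero_le_power2[of m] unfolding distrib_left by linarith
  then have t1: "t \<le> 2 * (1 + m\<^sup>2)" using m by linarith
  then show "\<bar>cutoff t - 1\<bar> \<le> 2 / t" unfolding c using t d by (simp add: field_simps)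
  have "1 / (1 + m\<^sup>2) \<le> 1 / 1" using d by (intro frac_le) auto
  then show "\<bar>cutoff t - 1\<bar> \<le> 1" unfolding c by linarith
  show c0: "0 \<le> cutoff' t" by (simp add: cutoff'_def)
  have c': "cutoff' t = 2 * m / (1 + m\<^sup>2)\<^sup>2" by (simp add: cutoff'_def m_def)
  have "t * (2 * m) \<le> 2 * (1 + m\<^sup>2) * (1 + m\<^sup>2)" using t1 m2 t m by (intro mult_mono) auto
  then have "t * (2 * m) / (1 + m\<^sup>2)\<^sup>2 \<le> 2 * (1 + m\<^sup>2) * (1 + m\<^sup>2) / (1 + m\<^sup>2)\<^sup>2" by (rule divide_right_mono) simp
  moreover have one: "2 * (1 + m\<^sup>2) * (1 + m\<^sup>2) / (1 + m\<^sup>2)\<^sup>2 = 2"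
  proof -
    have "2 * a * a / a\<^sup>2 = 2" if "a \<noteq> 0" for a :: real using that by (simp add: power2_eq_square)
    moreover have "1 + m\<^sup>2 \<noteq> 0" using d by linarith
    ultimately show ?thesis by blast
  qed
  ultimately show "t * cutoff' t \<le> 2" unfolding c' by simp
  have "t\<^sup>2 \<le> (m + 1)\<^sup>2" using t m by (intro power_mono) auto
  also have "\<dots> \<le> 2 * (1 + m\<^sup>2)" using zero_le_power2[of "m - 1"] by (simp add: power2_eq_square algebra_simps)
  finally have "t\<^sup>2 * (2 * m) \<le> 2 * (1 + m\<^sup>2) * (1 + m\<^sup>2)" using m2 m by (intro mult_mono) auto
  then have "t\<^sup>2 * (2 * m) / (1 + m\<^sup>2)\<^sup>2 \<le> 2 * (1 + m\<^sup>2) * (1 + m\<^sup>2) / (1 + m\<^sup>2)\<^sup>2" by (rule divide_right_mono) simp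
  then have "t\<^sup>2 * cutoff' t \<le> 2" unfolding c' one by simp
  then show "t * cutoff' t \<le> 2 / t" using t by (simp add: field_simps power2_eq_square)
qed

lemma cutoff_continuous: "continuous_on S cutoff" "continuous_on S cutoff'"
proof -
  show "continuous_on S cutoff"
    by (intro continuous_at_imp_continuous_on ballI DERIV_isCont[OF cutoff_deriv])
  have "1 + (max 0 (t - 1))\<^sup>2 \<noteq> 0" for t :: real by (smt (verit) zero_le_power2)
  then show "continuous_on S cutoff'" unfolding cutoff'_def [abs_def] by (intro continuous_intros) auto
qed

text \<open>Only the eigenvalue equation and the boundary values of the ground state are retained.
  Both \<open>v\<close> and \<open>lam\<close> are complex, since the correction \<mu> is merely
  known to lie in the unit disc.\<close>

locale dirichlet_mode =
  fixes n :: nat and lam :: complex and v v' :: "real \<Rightarrow> complex"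
  assumes v: "\<And>x. (v has_vector_derivative v' x) (at x)"
    and v': "\<And>x. (v' has_vector_derivative ((of_nat n * of_real x)\<^sup>2 - lam) * v x) (at x)"
    and boundary: "v 1 = 0" "v (- 1) = 0"
begin

definition h where "h = mode n v"
definition hx where "hx = mode n v'"
definition hy where "hy p = fst p *\<^sub>R (\<i> * of_nat n * mode n v p)"

lemma v_cont: "continuous_on UNIV v" "continuous_on UNIV v'"
  by (rule continuous_on_vector_derivative_at, rule v)
     (rule continuous_on_vector_derivative_at, rule v')

lemma h_cont: "continuous_on UNIV h" "continuous_on UNIV hx" "continuous_on UNIV hy"
  unfolding h_def hx_def hy_def [abs_def] by (intro continuous_intros continuous_mode v_cont)+

lemma h_L2: "h \<in> L2 Omega" "hx \<in> L2 Omega" "hy \<in> L2 Omega"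
  using h_cont continuous_L2 Omega_borel Omega_bounded by blast+

text \<open>A function vanishing at 1 and -1 with derivative bounded by C is at most C (1 - |x|),
  and 1 - |x| \<le> 1 - x^2. This is the decay that compensates the derivative of the
  cutoff.\<close>

lemma v_near_boundary:
  "\<exists>C\<ge>0. \<forall>x. \<bar>x\<bar> \<le> 1 \<longrightarrow> norm (v x) \<le> C * (1 - x\<^sup>2) \<and> norm (v' x) \<le> C \<and> norm (v x) \<le> C"
proof -
  have "compact (v' ` {-1..1})" by (intro compact_continuous_image continuous_on_subset[OF v_cont(2)]) auto
  then have "bounded (v' ` {-1..1})" by (rule compact_imp_bounded)
  then obtain C where C: "\<forall>z\<in>v' ` {-1..1}. norm z \<le> C" unfolding bounded_iff by blast
  have v'C: "norm (v' x) \<le> C" if "\<bar>x\<bar> \<le> 1" for x using C that by (auto simp: abs_le_iff)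
  have C0: "C \<ge> 0" using order_trans[OF norm_ge_zero v'C[of 0]] by simp
  have lip: "norm (v x - v y) \<le> C * norm (x - y)" if "\<bar>x\<bar> \<le> 1" "\<bar>y\<bar> \<le> 1" for x y
  proof (rule differentiable_bound[of "{-1..1}" v "\<lambda>x d. d *\<^sub>R v' x"])
    show "(v has_derivative (\<lambda>d. d *\<^sub>R v' x)) (at x within {-1..1})" for x
      using has_vector_derivative_at_within[OF v, of x "{-1..1}"] unfolding has_vector_derivative_def .
    show "onorm (\<lambda>d. d *\<^sub>R v' x) \<le> C" if "x \<in> {-1..1}" for x
    proof (rule onorm_le)
      fix d :: real
      have "\<bar>d\<bar> * norm (v' x) \<le> \<bar>d\<bar> * C" using v'C[of x] that by (intro mult_left_mono) auto
      then show "norm (d *\<^sub>R v' x) \<le> C * norm d" by (simp add: mult.commute)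
    qed
  qed (use that in auto)
  have vC: "norm (v x) \<le> C * (1 - x\<^sup>2)" if x: "\<bar>x\<bar> \<le> 1" for x
  proof -
    have "norm (v x) \<le> C * (1 - \<bar>x\<bar>)"
      using lip[OF x, of 1] lip[OF x, of "- 1"] boundary x by (cases "x \<ge> 0") (auto simp: add.commute)
    also have "\<dots> \<le> C * (1 - x\<^sup>2)"
    proof (intro mult_left_mono C0)
      have "\<bar>x\<bar> * \<bar>x\<bar> \<le> \<bar>x\<bar> * 1" using x by (intro mult_left_mono) auto
      then show "1 - \<bar>x\<bar> \<le> 1 - x\<^sup>2" by (simp add: power2_eq_square)
    qed
    finally show ?thesis .
  qed
  have "norm (v x) \<le> C" if x: "\<bar>x\<bar> \<le> 1" for x
    using vC[OF x] C0 mult_left_mono[of "1 - x\<^sup>2" 1 C] by simp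
  then show ?thesis using C0 vC v'C by blast
qed

lemma in_form_domain: "in_form_domain h hx hy"
proof -
  obtain C where C0: "C \<ge> 0" and vC: "\<And>x. \<bar>x\<bar> \<le> 1 \<Longrightarrow> norm (v x) \<le> C * (1 - x\<^sup>2)"
    and v'C: "\<And>x. \<bar>x\<bar> \<le> 1 \<Longrightarrow> norm (v' x) \<le> C" and vC1: "\<And>x. \<bar>x\<bar> \<le> 1 \<Longrightarrow> norm (v x) \<le> C"
    using v_near_boundary by blast
  define \<tau> where "\<tau> j x = real (Suc j) * (1 - x\<^sup>2)" for j x
  define g where "g j x = of_real (cutoff (\<tau> j x)) * v x" for j x
  define g' where "g' j x = of_real (cutoff (\<tau> j x)) * v' x + of_real (cutoff' (\<tau> j x) * (- 2 * real (Suc j) * x)) * v x" for j x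
  have \<tau>_cont: "continuous_on UNIV (\<tau> j)" for j unfolding \<tau>_def [abs_def] by (intro continuous_intros)
  have g_deriv: "(g j has_vector_derivative g' j x) (at x)" for j x
  proof -
    have "((\<lambda>x. cutoff (\<tau> j x)) has_real_derivative cutoff' (\<tau> j x) * (- 2 * real (Suc j) * x)) (at x)"
      by (rule DERIV_chain2[OF cutoff_deriv]) (auto simp: \<tau>_def [abs_def] algebra_simps intro!: derivative_eq_intros)
    from has_vector_derivative_mult[OF has_vector_derivative_of_real[OF this] v]
    show ?thesis unfolding g_def [abs_def] g'_def .
  qed
  have g_cont: "continuous_on UNIV (g j)" for j
    by (rule continuous_on_vector_derivative_at) (rule g_deriv)
  have g'_cont: "continuous_on UNIV (g' j)" for j
    unfolding g'_def [abs_def]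
    by (intro continuous_intros v_cont continuous_on_compose2[OF cutoff_continuous(1)[of UNIV] \<tau>_cont]
        continuous_on_compose2[OF cutoff_continuous(2)[of UNIV] \<tau>_cont]) auto
  have C1: "C1_compact_support (mode n (g j)) (mode n (g' j)) (\<lambda>p. \<i> * of_nat n * mode n (g j) p)" for j
  proof (rule mode_C1_compact_support[OF g_deriv g'_cont])
    \<comment> \<open>For |x| > r one has (j + 1)(1 - x^2) < 1, where the cutoff vanishes.\<close>
    define r where "r = sqrt (1 - 1 / real (Suc j))"
    have r: "0 \<le> 1 - 1 / real (Suc j)" by simp
    show "r < 1" unfolding r_def by simp
    show "g j x = 0" if "\<bar>x\<bar> > r" for x
    proof -
      have "r\<^sup>2 < \<bar>x\<bar>\<^sup>2" using that r by (intro power_strict_mono) (auto simp: r_def)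
      then have "1 - x\<^sup>2 < 1 / real (Suc j)" using r by (simp add: r_def)
      then have "\<tau> j x < 1" by (simp add: \<tau>_def field_simps)
      then show ?thesis by (simp add: g_def cutoff_def)
    qed
  qed
  have Om: "\<bar>fst p\<bar> < 1" if "p \<in> Omega" for p using that by (auto simp: Omega_def)
  have \<tau>_pos: "\<tau> j x > 0" if "\<bar>x\<bar> < 1" for j x
    using that by (simp add: \<tau>_def abs_square_less_1)
  have \<tau>_lim: "(\<lambda>j. 2 / \<tau> j x) \<longlonglongrightarrow> 0" if "\<bar>x\<bar> < 1" for x
  proof -
    have "(\<lambda>j. (2 / (1 - x\<^sup>2)) * inverse (real (Suc j))) \<longlonglongrightarrow> (2 / (1 - x\<^sup>2)) * 0"
      by (intro tendsto_intros LIMSEQ_inverse_real_of_nat)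
    then show ?thesis by (simp add: \<tau>_def field_simps)
  qed
  have g_diff: "norm (g j x - v x) \<le> C * (2 / \<tau> j x) \<and> norm (g j x - v x) \<le> C" if x: "\<bar>x\<bar> < 1" for j x
  proof -
    have "g j x - v x = of_real (cutoff (\<tau> j x) - 1) * v x" by (simp add: g_def algebra_simps)
    then have eq: "norm (g j x - v x) = \<bar>cutoff (\<tau> j x) - 1\<bar> * norm (v x)" by (simp only: norm_mult norm_of_real)
    have "\<bar>cutoff (\<tau> j x) - 1\<bar> * norm (v x) \<le> (2 / \<tau> j x) * C" "\<bar>cutoff (\<tau> j x) - 1\<bar> * norm (v x) \<le> 1 * C"
      using cutoff_bounds[OF \<tau>_pos[OF x]] vC1[of x] x \<tau>_pos[OF x, of j] C0
      by - (intro mult_mono; simp)+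
    then show ?thesis unfolding eq by (simp add: mult.commute)
  qed
  have g'_diff: "norm (g' j x - v' x) \<le> 3 * C * (2 / \<tau> j x) \<and> norm (g' j x - v' x) \<le> 5 * C" if x: "\<bar>x\<bar> < 1" for j x
  proof -
    define t where "t = \<tau> j x"
    have t: "t > 0" using \<tau>_pos[OF x] by (simp add: t_def)
    note cb = cutoff_bounds[OF t]
    have "g' j x - v' x = of_real (cutoff t - 1) * v' x + of_real (cutoff' t * (- 2 * real (Suc j) * x)) * v x"
      by (simp add: g'_def t_def algebra_simps)
    then have "norm (g' j x - v' x) \<le> norm (of_real (cutoff t - 1) * v' x) + norm (of_real (cutoff' t * (- 2 * real (Suc j) * x)) * v x)"
      by (simp only: norm_triangle_ineq)
    also have "\<dots> = \<bar>cutoff t - 1\<bar> * norm (v' x) + cutoff' t * (2 * real (Suc j) * \<bar>x\<bar>) * norm (v x)"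
      unfolding norm_mult norm_of_real abs_mult using cb(3) by simp
    also have "\<dots> \<le> \<bar>cutoff t - 1\<bar> * C + cutoff' t * (2 * real (Suc j) * 1) * (C * (1 - x\<^sup>2))"
      using cb(3) vC[of x] v'C[of x] x by (intro add_mono mult_mono mult_left_mono) auto
    \<comment> \<open>The factor j + 1 from the chain rule and the factor 1 - x^2 from the boundary
      decay of v recombine to t, so only t cutoff'(t) has to be controlled.\<close>
    also have "\<dots> = \<bar>cutoff t - 1\<bar> * C + 2 * C * (t * cutoff' t)" by (simp add: t_def \<tau>_def algebra_simps)
    finally have *: "norm (g' j x - v' x) \<le> \<bar>cutoff t - 1\<bar> * C + 2 * C * (t * cutoff' t)" .
    have "\<bar>cutoff t - 1\<bar> * C + 2 * C * (t * cutoff' t) \<le> (2 / t) * C + 2 * C * (2 / t)"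
      "\<bar>cutoff t - 1\<bar> * C + 2 * C * (t * cutoff' t) \<le> 1 * C + 2 * C * 2"
      using cb C0 by (intro add_mono mult_right_mono mult_left_mono; simp)+
    then show ?thesis using * unfolding t_def[symmetric] by (simp add: algebra_simps)
  qed
  have mode_lim: "L2_tendsto Omega (\<lambda>j. mode n (w j)) (mode n z) sequentially"
    if w: "\<And>j. continuous_on UNIV (w j)" and z: "continuous_on UNIV z"
      and le: "\<And>j x. \<bar>x\<bar> < 1 \<Longrightarrow> norm (w j x - z x) \<le> K1 * (2 / \<tau> j x) \<and> norm (w j x - z x) \<le> K2" for w z K1 K2
  proof (rule L2_tendsto_bounded[OF Omega_borel Omega_bounded])
    show "mode n (w j) \<in> L2 Omega" "mode n z \<in> L2 Omega" for j
      by (intro continuous_L2 continuous_mode w z Omega_borel Omega_bounded)+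
    have eq: "norm (mode n (w j) p - mode n z p) = norm (w j (fst p) - z (fst p))" for j p
      unfolding norm_mode[of n "\<lambda>x. w j x - z x", symmetric] by (simp add: mode_def algebra_simps)
    show "norm (mode n (w j) p - mode n z p) \<le> K2" if "p \<in> Omega" for j p
      unfolding eq using le[OF Om[OF that]] by blast
    show "(\<lambda>j. mode n (w j) p) \<longlonglongrightarrow> mode n z p" if p: "p \<in> Omega" for p
    proof (rule LIM_zero_cancel, rule Lim_null_comparison)
      show "\<forall>\<^sub>F j in sequentially. norm (mode n (w j) p - mode n z p) \<le> K1 * (2 / \<tau> j (fst p))"
        unfolding eq using le[OF Om[OF p]] by (intro always_eventually allI) blast
      show "(\<lambda>j. K1 * (2 / \<tau> j (fst p))) \<longlonglongrightarrow> 0" using tendsto_mult_left[OF \<tau>_lim[OF Om[OF p]], of K1] by simp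
    qed
  qed
  have lim1: "L2_tendsto Omega (\<lambda>j. mode n (g j)) h sequentially"
    unfolding h_def by (rule mode_lim[OF g_cont v_cont(1) g_diff])
  have lim2: "L2_tendsto Omega (\<lambda>j. mode n (g' j)) hx sequentially"
    unfolding hx_def by (rule mode_lim[OF g'_cont v_cont(2) g'_diff])
  have lim3: "L2_tendsto Omega (\<lambda>j (x, y). x *\<^sub>R (\<i> * of_nat n * mode n (g j) (x, y))) hy sequentially"
  proof (rule L2_tendsto_bounded[OF Omega_borel Omega_bounded])
    define G where "G j p = fst p *\<^sub>R (\<i> * of_nat n * mode n (g j) p)" for j p
    have G: "(\<lambda>(x, y). x *\<^sub>R (\<i> * of_nat n * mode n (g j) (x, y))) = G j" for j by (auto simp: G_def)
    show "(\<lambda>(x, y). x *\<^sub>R (\<i> * of_nat n * mode n (g j) (x, y))) \<in> L2 Omega" for j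
      unfolding G G_def by (intro continuous_L2 continuous_intros continuous_mode g_cont Omega_borel Omega_bounded)
    show "hy \<in> L2 Omega" by (rule h_L2)
    have eq: "G j p - hy p = fst p *\<^sub>R (\<i> * of_nat n * mode n (\<lambda>x. g j x - v x) p)" for j p
      by (simp add: G_def mode_def hy_def algebra_simps)
    have le: "norm (G j p - hy p) \<le> real n * norm (g j (fst p) - v (fst p))" if "p \<in> Omega" for j p
    proof -
      have "norm (G j p - hy p) = \<bar>fst p\<bar> * (real n * norm (g j (fst p) - v (fst p)))"
        unfolding eq by (simp add: norm_mult norm_mode)
      also have "\<dots> \<le> 1 * (real n * norm (g j (fst p) - v (fst p)))"
        using Om[OF that] by (intro mult_right_mono) auto
      finally show ?thesis by simp
    qed
    show "norm ((case p of (x, y) \<Rightarrow> x *\<^sub>R (\<i> * of_nat n * mode n (g j) (x, y))) - hy p) \<le> real n * C" if p: "p \<in> Omega" for j p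
    proof -
      have "real n * norm (g j (fst p) - v (fst p)) \<le> real n * C" using g_diff[OF Om[OF p]] by (intro mult_left_mono) auto
      then show ?thesis using le[OF p, of j] unfolding G by linarith
    qed
    show "(\<lambda>j. (case p of (x, y) \<Rightarrow> x *\<^sub>R (\<i> * of_nat n * mode n (g j) (x, y)))) \<longlonglongrightarrow> hy p" if p: "p \<in> Omega" for p
      unfolding G
    proof (rule LIM_zero_cancel, rule Lim_null_comparison)
      show "\<forall>\<^sub>F j in sequentially. norm (G j p - hy p) \<le> real n * (C * (2 / \<tau> j (fst p)))"
      proof (intro always_eventually allI)
        fix j
        have "real n * norm (g j (fst p) - v (fst p)) \<le> real n * (C * (2 / \<tau> j (fst p)))"
          using g_diff[OF Om[OF p]] by (intro mult_left_mono) auto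
        then show "norm (G j p - hy p) \<le> real n * (C * (2 / \<tau> j (fst p)))" using le[OF p, of j] by linarith
      qed
      show "(\<lambda>j. real n * (C * (2 / \<tau> j (fst p)))) \<longlonglongrightarrow> 0"
        using tendsto_mult_left[OF \<tau>_lim[OF Om[OF p]], of "real n * C"] by (simp add: mult.assoc)
    qed
  qed
  show ?thesis unfolding in_form_domain_def
    using h_L2 C1 lim1 lim2 lim3
    by (intro conjI exI[of _ "\<lambda>j. mode n (g j)"] exI[of _ "\<lambda>j. mode n (g' j)"] exI[of _ "\<lambda>j p. \<i> * of_nat n * mode n (g j) p"] allI) auto
qed

end

subsection \<open>The moment identity\<close>

lemma product_integrable:
  fixes a b :: "real \<Rightarrow> complex"
  assumes a: "integrable lborel a" and b: "integrable lborel b"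
  shows "integrable lborel (\<lambda>p. a (fst p) * b (snd p))"
proof -
  have [measurable]: "a \<in> borel_measurable lborel" "b \<in> borel_measurable lborel" using a b by auto
  have "integrable (lborel \<Otimes>\<^sub>M lborel) (\<lambda>p. a (fst p) * b (snd p))"
  proof (rule lborel_pair.Fubini_integrable)
    show "integrable lborel (\<lambda>x. LINT y|lborel. norm (a (fst (x, y)) * b (snd (x, y))))"
      using a by (simp add: norm_mult)
    show "AE x in lborel. integrable lborel (\<lambda>y. a (fst (x, y)) * b (snd (x, y)))"
      using b by simp
  qed measurable
  then show ?thesis unfolding lborel_prod .
qed

text \<open>Variation of constants for \<open>\<phi>' = U - \<lambda> \<phi>\<close> with merely integrable \<open>U\<close>; Fubini's theorem on the triangle
  \<open>0 \<le> r \<le> s \<le> T\<close> plays the role of integration by parts.\<close>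

lemma duhamel:
  fixes g \<phi> U :: "real \<Rightarrow> complex" and lam \<phi>0 :: complex
  assumes T: "T \<ge> 0" and U: "set_integrable lborel {0..T} U"
    and \<phi>_int: "set_integrable lborel {0..T} \<phi>"
    and \<phi>: "\<And>t. t \<in> {0..T} \<Longrightarrow> \<phi> t = \<phi>0 + (LINT s:{0..t}|lborel. U s - lam * \<phi> s)"
  shows "exp (lam * of_real T) * \<phi> T = \<phi>0 + (LINT s:{0..T}|lborel. exp (lam * of_real s) * U s)"
proof -
  define e where "e s = exp (lam * of_real s)" for s :: real
  define g where "g s = U s - lam * \<phi> s" for s
  have e_deriv: "(e has_vector_derivative lam * e s) (at s)" for s
  proof -
    have "((\<lambda>z. exp (lam * z)) has_field_derivative lam * exp (lam * of_real s)) (at (of_real s))"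
      by (auto intro!: derivative_eq_intros)
    from vector_derivative_of_real[OF this] show ?thesis unfolding e_def [abs_def] .
  qed
  have e_cont: "continuous_on S e" for S
    by (rule continuous_on_vector_derivative_at) (rule e_deriv)
  have g_int: "set_integrable lborel {0..T} g"
    unfolding g_def by (intro set_integral_diff(1) U set_integrable_mult_right \<phi>_int)
  define a where "a s = indicat_real {0..T} s *\<^sub>R (lam * e s)" for s
  define b where "b r = indicat_real {0..T} r *\<^sub>R g r" for r
  define D where "D = {p :: real \<times> real. snd p \<le> fst p}"
  have D: "D \<in> sets borel"
  proof -
    have "closed D" unfolding D_def by (intro closed_Collect_le continuous_intros)
    then show ?thesis by (rule borel_closed)
  qed
  have a_int: "integrable lborel a"
    unfolding a_def by (intro borel_integrable_compact continuous_intros e_cont) auto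
  have b_int: "integrable lborel b" using g_int unfolding b_def set_integrable_def .
  \<comment> \<open>The kernel on the triangle r \<le> s: integrating over r recovers \<phi> -
    \<phi>0, integrating over s gives the increment of the exponential from r to T.\<close>
  define k where "k s r = indicat_real D (s, r) *\<^sub>R (a s * b r)" for s r
  have "integrable lborel (\<lambda>p. indicat_real D p *\<^sub>R (a (fst p) * b (snd p)))"
    using D by (intro integrable_mult_indicator product_integrable a_int b_int) auto
  then have k_int: "integrable (lborel \<Otimes>\<^sub>M lborel) (case_prod k)"
    unfolding lborel_prod k_def by (simp add: case_prod_unfold)
  have k1: "(LINT r|lborel. k s r) = indicat_real {0..T} s *\<^sub>R (lam * e s * (\<phi> s - \<phi>0))" for s
  proof (cases "s \<in> {0..T}")
    case True
    have "k s r = lam * e s * (indicat_real {0..s} r *\<^sub>R g r)" for r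
      using True by (auto simp: k_def a_def b_def D_def indicator_def)
    then have "(LINT r|lborel. k s r) = lam * e s * (LINT r:{0..s}|lborel. g r)"
      by (simp only: set_lebesgue_integral_def integral_mult_right_zero)
    also have "(LINT r:{0..s}|lborel. g r) = \<phi> s - \<phi>0" using \<phi>[OF True] by (simp add: g_def)
    finally show ?thesis using True by simp
  qed (simp add: k_def a_def)
  have k2: "(LINT s|lborel. k s r) = indicat_real {0..T} r *\<^sub>R ((e T - e r) * g r)" for r
  proof (cases "r \<in> {0..T}")
    case True
    have "k s r = (indicat_real {r..T} s *\<^sub>R (lam * e s)) * g r" for s
      using True by (auto simp: k_def a_def b_def D_def indicator_def)
    then have "(LINT s|lborel. k s r) = (LINT s:{r..T}|lborel. lam * e s) * g r"
      by (simp only: set_lebesgue_integral_def integral_mult_left_zero)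
    also have "(LINT s:{r..T}|lborel. lam * e s) = e T - e r"
      by (rule set_integral_FTC[OF e_deriv]) (use True in \<open>auto intro!: continuous_intros e_cont\<close>)
    finally show ?thesis using True by simp
  qed (simp add: k_def b_def)
  have A: "(LINT s:{0..T}|lborel. lam * e s * (\<phi> s - \<phi>0)) = (LINT r:{0..T}|lborel. (e T - e r) * g r)"
    using lborel_pair.Fubini_integral[OF k_int] unfolding k1 k2 set_lebesgue_integral_def by simp
  have bounded_mult: "set_integrable lborel {0..T} (\<lambda>s. e s * w s)" if w: "set_integrable lborel {0..T} w" for w
  proof -
    have "compact (e ` {0..T})" by (intro compact_continuous_image e_cont) auto
    then have "bounded (e ` {0..T})" by (rule compact_imp_bounded)
    then obtain B where B: "\<forall>z\<in>e ` {0..T}. norm z \<le> B" unfolding bounded_iff by blast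
    have [measurable]: "e \<in> borel_measurable borel" by (rule borel_measurable_continuous_onI[OF e_cont])
    show ?thesis
    proof (rule set_integrable_bound)
      show "set_integrable lborel {0..T} (\<lambda>s. B * norm (w s))"
        by (intro set_integrable_mult_right set_integrable_norm w)
      have [measurable]: "(\<lambda>s. indicat_real {0..T} s *\<^sub>R w s) \<in> borel_measurable lborel"
        using w unfolding set_integrable_def by auto
      have "(\<lambda>s. e s * (indicat_real {0..T} s *\<^sub>R w s)) \<in> borel_measurable lborel" by measurable
      then show "set_borel_measurable lborel {0..T} (\<lambda>s. e s * w s)"
        unfolding set_borel_measurable_def by (simp add: scaleR_conv_of_real mult.left_commute)
      show "AE s in lborel. s \<in> {0..T} \<longrightarrow> norm (e s * w s) \<le> norm (B * norm (w s))"
      proof (intro AE_I2 impI)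
        fix s assume "s \<in> {0..T}"
        then have "norm (e s) \<le> B" using B by blast
        then have "norm (e s) * norm (w s) \<le> B * norm (w s)" by (rule mult_right_mono) simp
        also have "\<dots> \<le> norm (B * norm (w s))" by simp
        finally show "norm (e s * w s) \<le> norm (B * norm (w s))" by (simp only: norm_mult)
      qed
    qed
  qed
  have eg: "set_integrable lborel {0..T} (\<lambda>s. e s * g s)" and ep: "set_integrable lborel {0..T} (\<lambda>s. e s * \<phi> s)"
    and eU: "set_integrable lborel {0..T} (\<lambda>s. e s * U s)" and e1: "set_integrable lborel {0..T} (\<lambda>s. lam * e s)"
    by (rule bounded_mult[OF g_int], rule bounded_mult[OF \<phi>_int], rule bounded_mult[OF U],
        rule continuous_set_integrable) (auto intro!: continuous_intros e_cont)
  have B: "(LINT s:{0..T}|lborel. lam * e s * (\<phi> s - \<phi>0)) = lam * (LINT s:{0..T}|lborel. e s * \<phi> s) - (LINT s:{0..T}|lborel. lam * e s) * \<phi>0"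
  proof -
    have "(LINT s:{0..T}|lborel. lam * e s * (\<phi> s - \<phi>0)) = (LINT s:{0..T}|lborel. lam * (e s * \<phi> s) - lam * e s * \<phi>0)"
      by (simp add: algebra_simps)
    also have "\<dots> = (LINT s:{0..T}|lborel. lam * (e s * \<phi> s)) - (LINT s:{0..T}|lborel. lam * e s * \<phi>0)"
      by (intro set_integral_diff(2) set_integrable_mult_right set_integrable_mult_left ep e1)
    finally show ?thesis by simp
  qed
  have C: "(LINT s:{0..T}|lborel. lam * e s) = e T - e 0"
    by (rule set_integral_FTC[OF e_deriv]) (use T in \<open>auto intro!: continuous_intros e_cont\<close>)
  have D': "(LINT r:{0..T}|lborel. (e T - e r) * g r) = e T * (\<phi> T - \<phi>0) - ((LINT s:{0..T}|lborel. e s * U s) - lam * (LINT s:{0..T}|lborel. e s * \<phi> s))"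
  proof -
    have "(LINT r:{0..T}|lborel. (e T - e r) * g r) = (LINT r:{0..T}|lborel. e T * g r - e r * g r)"
      by (simp add: algebra_simps)
    also have "\<dots> = (LINT r:{0..T}|lborel. e T * g r) - (LINT r:{0..T}|lborel. e r * g r)"
      by (intro set_integral_diff(2) set_integrable_mult_right g_int eg)
    also have "(LINT r:{0..T}|lborel. e r * g r) = (LINT r:{0..T}|lborel. e r * U r - lam * (e r * \<phi> r))"
      by (simp add: g_def algebra_simps)
    also have "\<dots> = (LINT r:{0..T}|lborel. e r * U r) - (LINT r:{0..T}|lborel. lam * (e r * \<phi> r))"
      by (intro set_integral_diff(2) set_integrable_mult_right eU ep)
    finally show ?thesis using \<phi>[of T] T by (simp add: g_def)
  qed
  have "e 0 = 1" by (simp add: e_def)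
  then have "e T * \<phi> T = \<phi>0 + (LINT s:{0..T}|lborel. e s * U s)"
    using A unfolding B C D' by (simp only: left_diff_distrib right_diff_distrib) (simp add: algebra_simps)
  then show ?thesis unfolding e_def .
qed

context dirichlet_mode
begin

lemma cnj_h: "cnj (h p) = v (fst p) * cnj (osc n (snd p))"
  "cnj (hx p) = v' (fst p) * cnj (osc n (snd p))"
  "cnj (hy p) = - (of_real (fst p) * \<i> * of_nat n * v (fst p) * cnj (osc n (snd p)))"
  by (simp_all add: h_def hx_def hy_def mode_def scaleR_conv_of_real)

text \<open>Integration by parts with all further derivatives falling on the eigenfunction, as
  \<phi> is only \<open>C\<^sup>1\<close>. Boundary terms vanish because \<phi> is zero at x = 1 and
  x = -1 and everything is periodic in y.\<close>

lemma test_function_eigen: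
  assumes C1: "C1_compact_support \<phi> \<phi>x \<phi>y"
  shows "L2_inner Omega \<phi>x hx + L2_inner Omega (\<lambda>(x, y). x *\<^sub>R \<phi>y (x, y)) hy = lam * L2_inner Omega \<phi> h"
    and "\<phi> \<in> L2 Omega" "\<phi>x \<in> L2 Omega" "(\<lambda>(x, y). x *\<^sub>R \<phi>y (x, y)) \<in> L2 Omega"
proof -
  have d: "(\<phi> has_derivative (\<lambda>(v, w). v *\<^sub>R \<phi>x p + w *\<^sub>R \<phi>y p)) (at p)" for p
    using C1 unfolding C1_compact_support_def by blast
  have cont: "continuous_on UNIV \<phi>" "continuous_on UNIV \<phi>x" "continuous_on UNIV \<phi>y"
    using C1 has_derivative_continuous[OF d] unfolding C1_compact_support_def
    by (auto intro: continuous_at_imp_continuous_on)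
  have per: "\<phi> (x, y + 2 * pi) = \<phi> (x, y)" for x y using C1 unfolding C1_compact_support_def by blast
  have bd: "\<phi> (1, y) = 0" "\<phi> (- 1, y) = 0" for y using C1 unfolding C1_compact_support_def by force+
  have dx: "((\<lambda>x. \<phi> (x, y)) has_vector_derivative \<phi>x (x, y)) (at x)" for x y
  proof -
    have "((\<lambda>x. (x, y)) has_derivative (\<lambda>d. (d, 0))) (at x)" by (auto intro!: derivative_eq_intros)
    from has_derivative_compose[OF this d] show ?thesis unfolding has_vector_derivative_def by simp
  qed
  have dy: "((\<lambda>y. \<phi> (x, y)) has_vector_derivative \<phi>y (x, y)) (at y)" for x y
  proof -
    have "((\<lambda>y. (x, y)) has_derivative (\<lambda>d. (0, d))) (at y)" by (auto intro!: derivative_eq_intros)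
    from has_derivative_compose[OF this d] show ?thesis unfolding has_vector_derivative_def by simp
  qed
  define E where "E y = cnj (osc n y)" for y
  have E_deriv: "(E has_vector_derivative - (\<i> * of_nat n * E y)) (at y)" for y
    using bounded_linear.has_vector_derivative[OF bounded_linear_cnj osc_deriv[of n y]] unfolding E_def [abs_def] by simp
  have E_cont: "continuous_on S E" for S
    by (rule continuous_on_vector_derivative_at) (rule E_deriv)
  have cv: "continuous_on UNIV (\<lambda>p :: real \<times> real. v (fst p))" "continuous_on UNIV (\<lambda>p :: real \<times> real. v' (fst p))"
    "continuous_on UNIV (\<lambda>p :: real \<times> real. E (snd p))"
    by (auto intro!: continuous_on_compose2[OF v_cont(1)] continuous_on_compose2[OF v_cont(2)] continuous_on_compose2[OF E_cont[of UNIV]] continuous_intros)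
  \<comment> \<open>\<open>D1\<close> is the x-derivative of \<phi> v' E and \<open>D2\<close> the
    y-derivative of - i n x^2 v \<phi> E. In their sum the terms n^2 x^2 \<phi> v E cancel and the
    integrand of the eigenvalue identity is left.\<close>
  define D1 where "D1 p = (\<phi>x p * v' (fst p) + \<phi> p * (((of_nat n * of_real (fst p))\<^sup>2 - lam) * v (fst p))) * E (snd p)" for p
  define D2 where "D2 p = - (\<i> * of_nat n * (of_real (fst p))\<^sup>2 * v (fst p)) * (\<phi>y p * E (snd p) - \<i> * of_nat n * \<phi> p * E (snd p))" for p
  have D_cont: "continuous_on UNIV D1" "continuous_on UNIV D2"
    unfolding D1_def [abs_def] D2_def [abs_def] by (intro continuous_intros cont cv)+
  have D_int: "set_integrable lborel Omega D1" "set_integrable lborel Omega D2"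
    by (intro continuous_set_integrable D_cont Omega_borel Omega_bounded)+
  have slice: "continuous_on UNIV (\<lambda>x. D (x, y))" "continuous_on UNIV (\<lambda>y. D (x, y))" if "continuous_on UNIV D" for D :: "real \<times> real \<Rightarrow> complex" and x y
    by (auto intro!: continuous_on_compose2[OF that] continuous_intros)
  have I1: "(LINT p:Omega|lborel. D1 p) = 0"
  proof -
    have "(LINT x:{-1<..<1}|lborel. D1 (x, y)) = \<phi> (1, y) * v' 1 * E y - \<phi> (- 1, y) * v' (- 1) * E y" for y
    proof (rule set_integral_FTC[OF _ slice(1)[OF D_cont(1)]])
      show "((\<lambda>x. \<phi> (x, y) * v' x * E y) has_vector_derivative D1 (x, y)) (at x)" for x
        using has_vector_derivative_mult_left[OF has_vector_derivative_mult[OF dx[of y x] v'[of x]], of "E y"]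
        by (simp add: D1_def algebra_simps)
    qed auto
    then show ?thesis using D_int(1) unfolding Omega_def by (simp add: set_integral_Times' bd)
  qed
  have I2: "(LINT p:Omega|lborel. D2 p) = 0"
  proof -
    have "(LINT y:{0..<2 * pi}|lborel. D2 (x, y)) = - (\<i> * of_nat n * (of_real x)\<^sup>2 * v x) * (\<phi> (x, 2 * pi) * E (2 * pi))
        - - (\<i> * of_nat n * (of_real x)\<^sup>2 * v x) * (\<phi> (x, 0) * E 0)" for x
    proof (rule set_integral_FTC[OF _ slice(2)[OF D_cont(2)]])
      show "((\<lambda>y. - (\<i> * of_nat n * (of_real x)\<^sup>2 * v x) * (\<phi> (x, y) * E y)) has_vector_derivative D2 (x, y)) (at y)" for y
        using has_vector_derivative_mult_right[OF has_vector_derivative_mult[OF dy[of x y] E_deriv[of y]], of "- (\<i> * of_nat n * (of_real x)\<^sup>2 * v x)"]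
        by (simp add: D2_def algebra_simps)
    qed auto
    moreover have "E (2 * pi) = E 0" "\<phi> (x, 2 * pi) = \<phi> (x, 0)" for x
      using osc_periodic[of n 0] per[of x 0] by (auto simp: E_def)
    ultimately show ?thesis using D_int(2) unfolding Omega_def by (simp add: set_integral_Times)
  qed
  have xc: "continuous_on UNIV (\<lambda>(x, y). x *\<^sub>R \<phi>y (x, y))"
    unfolding case_prod_unfold prod.collapse by (intro continuous_intros cont)
  show L: "\<phi> \<in> L2 Omega" "\<phi>x \<in> L2 Omega" "(\<lambda>(x, y). x *\<^sub>R \<phi>y (x, y)) \<in> L2 Omega"
    by (intro continuous_L2 cont xc Omega_borel Omega_bounded)+
  have "L2_inner Omega \<phi>x hx + L2_inner Omega (\<lambda>(x, y). x *\<^sub>R \<phi>y (x, y)) hy - lam * L2_inner Omega \<phi> h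
    = (LINT p:Omega|lborel. \<phi>x p * cnj (hx p) + (case p of (x, y) \<Rightarrow> x *\<^sub>R \<phi>y (x, y)) * cnj (hy p) - lam * (\<phi> p * cnj (h p)))"
    unfolding L2_inner_def
    using L h_L2 L2_mult_integrable[OF Omega_borel]
    by (simp add: set_integral_add set_integral_diff)
  also have "(\<lambda>p. \<phi>x p * cnj (hx p) + (case p of (x, y) \<Rightarrow> x *\<^sub>R \<phi>y (x, y)) * cnj (hy p) - lam * (\<phi> p * cnj (h p))) = (\<lambda>p. D1 p + D2 p)"
    unfolding cnj_h E_def[symmetric]
    by (auto simp: D1_def D2_def fun_eq_iff scaleR_conv_of_real algebra_simps power2_eq_square)
  also have "(LINT p:Omega|lborel. D1 p + D2 p) = 0"
    using D_int I1 I2 by (simp add: set_integral_add)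
  finally show "L2_inner Omega \<phi>x hx + L2_inner Omega (\<lambda>(x, y). x *\<^sub>R \<phi>y (x, y)) hy = lam * L2_inner Omega \<phi> h"
    by simp
qed

text \<open>The form domain consists of limits of test functions in precisely the three components
  that occur here, and the inner product is continuous in each.\<close>

lemma weak_eigen:
  assumes f: "in_form_domain f gx gy"
  shows "L2_inner Omega gx hx + L2_inner Omega gy hy = lam * L2_inner Omega f h"
proof -
  have L: "f \<in> L2 Omega" "gx \<in> L2 Omega" "gy \<in> L2 Omega" using f by (auto simp: in_form_domain_def)
  obtain \<phi> \<phi>x \<phi>y where C1: "\<And>j::nat. C1_compact_support (\<phi> j) (\<phi>x j) (\<phi>y j)"
    and lim: "L2_tendsto Omega \<phi> f sequentially" "L2_tendsto Omega \<phi>x gx sequentially"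
      "L2_tendsto Omega (\<lambda>j (x, y). x *\<^sub>R \<phi>y j (x, y)) gy sequentially"
    using f unfolding in_form_domain_def by blast
  note t = test_function_eigen[OF C1]
  have "(\<lambda>j. L2_inner Omega (\<phi>x j) hx + L2_inner Omega (\<lambda>(x, y). x *\<^sub>R \<phi>y j (x, y)) hy) \<longlonglongrightarrow> L2_inner Omega gx hx + L2_inner Omega gy hy"
    using t L h_L2 lim by (intro tendsto_add L2_inner_tendsto[OF Omega_borel]) auto
  moreover have "(\<lambda>j. lam * L2_inner Omega (\<phi> j) h) \<longlonglongrightarrow> lam * L2_inner Omega f h"
    using t L h_L2 lim by (intro tendsto_mult tendsto_const L2_inner_tendsto[OF Omega_borel]) auto
  ultimately show ?thesis unfolding t(1) by (rule LIMSEQ_unique)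
qed

end

lemma continuous_mode_time:
  assumes g: "continuous_on UNIV g"
  shows "continuous_on UNIV (\<lambda>q. g (snd q :: 'b::topological_space))"
  by (rule continuous_on_compose2[OF g]) (auto intro!: continuous_intros)

text \<open>By the eigenvalue identity at almost every time, the weak equation tested with the mode
  becomes a scalar integral equation \<phi>' = U - lam \<phi> for the coefficient \<phi>. Variation
  of constants together with \<phi>(T) = 0 leaves only the initial value and the moment of the
  control.\<close>

lemma (in dirichlet_mode) moment_identity:
  assumes T: "T > 0" and W: "W \<in> sets borel" "W \<subseteq> Omega" and u: "u \<in> L2 ({0..T} \<times> W)" and f0: "f0 \<in> L2 Omega"
    and sol: "grushin_solution T W u f0 f" and null: "AE p\<in>Omega in lborel. f T p = 0"
  shows "L2_inner Omega f0 h + (LINT q:{0..T} \<times> W|lborel. u q * (exp (lam * of_real (fst q)) * cnj (h (snd q)))) = 0"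
proof -
  define \<phi> where "\<phi> t = L2_inner Omega (f t) h" for t
  define U where "U s = (LINT p:W|lborel. u (s, p) * cnj (h p))" for s
  have fL: "f t \<in> L2 Omega" "L2_tendsto Omega f (f t) (at t within {0..T})" if "t \<in> {0..T}" for t
    using sol that unfolding grushin_solution_def by auto
  obtain gx gy where g: "gx \<in> L2 ({0..T} \<times> Omega)" "gy \<in> L2 ({0..T} \<times> Omega)"
    and dom: "AE t\<in>{0..T} in lborel. in_form_domain (f t) (\<lambda>p. gx (t, p)) (\<lambda>p. gy (t, p))"
    and weak: "\<And>h hx hy t. in_form_domain h hx hy \<Longrightarrow> t \<in> {0..T} \<Longrightarrow>
           L2_inner Omega (f t) h - L2_inner Omega f0 h
             + L2_inner ({0..t} \<times> Omega) gx (\<lambda>(s, p). hx p)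
             + L2_inner ({0..t} \<times> Omega) gy (\<lambda>(s, p). hy p)
           = L2_inner ({0..t} \<times> W) u (\<lambda>(s, p). h p)"
    using sol unfolding grushin_solution_def by blast
  have bor: "{0..t} \<times> Omega \<in> sets borel" "{0..t} \<times> W \<in> sets borel" for t :: real
    by (intro borel_Times Omega_borel W; simp)+
  have bnd: "bounded ({0..t} \<times> Omega)" "bounded ({0..t} \<times> W)" for t :: real
    using Omega_bounded bounded_subset[OF Omega_bounded W(2)] by (auto intro!: bounded_Times)
  have hL: "(\<lambda>(s, p). h p) \<in> L2 ({0..T} \<times> W)" "(\<lambda>(s, p). hx p) \<in> L2 ({0..T} \<times> Omega)" "(\<lambda>(s, p). hy p) \<in> L2 ({0..T} \<times> Omega)"
    unfolding case_prod_unfold by (intro continuous_L2 continuous_mode_time h_cont bor bnd)+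
  have slices: "(LINT q:{0..t} \<times> S|lborel. w q * cnj (case q of (s, p) \<Rightarrow> g p)) = (LINT s:{0..t}|lborel. LINT p:S|lborel. w (s, p) * cnj (g p))
      \<and> set_integrable lborel {0..T} (\<lambda>s. LINT p:S|lborel. w (s, p) * cnj (g p))"
    if wL: "w \<in> L2 ({0..T} \<times> S)" and gL: "(\<lambda>(s, p). g p) \<in> L2 ({0..T} \<times> S)" and S: "S \<in> sets borel" and t: "t \<in> {0..T}" for w g t S
  proof -
    have 1: "set_integrable lborel ({0..T} \<times> S) (\<lambda>q. w q * cnj (case q of (s, p) \<Rightarrow> g p))"
      by (rule L2_mult_integrable[OF _ wL gL]) (intro borel_Times S, simp)
    have 2: "set_integrable lborel ({0..t} \<times> S) (\<lambda>q. w q * cnj (case q of (s, p) \<Rightarrow> g p))"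
      by (rule set_integrable_subset[OF 1]) (use t S in \<open>auto intro!: borel_Times\<close>)
    show ?thesis using set_integral_Times[OF 2] set_integrable_slice_integral[OF 1] by simp
  qed
  have \<phi>_cont: "continuous_on {0..T} \<phi>"
    unfolding continuous_on_def \<phi>_def
  proof
    fix t assume t: "t \<in> {0..T}"
    show "((\<lambda>t. L2_inner Omega (f t) h) \<longlongrightarrow> L2_inner Omega (f t) h) (at t within {0..T})"
      by (rule L2_inner_tendsto[OF Omega_borel _ fL(1)[OF t] h_L2(1) fL(2)[OF t]])
         (auto simp: eventually_at_filter fL)
  qed
  have \<phi>_int: "set_integrable lborel {0..T} \<phi>"
    unfolding set_integrable_def by (rule borel_integrable_compact[OF _ \<phi>_cont]) simp
  have T0: "(0::real) \<in> {0..T}" "T \<in> {0..T}" using T by auto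
  have U_int: "set_integrable lborel {0..T} U"
    unfolding U_def using slices[OF u hL(1) W(1) T0(2)] by blast
  have \<phi>_eq: "\<phi> t = L2_inner Omega f0 h + (LINT s:{0..t}|lborel. U s - lam * \<phi> s)" if t: "t \<in> {0..T}" for t
  proof -
    define X where "X s = L2_inner Omega (\<lambda>p. gx (s, p)) hx" for s
    define Y where "Y s = L2_inner Omega (\<lambda>p. gy (s, p)) hy" for s
    have sub: "set_integrable lborel {0..t} w" if "set_integrable lborel {0..T} w" for w :: "real \<Rightarrow> complex"
      by (rule set_integrable_subset[OF that]) (use t in auto)
    have XY: "set_integrable lborel {0..T} X" "set_integrable lborel {0..T} Y"
      unfolding X_def Y_def L2_inner_def
      using slices[OF g(1) hL(2) Omega_borel T0(2)] slices[OF g(2) hL(3) Omega_borel T0(2)] by blast+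
    have e1: "\<phi> t - L2_inner Omega f0 h + (LINT s:{0..t}|lborel. X s) + (LINT s:{0..t}|lborel. Y s) = (LINT s:{0..t}|lborel. U s)"
      using weak[OF in_form_domain t] slices[OF g(1) hL(2) Omega_borel t] slices[OF g(2) hL(3) Omega_borel t] slices[OF u hL(1) W(1) t]
      unfolding \<phi>_def X_def Y_def U_def L2_inner_def by simp
    have e2: "(LINT s:{0..t}|lborel. X s) + (LINT s:{0..t}|lborel. Y s) = (LINT s:{0..t}|lborel. X s + Y s)"
      by (rule set_integral_add(2)[symmetric]) (intro sub XY)+
    have e3: "(LINT s:{0..t}|lborel. X s + Y s) = (LINT s:{0..t}|lborel. lam * \<phi> s)"
      \<comment> \<open>The solution lies in the form domain for almost every time only, so the two
        integrands are compared almost everywhere.\<close>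
      unfolding set_lebesgue_integral_def
    proof (rule integral_cong_AE)
      show "(\<lambda>s. indicat_real {0..t} s *\<^sub>R (X s + Y s)) \<in> borel_measurable lborel"
        using set_integral_add(1)[OF sub[OF XY(1)] sub[OF XY(2)]] unfolding set_integrable_def by auto
      show "(\<lambda>s. indicat_real {0..t} s *\<^sub>R (lam * \<phi> s)) \<in> borel_measurable lborel"
        using sub[OF set_integrable_mult_right[OF \<phi>_int]] unfolding set_integrable_def by auto
      show "AE s in lborel. indicat_real {0..t} s *\<^sub>R (X s + Y s) = indicat_real {0..t} s *\<^sub>R (lam * \<phi> s)"
        using dom
      proof eventually_elim
        case (elim s)
        then show ?case using t weak_eigen[of "f s" "\<lambda>p. gx (s, p)" "\<lambda>p. gy (s, p)"]
          by (auto simp: indicator_def X_def Y_def \<phi>_def)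
      qed
    qed
    have e4: "(LINT s:{0..t}|lborel. U s - lam * \<phi> s) = (LINT s:{0..t}|lborel. U s) - (LINT s:{0..t}|lborel. lam * \<phi> s)"
      by (rule set_integral_diff(2)) (intro sub U_int set_integrable_mult_right \<phi>_int)+
    show ?thesis using e1 unfolding add.assoc e2 e3 e4 by (simp only: e4 algebra_simps)
  qed
  have "\<phi> T = 0"
    unfolding \<phi>_def L2_inner_def set_lebesgue_integral_def
    by (rule integral_eq_zero_AE) (use null in \<open>eventually_elim; auto simp: indicator_def\<close>)
  then have "L2_inner Omega f0 h + (LINT s:{0..T}|lborel. exp (lam * of_real s) * U s) = 0"
    using duhamel[OF less_imp_le[OF T] U_int \<phi>_int \<phi>_eq] by simp
  moreover have "(LINT q:{0..T} \<times> W|lborel. u q * (exp (lam * of_real (fst q)) * cnj (h (snd q)))) = (LINT s:{0..T}|lborel. exp (lam * of_real s) * U s)"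
  proof -
    have "set_integrable lborel ({0..T} \<times> W) (\<lambda>q. u q * cnj (cnj (exp (lam * of_real (fst q))) * h (snd q)))"
      by (intro L2_mult_integrable bor u continuous_L2 bnd continuous_intros continuous_mode_time h_cont)
    then have "set_integrable lborel ({0..T} \<times> W) (\<lambda>q. u q * (exp (lam * of_real (fst q)) * cnj (h (snd q))))" by simp
    moreover have "(LINT p:W|lborel. u (s, p) * (e * cnj (h p))) = e * U s" for s and e :: complex
      unfolding U_def by (subst set_integral_mult_right[symmetric]) (simp add: mult_ac)
    ultimately show ?thesis by (simp add: set_integral_Times)
  qed
  ultimately show ?thesis by simp
qed

lemma mode_inner:
  assumes g: "continuous_on UNIV g" "continuous_on UNIV g'"
  shows "L2_inner Omega (mode m g) (mode n g') = (if m = n then 2 * pi * (LINT x:{-1<..<1}|lborel. cnj (g x) * g' x) else 0)"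
proof -
  define w where "w y = exp (\<i> * (of_nat m - of_nat n) * of_real y)" for y :: real
  have oc: "osc m y * cnj (osc n y) = w y" for y
    unfolding cnj_osc unfolding osc_def w_def exp_add[symmetric] by (simp add: algebra_simps)
  have w_deriv: "(w has_vector_derivative \<i> * (of_nat m - of_nat n) * w y) (at y)" for y
  proof -
    have "((\<lambda>z. exp (\<i> * (of_nat m - of_nat n) * z)) has_field_derivative \<i> * (of_nat m - of_nat n) * exp (\<i> * (of_nat m - of_nat n) * of_real y)) (at (of_real y))"
      by (auto intro!: derivative_eq_intros)
    from vector_derivative_of_real[OF this] show ?thesis unfolding w_def [abs_def] .
  qed
  have w_cont: "continuous_on UNIV w"
    by (rule continuous_on_vector_derivative_at) (rule w_deriv)
  have wI: "(LINT y:{0..<2 * pi}|lborel. w y) = (if m = n then 2 * pi else 0)"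
  proof (cases "m = n")
    case True
    then have "w y = 1" for y by (simp add: w_def)
    moreover have "(LINT y:{0..<2 * pi}|lborel. (1::complex)) = of_real (2 * pi) - of_real 0"
      by (rule set_integral_FTC[of "\<lambda>y. of_real y"])
         (auto intro!: continuous_intros has_vector_derivative_of_real[OF DERIV_ident, simplified])
    ultimately show ?thesis using True by simp
  next
    case False
    have "(LINT y:{0..<2 * pi}|lborel. \<i> * (of_nat m - of_nat n) * w y) = w (2 * pi) - w 0"
      by (rule set_integral_FTC[OF w_deriv]) (auto intro!: continuous_intros w_cont)
    also have "w (2 * pi) = w 0"
      using osc_periodic[of m 0] osc_periodic[of n 0] by (simp add: oc[symmetric])
    finally show ?thesis using False by simp
  qed
  have "continuous_on UNIV (\<lambda>p. mode m g p * cnj (mode n g' p))"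
    by (intro continuous_intros continuous_mode g)
  from continuous_set_integrable[OF this Omega_borel Omega_bounded]
  have "set_integrable lborel ({-1<..<1} \<times> {0..<2 * pi}) (\<lambda>p. mode m g p * cnj (mode n g' p))"
    unfolding Omega_def .
  from set_integral_Times[OF this]
  have "L2_inner Omega (mode m g) (mode n g') = (LINT x:{-1<..<1}|lborel. LINT y:{0..<2 * pi}|lborel. (cnj (g x) * g' x) * w y)"
    unfolding L2_inner_def Omega_def by (simp add: mode_def oc[symmetric] mult_ac)
  then show ?thesis by (simp add: wI)
qed

section \<open>Geometry of the control region\<close>

lemma omega_borel: "omega a b \<in> sets borel"
proof -
  have "{p :: real \<times> real. \<exists>k::int. snd p + 2 * pi * of_int k \<in> {a..b}} = (\<Union>k::int. {p. a \<le> snd p + 2 * pi * of_int k} \<inter> {p. snd p + 2 * pi * of_int k \<le> b})"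
    by auto
  also have "\<dots> \<in> sets borel"
  proof -
    have "{p. a \<le> snd p + 2 * pi * of_int k} \<inter> {p :: real \<times> real. snd p + 2 * pi * of_int k \<le> b} \<in> sets borel" for k :: int
      by (intro borel_closed closed_Int closed_Collect_le continuous_intros)
    then show ?thesis by (intro sets.countable_UN') auto
  qed
  finally have "Omega - {p :: real \<times> real. \<exists>k::int. snd p + 2 * pi * of_int k \<in> {a..b}} \<in> sets borel"
    by (intro sets.Diff Omega_borel)
  moreover have "omega a b = Omega - {p. \<exists>k::int. snd p + 2 * pi * of_int k \<in> {a..b}}"
    by (auto simp: omega_def)
  ultimately show ?thesis by simp
qed

text \<open>Turned so that the midpoint c sits at 0, the angles outside [a, b] fill an interval
  centred at the antipode \<pi>, with half-length \<pi> - (b - a)/2. The antipode contributes the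
  sign (-1)^n.\<close>

lemma omega_angle:
  assumes p: "p \<in> omega a b"
  shows "\<exists>\<theta>. \<bar>\<theta>\<bar> \<le> pi - (b - a) / 2 \<and>
     (\<forall>n::nat. cnj (osc n (snd p)) * exp (\<i> * of_nat n * of_real ((a + b) / 2)) = (-1) ^ n * exp (- (\<i> * of_nat n * of_real \<theta>)))"
proof -
  define c where "c = (a + b) / 2"
  define y where "y = snd p"
  define k where "k = \<lfloor>(y - c) / (2 * pi)\<rfloor>"
  define \<theta> where "\<theta> = y - c - 2 * pi * of_int k - pi"
  have notin: "\<not> (y + 2 * pi * of_int j \<in> {a..b})" for j :: int
    using p by (auto simp: omega_def y_def)
  have k: "of_int k \<le> (y - c) / (2 * pi)" "(y - c) / (2 * pi) < of_int k + 1" unfolding k_def by linarith+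
  then have k': "2 * pi * of_int k \<le> y - c" "y - c < 2 * pi * of_int k + 2 * pi" by (simp_all add: field_simps)
  \<comment> \<open>Too close to c from above, y would fall into [a, b] after the shift by - k
    turns; too close to the next copy of c from below, after - k - 1 turns.\<close>
  have "\<theta> \<ge> - (pi - (b - a) / 2)"
  proof (rule ccontr)
    assume "\<not> ?thesis"
    then have "y + 2 * pi * of_int (- k) \<in> {a..b}" using k'(1) by (simp add: \<theta>_def c_def field_simps)
    then show False using notin by blast
  qed
  moreover have "\<theta> \<le> pi - (b - a) / 2"
  proof (rule ccontr)
    assume "\<not> ?thesis"
    then have "y + 2 * pi * of_int (- k - 1) \<in> {a..b}" using k'(2) by (simp add: \<theta>_def c_def field_simps)
    then show False using notin by blast
  qed
  moreover have "cnj (osc n y) * exp (\<i> * of_nat n * of_real c) = (-1) ^ n * exp (- (\<i> * of_nat n * of_real \<theta>))" for n :: nat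
  proof -
    have "exp (- (\<i> * of_real pi)) ^ n = (-1 :: complex) ^ n" by (simp add: exp_minus)
    then have 1: "exp (- (of_nat n * (\<i> * of_real pi))) = (-1 :: complex) ^ n" by (simp add: exp_of_nat_mult[symmetric])
    have 2: "exp (- (2 * of_int (int n * k) * of_real pi * \<i>)) = (1 :: complex)"
      unfolding exp_eq_1 by (auto intro!: exI[of _ "- (int n * k)"])
    have "cnj (osc n y) * exp (\<i> * of_nat n * of_real c)
      = exp (- (of_nat n * (\<i> * of_real pi))) * exp (- (2 * of_int (int n * k) * of_real pi * \<i>)) * exp (- (\<i> * of_nat n * of_real \<theta>))"
      unfolding cnj_osc exp_add[symmetric] by (simp add: \<theta>_def algebra_simps)
    then show ?thesis unfolding 1 2 by simp
  qed
  ultimately show ?thesis unfolding c_def y_def by (intro exI[of _ \<theta>]) (auto simp: abs_le_iff)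
qed

lemma set_integral_weighted_sum:
  fixes g :: "'i \<Rightarrow> 'a \<Rightarrow> complex"
  assumes "\<And>i. i \<in> I \<Longrightarrow> set_integrable M S (g i)"
  shows "(\<Sum>i\<in>I. w i * (LINT x:S|M. g i x)) = (LINT x:S|M. \<Sum>i\<in>I. w i * g i x)"
proof -
  have "(\<Sum>i\<in>I. w i * (LINT x:S|M. g i x)) = (\<Sum>i\<in>I. (LINT x|M. w i * (indicator S x *\<^sub>R g i x)))"
    by (simp only: set_lebesgue_integral_def integral_mult_right_zero)
  also have "\<dots> = (LINT x|M. (\<Sum>i\<in>I. w i * (indicator S x *\<^sub>R g i x)))"
    using assms unfolding set_integrable_def by (intro Bochner_Integration.integral_sum[symmetric] integrable_mult_right) auto
  finally show ?thesis by (simp add: set_lebesgue_integral_def scaleR_sum_right)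
qed

theorem proposition27:
  fixes T a b \<alpha> :: real
  assumes "T > 0" and "a < b" and "b < a + 2 * pi" and "\<alpha> > 0"
  shows "\<exists>f\<in>analytic_space \<alpha>. \<not> steerable_to_zero T (omega a b) f"
proof -
  define \<delta> where "\<delta> = (b - a) / 2"
  define c where "c = (a + b) / 2"
  \<comment> \<open>Since \<open>v\<^sub>n\<close> is bounded by 2 e^n, the n-th coefficient will be
    at most 2 e^(-(\<alpha> + 1) n), one unit better than the weight of the analytic class.\<close>
  define \<beta> where "\<beta> = \<alpha> + 2"
  \<comment> \<open>Total growth rate in Re N: \<beta> + 1 = \<alpha> + 3 from the summation weight,
    1 from the eigenfunction, T from the exponential in time.\<close>
  define L where "L = \<alpha> + T + 4"
  define k where "k = max 1 (2 * (L + 1) / \<delta>)"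
  have \<delta>: "\<delta> > 0" "\<delta> < pi" using assms by (auto simp: \<delta>_def)
  have L: "L \<ge> 0" using assms by (simp add: L_def)
  have k: "k \<ge> 1" "\<delta> / 2 * k \<ge> L + 1"
  proof -
    show "k \<ge> 1" by (simp add: k_def)
    have "2 * (L + 1) / \<delta> \<le> k" by (simp add: k_def)
    then show "\<delta> / 2 * k \<ge> L + 1" using \<delta> by (simp add: field_simps)
  qed
  obtain R \<mu> where R: "R \<ge> 1" and \<mu>_hol: "\<mu> holomorphic_on sector R k"
    and \<mu>: "\<And>N. N \<in> sector R k \<Longrightarrow> norm (\<mu> N) \<le> 1" and \<mu>_root: "\<And>N. N \<in> sector R k \<Longrightarrow> wr N (\<mu> N) 1 = 0"
    using eigenvalue_correction[of k] k(1) by (metis less_le_trans zero_less_one)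
  \<comment> \<open>R + 1 places the whole contour in the sector where \<mu> exists; 4 is required
    by the lower bound of the eigenfunction near 0.\<close>
  define n0 where "n0 = max 4 (nat \<lceil>R + 1\<rceil>)"
  have n0: "real n0 \<ge> R + 1" "n0 \<ge> 4" unfolding n0_def by linarith+
  obtain C where C: "C > 0" and lind: "\<And>\<epsilon>. 0 < \<epsilon> \<Longrightarrow> \<epsilon> \<le> \<delta> / pi \<Longrightarrow> \<exists>M0. \<forall>M\<ge>M0. \<forall>B. \<forall>\<Psi>\<in>exp_type R k L \<delta> B.
     norm (\<Sum>n=n0..M. (-1) ^ n * (\<Psi> (of_nat n) * of_real (damping \<epsilon> n))) \<le> C * B"
    using lindelof_bound[OF L \<delta>(1) k n0(1) R] by blast
  define vn where "vn n = efun (of_nat n) (\<mu> (of_nat n))" for n :: nat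
  define lam where "lam n = of_nat n + \<mu> (of_nat n)" for n :: nat
  have sec: "of_nat n \<in> sector R k" if "n \<ge> n0" for n
    using that n0 R k by (auto simp: sector_def)
  have dm: "dirichlet_mode n (lam n) (vn n) (efun' (of_nat n) (\<mu> (of_nat n)))" if "n \<ge> n0" for n
    using efun_deriv efun'_deriv efun_boundary[OF \<mu>_root[OF sec[OF that]]]
    by unfold_locales (auto simp: vn_def lam_def)
  have vn_cont: "continuous_on S (vn n)" for S n
    unfolding vn_def by (rule continuous_on_vector_derivative_at) (rule efun_deriv)
  have vn_bound: "norm (vn n x) \<le> 2 * exp (real n)" if "n \<ge> n0" "\<bar>x\<bar> \<le> 1" for n x
    using efun_bound[of "of_nat n" "\<mu> (of_nat n)" x] \<mu>[OF sec[OF that(1)]] that n0 by (simp add: vn_def)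
  \<comment> \<open>Frequencies below n0 are left out because no eigenfunction has been constructed
    there. The phase moves the centre of the Fourier series to the midpoint c.\<close>
  define bn where "bn n = (if n < n0 then 0 else of_real (exp (- (\<beta> * real n))) * exp (- (\<i> * of_nat n * of_real c)))" for n :: nat
  have norm_bn: "norm (bn n) = (if n < n0 then 0 else exp (- (\<beta> * real n)))" for n
    by (simp add: bn_def norm_mult norm_exp_eq_Re)
  define A where "A n x = bn n * cnj (vn n x)" for n x
  have A_bound: "norm (A n x) \<le> 2 * exp (- ((\<alpha> + 1) * real n))" if "\<bar>x\<bar> \<le> 1" for n x
  proof (cases "n < n0")
    case False
    have "norm (A n x) \<le> exp (- (\<beta> * real n)) * (2 * exp (real n))"
      unfolding A_def norm_mult norm_bn using vn_bound[of n x] that False by simp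
    also have "\<dots> = 2 * exp (- ((\<alpha> + 1) * real n))"
      by (simp add: exp_add[symmetric] \<beta>_def algebra_simps)
    finally show ?thesis .
  qed (simp add: A_def bn_def)
  have A_cont: "continuous_on UNIV (A n)" for n
    unfolding A_def [abs_def] by (intro continuous_intros vn_cont)
  define trm where "trm n p = A n (fst p) * osc n (snd p)" for n p
  have trm_mode: "trm n p = bn n * mode n (vn n) p" for n p by (simp add: trm_def A_def mode_def)
  have trm_cont: "continuous_on UNIV (trm n)" for n
    unfolding trm_mode [abs_def] by (intro continuous_intros continuous_mode vn_cont)
  have geo: "summable (\<lambda>n. 2 * exp (- 1 :: real) ^ n)" by (intro summable_mult summable_geometric) simp
  have trm_bound: "norm (trm n p) \<le> 2 * exp (- 1) ^ n" if "p \<in> Omega" for n p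
  proof -
    have "norm (trm n p) = norm (A n (fst p))" by (simp add: trm_def norm_mult)
    also have "\<dots> \<le> 2 * exp (- ((\<alpha> + 1) * real n))" using that by (intro A_bound) (auto simp: Omega_def)
    also have "\<dots> \<le> 2 * exp (of_nat n * (- 1))" using assms by (simp add: algebra_simps)
    also have "\<dots> = 2 * exp (- 1) ^ n" unfolding exp_of_nat_mult ..
    finally show ?thesis .
  qed
  define f0 where "f0 p = (\<Sum>n. trm n p)" for p
  define P where "P M p = (\<Sum>n<M. trm n p)" for M p
  define K where "K = (\<Sum>n. 2 * exp (- 1 :: real) ^ n)"
  have sm: "summable (\<lambda>n. norm (trm n p))" if "p \<in> Omega" for p
    by (rule summable_comparison_test'[OF geo, of 0]) (use trm_bound[OF that] in simp)
  have P_lim: "(\<lambda>M. P M p) \<longlonglongrightarrow> f0 p" if "p \<in> Omega" for p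
    unfolding P_def f0_def by (rule summable_LIMSEQ[OF summable_norm_cancel[OF sm[OF that]]])
  have f0_bound: "norm (f0 p) \<le> K" if "p \<in> Omega" for p
    unfolding f0_def K_def
    by (rule order_trans[OF summable_norm[OF sm[OF that]] suminf_le[OF trm_bound[OF that] sm[OF that] geo]])
  have P_bound: "norm (P M p) \<le> K" if "p \<in> Omega" for M p
  proof -
    have "norm (P M p) \<le> (\<Sum>n<M. 2 * exp (- 1) ^ n)" unfolding P_def by (rule sum_norm_le) (rule trm_bound[OF that])
    also have "\<dots> \<le> K" unfolding K_def by (rule sum_le_suminf[OF geo]) auto
    finally show ?thesis .
  qed
  have P_cont: "continuous_on UNIV (P M)" for M unfolding P_def [abs_def] by (intro continuous_intros trm_cont)
  have P_L2: "P M \<in> L2 Omega" for M by (intro continuous_L2 P_cont Omega_borel Omega_bounded)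
  have f0_L2: "f0 \<in> L2 Omega"
    unfolding L2_iff[OF Omega_borel]
  proof
    have "(\<lambda>p. indicat_real Omega p *\<^sub>R f0 p) \<in> borel_measurable lborel"
    proof (rule borel_measurable_LIMSEQ_metric)
      show "(\<lambda>p. indicat_real Omega p *\<^sub>R P M p) \<in> borel_measurable lborel" for M
        using P_L2[of M] unfolding L2_iff[OF Omega_borel] set_borel_measurable_def by auto
      show "(\<lambda>M. indicat_real Omega p *\<^sub>R P M p) \<longlonglongrightarrow> indicat_real Omega p *\<^sub>R f0 p" for p
        using P_lim[of p] by (cases "p \<in> Omega") auto
    qed
    then show m: "set_borel_measurable lborel Omega f0" unfolding set_borel_measurable_def .
    show "set_integrable lborel Omega (\<lambda>p. (norm (f0 p))\<^sup>2)"
    proof (rule set_integrable_bound)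
      show "set_integrable lborel Omega (\<lambda>p. K\<^sup>2)"
        by (intro continuous_set_integrable continuous_intros Omega_borel Omega_bounded)
      have "(\<lambda>p. (norm (indicat_real Omega p *\<^sub>R f0 p))\<^sup>2) \<in> borel_measurable lborel"
        using m unfolding set_borel_measurable_def by measurable
      also have "(\<lambda>p. (norm (indicat_real Omega p *\<^sub>R f0 p))\<^sup>2) = (\<lambda>p. indicat_real Omega p *\<^sub>R (norm (f0 p))\<^sup>2)"
        by (auto simp: indicator_def)
      finally show "set_borel_measurable lborel Omega (\<lambda>p. (norm (f0 p))\<^sup>2)" unfolding set_borel_measurable_def .
      show "AE p in lborel. p \<in> Omega \<longrightarrow> norm ((norm (f0 p))\<^sup>2) \<le> norm (K\<^sup>2)"
        using f0_bound by (intro AE_I2 impI) (auto intro!: power_mono)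
    qed
  qed
  have P_tendsto: "L2_tendsto Omega P f0 sequentially"
  proof (rule L2_tendsto_bounded[OF Omega_borel Omega_bounded P_L2 f0_L2])
    show "norm (P M p - f0 p) \<le> K + K" if "p \<in> Omega" for M p
      using norm_triangle_ineq4[of "P M p" "f0 p"] P_bound[OF that, of M] f0_bound[OF that] by linarith
  qed (rule P_lim)
  have analytic: "f0 \<in> analytic_space \<alpha>"
    unfolding analytic_space_def mem_Collect_eq
  proof (intro conjI exI[of _ A] f0_L2 allI)
    show AL: "A n \<in> L2 {-1<..<1}" for n by (intro continuous_L2 A_cont) auto
    show "summable (\<lambda>n. L2_normsq {-1<..<1} (A n) * exp (2 * \<alpha> * real n))"
    proof (rule summable_comparison_test'[of "\<lambda>n. 8 * exp (- 2 :: real) ^ n" 0])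
      show "summable (\<lambda>n. 8 * exp (- 2 :: real) ^ n)" by (intro summable_mult summable_geometric) simp
      show "norm (L2_normsq {-1<..<1} (A n) * exp (2 * \<alpha> * real n)) \<le> 8 * exp (- 2) ^ n" for n
      proof -
        have "L2_normsq {-1<..<1} (A n) \<le> (LINT x:{-1<..<1::real}|lborel. 4 * exp (- (2 * (\<alpha> + 1) * real n)))"
          unfolding L2_normsq_def
        proof (rule set_integral_mono)
          show "set_integrable lborel {-1<..<1} (\<lambda>x. (norm (A n x))\<^sup>2)" using AL[of n] by (simp add: L2_iff)
          show "set_integrable lborel {-1<..<1::real} (\<lambda>x. 4 * exp (- (2 * (\<alpha> + 1) * real n)))"
            by (rule continuous_set_integrable) (auto intro!: continuous_intros)
          fix x :: real assume "x \<in> {-1<..<1}"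
          then have "(norm (A n x))\<^sup>2 \<le> (2 * exp (- ((\<alpha> + 1) * real n)))\<^sup>2" by (intro power_mono A_bound) auto
          also have "\<dots> = 4 * exp (- (2 * (\<alpha> + 1) * real n))"
            by (simp add: power_mult_distrib exp_double[symmetric] algebra_simps)
          finally show "(norm (A n x))\<^sup>2 \<le> 4 * exp (- (2 * (\<alpha> + 1) * real n))" .
        qed
        also have "\<dots> = 8 * exp (- (2 * (\<alpha> + 1) * real n))" by (subst set_integral_const) auto
        finally have "L2_normsq {-1<..<1} (A n) * exp (2 * \<alpha> * real n) \<le> 8 * exp (- (2 * (\<alpha> + 1) * real n)) * exp (2 * \<alpha> * real n)"
          by (rule mult_right_mono) simp
        also have "\<dots> = 8 * exp (of_nat n * (- 2))" by (simp add: exp_add[symmetric] algebra_simps)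
        also have "\<dots> = 8 * exp (- 2) ^ n" unfolding exp_of_nat_mult ..
        finally show ?thesis
          unfolding L2_normsq_def set_lebesgue_integral_def by (subst real_norm_def, subst abs_of_nonneg) auto
      qed
    qed
    have "(\<lambda>N (x, y). \<Sum>n<N. A n x * exp (\<i> * of_nat n * of_real y)) = P"
      by (auto simp: P_def trm_def osc_def fun_eq_iff)
    then show "L2_tendsto Omega (\<lambda>N (x, y). \<Sum>n<N. A n x * exp (\<i> * of_nat n * of_real y)) f0 sequentially"
      using P_tendsto by simp
  qed
  define G where "G n = (LINT x:{-1<..<1}|lborel. (norm (vn n x))\<^sup>2)" for n
  have inner: "L2_inner Omega f0 (mode n (vn n)) = bn n * of_real (2 * pi * G n)" for n
  proof -
    have hL: "mode n (vn n) \<in> L2 Omega" by (intro continuous_L2 continuous_mode vn_cont Omega_borel Omega_bounded)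
    \<comment> \<open>By orthogonality in y the inner product with the partial sum is constant from
      M = n + 1 on, so the limit is immediate.\<close>
    have "L2_inner Omega (P M) (mode n (vn n)) = bn n * of_real (2 * pi * G n)" if M: "M \<ge> Suc n" for M
    proof -
      have "L2_inner Omega (P M) (mode n (vn n)) = (LINT p:Omega|lborel. \<Sum>m<M. bn m * (mode m (vn m) p * cnj (mode n (vn n) p)))"
        unfolding L2_inner_def P_def trm_mode by (simp add: sum_distrib_right mult.assoc)
      also have "\<dots> = (\<Sum>m<M. bn m * L2_inner Omega (mode m (vn m)) (mode n (vn n)))"
        unfolding L2_inner_def
        by (intro set_integral_weighted_sum[symmetric] L2_mult_integrable[OF Omega_borel _ hL] continuous_L2 continuous_mode vn_cont Omega_borel Omega_bounded)
      also have "\<dots> = (\<Sum>m<M. if m = n then bn n * (2 * pi * (LINT x:{-1<..<1}|lborel. cnj (vn n x) * vn n x)) else 0)"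
        by (intro sum.cong refl) (simp add: mode_inner[OF vn_cont vn_cont])
      also have "\<dots> = bn n * (2 * pi * (LINT x:{-1<..<1}|lborel. cnj (vn n x) * vn n x))" using M by simp
      also have "(LINT x:{-1<..<1}|lborel. cnj (vn n x) * vn n x) = of_real (G n)"
      proof -
        have "cnj z * z = of_real ((norm z)\<^sup>2)" for z by (metis complex_norm_square mult.commute)
        then show ?thesis unfolding G_def by (simp only: set_integral_complex_of_real)
      qed
      finally show ?thesis by simp
    qed
    then have "\<forall>\<^sub>F M in sequentially. L2_inner Omega (P M) (mode n (vn n)) = bn n * of_real (2 * pi * G n)"
      by (auto simp: eventually_sequentially)
    then have "(\<lambda>M. L2_inner Omega (P M) (mode n (vn n))) \<longlonglongrightarrow> bn n * of_real (2 * pi * G n)"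
      by (rule tendsto_eventually)
    moreover have "(\<lambda>M. L2_inner Omega (P M) (mode n (vn n))) \<longlonglongrightarrow> L2_inner Omega f0 (mode n (vn n))"
      by (rule L2_inner_tendsto[OF Omega_borel _ f0_L2 hL P_tendsto]) (simp add: P_L2)
    ultimately show ?thesis by (rule LIMSEQ_unique[symmetric])
  qed
  have G_nonneg: "G n \<ge> 0" for n
    unfolding G_def set_lebesgue_integral_def by (intro integral_nonneg_AE) auto
  have G_lower: "1 / (16 * real n) \<le> G n" if n: "n \<ge> n0" for n
  proof -
    have n4: "real n \<ge> 4" using n n0 by simp
    then have n1: "1 / real n < 1" by simp
    have vi: "set_integrable lborel {-1<..<1} (\<lambda>x. (norm (vn n x))\<^sup>2)"
      by (rule continuous_set_integrable) (auto intro!: continuous_intros vn_cont)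
    have "(LINT x:{0..1 / real n}|lborel. 1 / 16) \<le> G n"
      unfolding G_def set_lebesgue_integral_def
    proof (rule integral_mono)
      show "integrable lborel (\<lambda>x. indicat_real {0..1 / real n} x *\<^sub>R (1 / 16 :: real))"
        using continuous_set_integrable[of "\<lambda>_. 1 / 16 :: real" "{0..1 / real n}"] by (simp add: set_integrable_def)
      show "integrable lborel (\<lambda>x. indicat_real {-1<..<1} x *\<^sub>R (norm (vn n x))\<^sup>2)" using vi unfolding set_integrable_def .
      show "indicat_real {0..1 / real n} x *\<^sub>R (1 / 16) \<le> indicat_real {-1<..<1} x *\<^sub>R (norm (vn n x))\<^sup>2" for x
      proof (cases "x \<in> {0..1 / real n}")
        case True
        then have "1 / 4 \<le> norm (vn n x)"
          unfolding vn_def using efun_lower_bound[OF n4 \<mu>[OF sec[OF n]]] by simp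
        then have "(1 / 4)\<^sup>2 \<le> (norm (vn n x))\<^sup>2" by (intro power_mono) auto
        then show ?thesis using True n1 by (simp add: power2_eq_square)
      next
        case False
        show ?thesis unfolding indicator_simps(2)[OF False] by simp
      qed
    qed
    also have "(LINT x:{0..1 / real n}|lborel. 1 / 16) = 1 / (16 * real n)"
      using n4 by (subst set_integral_const) auto
    finally show ?thesis .
  qed

  \<comment> \<open>Contradiction with a steering control\<close>
  have "\<not> steerable_to_zero T (omega a b) f0"
  proof
    assume "steerable_to_zero T (omega a b) f0"
    then obtain u f where u: "u \<in> L2 ({0..T} \<times> omega a b)" and sol: "grushin_solution T (omega a b) u f0 f"
      and null: "AE p\<in>Omega in lborel. f T p = 0"
      unfolding steerable_to_zero_def by blast
    define Q where "Q = {0..T} \<times> omega a b"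
    have W: "omega a b \<in> sets borel" "omega a b \<subseteq> Omega" using omega_borel by (auto simp: omega_def)
    have Q: "Q \<in> sets borel" "bounded Q"
      unfolding Q_def using W bounded_subset[OF Omega_bounded W(2)] by (auto intro!: borel_Times bounded_Times)
    note u = u[folded Q_def]
    define \<Theta> where "\<Theta> n q = u q * (exp (lam n * of_real (fst q)) * cnj (mode n (vn n) (snd q)))" for n q
    have \<Theta>_int: "set_integrable lborel Q (\<Theta> n)" for n
    proof -
      have "set_integrable lborel Q (\<lambda>q. u q * cnj (cnj (exp (lam n * of_real (fst q))) * mode n (vn n) (snd q)))"
        by (intro L2_mult_integrable Q u continuous_L2 continuous_intros continuous_mode_time continuous_mode vn_cont)
      then show ?thesis by (simp add: \<Theta>_def [abs_def])
    qed
    have moment: "bn n * of_real (2 * pi * G n) + (LINT q:Q|lborel. \<Theta> n q) = 0" if n: "n \<ge> n0" for n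
    proof -
      interpret D: dirichlet_mode n "lam n" "vn n" "efun' (of_nat n) (\<mu> (of_nat n))" by (rule dm[OF n])
      show ?thesis
        using D.moment_identity[OF assms(1) W u[unfolded Q_def] f0_L2 sol null]
        unfolding D.h_def inner Q_def[symmetric] \<Theta>_def .
    qed
    have u_int: "set_integrable lborel Q (\<lambda>q. norm (u q))"
    proof -
      have "set_integrable lborel Q (\<lambda>q. u q * cnj 1)"
        by (intro L2_mult_integrable Q u continuous_L2 continuous_intros)
      then show ?thesis by (intro set_integrable_norm) simp
    qed
    \<comment> \<open>The 2 comes from the eigenfunction bound, and e^T from Re \<mu> \<le> 1 in the
      exponential in time.\<close>
    define B where "B = 2 * exp T"
    define K' where "K' = (LINT q:Q|lborel. norm (u q)) * (C * B)"
    \<comment> \<open>The bound K' involves neither m nor the damping, while the left side grows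
      exponentially in m.\<close>
    have main: "exp (real m - 1) * (2 * pi * G m) \<le> K'" if m: "m \<ge> n0" for m
    proof -
      \<comment> \<open>The damping is adapted to m: at the m-th term it costs at most a factor
        e.\<close>
      define \<epsilon> where "\<epsilon> = min (\<delta> / pi) (1 / (real m * ln (real m) + 1))"
      have m4: "real m \<ge> 4" using m n0 by simp
      then have mln: "real m * ln (real m) \<ge> 0" by simp
      have \<epsilon>: "\<epsilon> > 0" "\<epsilon> \<le> \<delta> / pi" using \<delta> mln by (auto simp: \<epsilon>_def)
      have \<epsilon>m: "\<epsilon> * real m * ln (real m) \<le> 1"
      proof -
        have "\<epsilon> * (real m * ln (real m)) \<le> 1 / (real m * ln (real m) + 1) * (real m * ln (real m))"
          using mln by (intro mult_right_mono) (auto simp: \<epsilon>_def)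
        also have "\<dots> \<le> 1" using mln by (simp add: field_simps)
        finally show ?thesis by (simp add: mult.assoc)
      qed
      from lind[OF \<epsilon>] obtain M0 where M0: "\<forall>M\<ge>M0. \<forall>B. \<forall>\<Psi>\<in>exp_type R k L \<delta> B.
         norm (\<Sum>n=n0..M. (-1) ^ n * (\<Psi> (of_nat n) * of_real (damping \<epsilon> n))) \<le> C * B"
        by (rule exE)
      define M where "M = max M0 m"
      define d where "d = damping \<epsilon>"
      define w where "w n = of_real (exp ((\<beta> + 1) * real n) * d n) * exp (\<i> * of_nat n * of_real c)" for n :: nat
      have sum_bound: "norm (\<Sum>n=n0..M. w n * \<Theta> n q) \<le> norm (u q) * (C * B)" if q: "q \<in> Q" for q
      proof -
        define s where "s = fst q"
        define x where "x = fst (snd q)"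
        have s: "0 \<le> s" "s \<le> T" and qw: "snd q \<in> omega a b" using q by (auto simp: Q_def s_def)
        then have x: "\<bar>x\<bar> \<le> 1" using W(2) by (force simp: Omega_def x_def)
        obtain \<theta> where \<theta>: "\<bar>\<theta>\<bar> \<le> pi - \<delta>" and ang: "\<And>n::nat. cnj (osc n (snd (snd q))) * exp (\<i> * of_nat n * of_real c) = (-1) ^ n * exp (- (\<i> * of_nat n * of_real \<theta>))"
          using omega_angle[OF qw] unfolding \<delta>_def c_def by blast
        \<comment> \<open>The summand at the fixed point q, without the control and the sign, with n
          replaced by the complex N throughout, including the eigenvalue and the
          eigenfunction.\<close>
        define \<Psi> where "\<Psi> N = exp (of_real (\<beta> + 1) * N) * exp (- (\<i> * N * of_real \<theta>)) * efun N (\<mu> N) x * exp ((N + \<mu> N) * of_real s)" for N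
        have \<Psi>_hol: "\<Psi> holomorphic_on sector R k"
          unfolding \<Psi>_def by (intro holomorphic_intros efun_holomorphic open_sector \<mu>_hol)
        have \<Psi>_bound: "norm (\<Psi> N) \<le> B * exp (L * Re N + (pi - \<delta>) * \<bar>Im N\<bar>)" if N: "N \<in> sector R k" for N
        proof -
          have ReN: "Re N \<ge> 1" using N R by (auto simp: sector_def)
          have 1: "norm (exp (of_real (\<beta> + 1) * N)) = exp ((\<beta> + 1) * Re N)" by (simp add: norm_exp_eq_Re)
          have "\<theta> * Im N \<le> \<bar>\<theta>\<bar> * \<bar>Im N\<bar>" by (metis abs_ge_self abs_mult)
          also have "\<dots> \<le> (pi - \<delta>) * \<bar>Im N\<bar>" using \<theta> by (intro mult_right_mono) auto
          finally have 2: "norm (exp (- (\<i> * N * of_real \<theta>))) \<le> exp ((pi - \<delta>) * \<bar>Im N\<bar>)"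
            by (simp add: norm_exp_eq_Re mult.commute)
          have 3: "norm (efun N (\<mu> N) x) \<le> 2 * exp (Re N)" by (rule efun_bound[OF ReN \<mu>[OF N] x])
          have "Re (\<mu> N) \<le> 1" using complex_Re_le_cmod[of "\<mu> N"] \<mu>[OF N] by linarith
          then have "(Re N + Re (\<mu> N)) * s \<le> (Re N + 1) * s" using s by (intro mult_right_mono) auto
          also have "\<dots> \<le> (Re N + 1) * T" using s ReN by (intro mult_left_mono) auto
          finally have 4: "norm (exp ((N + \<mu> N) * of_real s)) \<le> exp ((Re N + 1) * T)"
            by (simp add: norm_exp_eq_Re)
          have "norm (\<Psi> N) \<le> exp ((\<beta> + 1) * Re N) * exp ((pi - \<delta>) * \<bar>Im N\<bar>) * (2 * exp (Re N)) * exp ((Re N + 1) * T)"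
            unfolding \<Psi>_def norm_mult 1 by (intro mult_mono 2 3 4) auto
          also have "\<dots> = B * (exp ((\<beta> + 1) * Re N + (pi - \<delta>) * \<bar>Im N\<bar> + Re N + Re N * T))"
            by (simp add: B_def exp_add[symmetric] algebra_simps)
          also have "(\<beta> + 1) * Re N + (pi - \<delta>) * \<bar>Im N\<bar> + Re N + Re N * T = L * Re N + (pi - \<delta>) * \<bar>Im N\<bar>"
            by (simp add: L_def \<beta>_def algebra_simps)
          finally show ?thesis .
        qed
        have "w n * \<Theta> n q = u q * ((-1) ^ n * (\<Psi> (of_nat n) * of_real (d n)))" for n
        proof -
          have "w n * \<Theta> n q = u q * (of_real (exp ((\<beta> + 1) * real n)) * of_real (d n) * exp (lam n * of_real s) * vn n x *
              (cnj (osc n (snd (snd q))) * exp (\<i> * of_nat n * of_real c)))"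
            by (simp add: w_def \<Theta>_def mode_def s_def x_def)
          also have "\<dots> = u q * ((-1) ^ n * (\<Psi> (of_nat n) * of_real (d n)))"
            unfolding ang by (simp add: \<Psi>_def vn_def lam_def exp_of_real[symmetric])
          finally show ?thesis .
        qed
        then have "(\<Sum>n=n0..M. w n * \<Theta> n q) = u q * (\<Sum>n=n0..M. (-1) ^ n * (\<Psi> (of_nat n) * of_real (d n)))"
          by (simp add: sum_distrib_left)
        moreover have "norm (\<Sum>n=n0..M. (-1) ^ n * (\<Psi> (of_nat n) * of_real (d n))) \<le> C * B"
          unfolding d_def by (rule M0[rule_format]) (use \<Psi>_hol \<Psi>_bound in \<open>auto simp: M_def exp_type_def\<close>)
        ultimately show ?thesis by (simp add: norm_mult mult_left_mono)
      qed
      have "(\<Sum>n=n0..M. w n * (bn n * of_real (2 * pi * G n))) = - (\<Sum>n=n0..M. w n * (LINT q:Q|lborel. \<Theta> n q))"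
        unfolding sum_negf[symmetric]
      proof (rule sum.cong[OF refl])
        fix n assume "n \<in> {n0..M}"
        then have "bn n * of_real (2 * pi * G n) = - (LINT q:Q|lborel. \<Theta> n q)"
          using moment[of n] by (simp add: eq_neg_iff_add_eq_0)
        then show "w n * (bn n * of_real (2 * pi * G n)) = - (w n * (LINT q:Q|lborel. \<Theta> n q))" by simp
      qed
      also have "(\<Sum>n=n0..M. w n * (LINT q:Q|lborel. \<Theta> n q)) = (LINT q:Q|lborel. \<Sum>n=n0..M. w n * \<Theta> n q)"
        by (rule set_integral_weighted_sum) (rule \<Theta>_int)
      finally have eq: "(\<Sum>n=n0..M. w n * (bn n * of_real (2 * pi * G n))) = - (LINT q:Q|lborel. \<Sum>n=n0..M. w n * \<Theta> n q)" .
      \<comment> \<open>The phases and the decay e^(-\<beta> n) cancel, and each term becomes a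
        nonnegative real number; this allows the m-th term to be isolated from the sum.\<close>
      have wb: "w n * (bn n * of_real (2 * pi * G n)) = of_real (exp (real n) * d n * (2 * pi * G n))" if "n \<in> {n0..M}" for n
      proof -
        have e1: "exp (\<i> * of_nat n * of_real c) * exp (- (\<i> * of_nat n * of_real c)) = (1 :: complex)"
          unfolding exp_add[symmetric] by simp
        have e2: "exp ((\<beta> + 1) * real n) * exp (- (\<beta> * real n)) = exp (real n)"
          unfolding exp_add[symmetric] by (simp add: algebra_simps)
        have "w n * (bn n * of_real (2 * pi * G n)) = (exp (\<i> * of_nat n * of_real c) * exp (- (\<i> * of_nat n * of_real c))) *
            of_real ((exp ((\<beta> + 1) * real n) * exp (- (\<beta> * real n))) * d n * (2 * pi * G n))"
          using that by (simp add: w_def bn_def)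
        then show ?thesis unfolding e1 e2 by simp
      qed
      have S_int: "set_integrable lborel Q (\<lambda>q. \<Sum>n=n0..M. w n * \<Theta> n q)"
        unfolding set_integrable_def scaleR_sum_right
        by (intro Bochner_Integration.integrable_sum) (use set_integrable_mult_right[OF \<Theta>_int] in \<open>simp add: set_integrable_def\<close>)
      have "norm (LINT q:Q|lborel. \<Sum>n=n0..M. w n * \<Theta> n q) \<le> (LINT q:Q|lborel. norm (\<Sum>n=n0..M. w n * \<Theta> n q))"
        by (rule set_integral_norm_bound[OF S_int])
      also have "\<dots> \<le> (LINT q:Q|lborel. norm (u q) * (C * B))"
        by (intro set_integral_mono set_integrable_norm S_int set_integrable_mult_left u_int sum_bound)
      also have "\<dots> = K'" by (simp add: K'_def)
      finally have "norm (\<Sum>n=n0..M. w n * (bn n * of_real (2 * pi * G n))) \<le> K'" unfolding eq by simp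
      also have "(\<Sum>n=n0..M. w n * (bn n * of_real (2 * pi * G n))) = of_real (\<Sum>n=n0..M. exp (real n) * d n * (2 * pi * G n))"
        unfolding of_real_sum by (rule sum.cong[OF refl wb])
      finally have S_le: "(\<Sum>n=n0..M. exp (real n) * d n * (2 * pi * G n)) \<le> K'"
        unfolding norm_of_real by linarith
      have "exp (real m - 1) * (2 * pi * G m) \<le> exp (real m) * d m * (2 * pi * G m)"
      proof (rule mult_right_mono)
        have "exp (real m - 1) \<le> exp (real m + - (\<epsilon> * real m * ln (real m)))" using \<epsilon>m by simp
        then show "exp (real m - 1) \<le> exp (real m) * d m" unfolding d_def damping_def exp_add .
      qed (use G_nonneg in simp)
      also have "\<dots> \<le> (\<Sum>n=n0..M. exp (real n) * d n * (2 * pi * G n))"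
        using m by (intro member_le_sum) (auto simp: M_def d_def damping_def G_nonneg)
      finally show ?thesis using S_le by linarith
    qed
    \<comment> \<open>With e^(m - 1) \<ge> m^2 / 6 and 2 \<pi> G(m) \<ge> 1 / (8 m), the uniform
      bound forces m / 48 \<le> K'.\<close>
    define m where "m = max n0 (nat \<lceil>48 * K'\<rceil> + 1)"
    have m: "m \<ge> n0" "real m > 48 * K'" "real m \<ge> 4" using n0(2) unfolding m_def by linarith+
    have "(real m)\<^sup>2 / 2 \<le> exp (real m)" by (rule exp_ge_half_square) simp
    also have "\<dots> = exp 1 * exp (real m - 1)" by (simp add: exp_add[symmetric])
    also have "\<dots> \<le> 3 * exp (real m - 1)" by (intro mult_right_mono exp_le) simp
    finally have 1: "(real m)\<^sup>2 / 6 \<le> exp (real m - 1)" by simp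
    have "1 / (16 * real m) * 2 \<le> G m * (2 * pi)"
      using G_lower[OF m(1)] G_nonneg[of m] pi_gt3 m by (intro mult_mono) auto
    then have 2: "1 / (8 * real m) \<le> 2 * pi * G m" by (simp add: mult_ac)
    have "(real m)\<^sup>2 / 6 * (1 / (8 * real m)) \<le> exp (real m - 1) * (2 * pi * G m)"
      using m by (intro mult_mono 1 2) auto
    also have "\<dots> \<le> K'" by (rule main[OF m(1)])
    finally have "real m / 48 \<le> K'" using m by (simp add: power2_eq_square)
    then show False using m by simp
  qed
  then show ?thesis using analytic by blast
qed

end
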